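(* Let $(X,J)$ be a lattice one-sided (skip-free downward) Markov additive process as described in the context, and for $m\ge0$ let $\Phi(m)$ be the matrix with entries $\Phi(m)_{ij}=\mathrm E_i[L_j(m,\tau_{m+1}^+)]$. For $m,l\ge1$ let $\mathrm P[\tau_m<\tau_{m+l}^+,J_{\tau_m}]$ and $\mathrm P[\tau_m=\tau_m^+,J_{\tau_m}]$ be the matrices with entries $\mathrm P_i[\tau_m<\tau_{m+l}^+,J_{\tau_m}=j]$ and $\mathrm P_i[\tau_m=\tau_m^+<\infty,J_{\tau_m}=j]$. Then, for all $m,l\ge1$, $$\mathrm P[\tau_m=\tau_m^+,J_{\tau_m}]=\Phi(m)\,\Phi(0)^{-1}$$ and $$\mathrm P[\tau_m<\tau_{m+l}^+,J_{\tau_m}]=\Big(\sum_{0\le i\le l-1}\Phi(m+i)R^i\Big)\Big(\sum_{0\le i\le l-1}\Phi(i)R^i\Big)^{-1}.$$ If moreover $A_{-1}$ (and hence $R$) is nonsingular, then with $W(k)=\Xi(k)R^{-k}$, where $\Xi(k)_{ij}=\mathrm E_i[L_j(0,\tau_k^+)]$ for $k\ge1$, $$\mathrm P[\tau_m<\tau_{m+l}^+,J_{\tau_m}]=\big(W(m+l)-W(m)R^{-l}\big)\,W(l)^{-1}.$$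
   Context: Setting. $E=\{1,\dots,N\}$ is finite. $(X_t,J_t)_{t\ge0}$ is a continuous-time Markov chain on $\mathbb Z\times E$, possibly killed, with transition rates that are translation-invariant in the level: for every $k$, $A_m$ is the $N\times N$ block of transition rates from level $k$ to level $k+m$, with $A_m=0$ for $m\le-2$. The diagonal of $A_0$ is strictly negative, all other rates are nonnegative. $Q=\sum_{m\ge-1}A_m$, the transition rate matrix of $J$, is irreducible with row sums $\le0$, and $\boldsymbol q=-Q\boldsymbol 1\ge0$ is the vector of killing rates, at which the process is sent to a cemetery state forever. The chain $(X,J)$ on $\mathbb Z\times E$ is assumed irreducible. $\mathrm P_i,\mathrm E_i$ refer to $X_0=0,J_0=i$. $\tau_x=\inf\{t\ge0:X_t=x\}$, $\tau_x^+=\inf\{t\ge0:X_t\ge x\}$, $L_j(x,t)=\int_0^t\mathbf 1\{X_s=x,J_s=j\}\,ds$. $R$ is the minimal nonnegative solution of $A_{-1}+RA_0+R^2A_1+R^3A_2+\cdots=0$; equivalently, for $k\ge1$, $(R^k)_{ij}=\mathrm E_i[L_j(-k,\tau'_0)]/\mathrm E_i[L_i(0,\tau_0')]$, where $\tau_0'=\inf\{t\ge\tau^*:X_t=0\}$ and $\tau^*$ is the first jump time of $(X,J)$. *)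

theory Defs
  imports "HOL-Probability.Probability"
begin

section \<open>Continuous-time Markov chains on a discrete state space\<close>

text \<open>
  A chain is specified, as usual, by its generator \<open>G\<close> (off-diagonal entries: transition rates;
  minus the diagonal entry: total exit rate), and a process is a chain with generator \<open>G\<close> if its
  sample paths are right-continuous and its jump chain and holding times have the prescribed
  joint law. The jump times of a path \<open>x\<close> are \<open>T\<^sub>0 = 0\<close> and
  \<open>T\<^sub>n\<^sub>+\<^sub>1 = inf {t \<ge> T\<^sub>n. x t \<noteq> x (T\<^sub>n)}\<close>, which is \<open>\<infinity>\<close> if \<open>x\<close> never leaves \<open>x (T\<^sub>n)\<close> or if
  \<open>T\<^sub>n = \<infinity>\<close>; in that case the jump chain stays where it is and the holding time is \<open>\<infinity>\<close>.
  Only the values \<open>x t\<close> with \<open>t \<ge> 0\<close> matter.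
\<close>

primrec jump_time :: "(real \<Rightarrow> 's) \<Rightarrow> nat \<Rightarrow> ereal" where
  "jump_time x 0 = 0"
| "jump_time x (Suc n) =
     (INF t\<in>{t. 0 \<le> t \<and> jump_time x n \<le> ereal t \<and> x t \<noteq> x (real_of_ereal (jump_time x n))}. ereal t)"

primrec jump_chain :: "(real \<Rightarrow> 's) \<Rightarrow> nat \<Rightarrow> 's" where
  "jump_chain x 0 = x 0"
| "jump_chain x (Suc n) =
     (if jump_time x (Suc n) = \<infinity> then jump_chain x n else x (real_of_ereal (jump_time x (Suc n))))"

definition holding_time :: "(real \<Rightarrow> 's) \<Rightarrow> nat \<Rightarrow> ereal" where
  "holding_time x n =
     (if jump_time x n = \<infinity> then \<infinity> else jump_time x (Suc n) - jump_time x n)"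

definition exit_rate :: "('s \<Rightarrow> 's \<Rightarrow> real) \<Rightarrow> 's \<Rightarrow> real" where
  "exit_rate G x = - G x x"

definition jump_prob :: "('s \<Rightarrow> 's \<Rightarrow> real) \<Rightarrow> 's \<Rightarrow> 's \<Rightarrow> real" where
  "jump_prob G x y =
     (if exit_rate G x = 0 then (if x = y then 1 else 0)
      else (if x = y then 0 else G x y / exit_rate G x))"

text \<open>
  The last conjunct says that the jump chain is a discrete-time Markov chain started at \<open>a\<close> with
  transition matrix \<open>jump_prob G\<close> and that, given the jump chain, the holding times are
  independent and exponential with parameter \<open>exit_rate G\<close> of the current state (the factor
  \<open>exp (- 0 * t) = 1\<close> meaning that an absorbing state is held forever).
\<close>

definition ctmc ::
  "'w measure \<Rightarrow> ('s \<Rightarrow> 's \<Rightarrow> real) \<Rightarrow> 's \<Rightarrow> (real \<Rightarrow> 'w \<Rightarrow> 's) \<Rightarrow> bool" where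
  "ctmc M G a X \<longleftrightarrow>
     prob_space M \<and>
     (\<forall>t\<ge>0. X t \<in> measurable M (count_space UNIV)) \<and>
     (\<forall>w\<in>space M. \<forall>t\<ge>0. eventually (\<lambda>s. X s w = X t w) (at_right t)) \<and>
     (\<forall>n y t. (\<forall>k\<le>n. 0 \<le> t k) \<longrightarrow>
        measure M {w\<in>space M. \<forall>k\<le>n. jump_chain (\<lambda>s. X s w) k = y k \<and>
                                    holding_time (\<lambda>s. X s w) k > ereal (t k)} =
        (if y 0 = a then 1 else 0) * (\<Prod>k<n. jump_prob G (y k) (y (Suc k))) *
        (\<Prod>k\<le>n. exp (- exit_rate G (y k) * t k)))"

definition irreducible_rates :: "('s \<Rightarrow> 's \<Rightarrow> real) \<Rightarrow> bool" where
  "irreducible_rates r \<longleftrightarrow> (\<forall>x y. (\<lambda>u v. r u v > 0)\<^sup>*\<^sup>* x y)"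


section \<open>Skip-free downward Markov additive processes on the lattice\<close>

text \<open>\<open>A m\<close> is the block of rates for changing the level by \<open>m\<close>; the phase space \<open>E\<close> is the
  finite type \<open>'n\<close>.\<close>

definition phase_gen :: "(int \<Rightarrow> real^'n^'n) \<Rightarrow> real^'n^'n" where
  "phase_gen A = (\<Sum>n. A (int n - 1))"

definition kill_rate :: "(int \<Rightarrow> real^'n^'n) \<Rightarrow> 'n \<Rightarrow> real" where
  "kill_rate A i = - (\<Sum>j\<in>UNIV. phase_gen A $ i $ j)"

definition level_rates :: "(int \<Rightarrow> real^'n^'n) \<Rightarrow> int \<times> 'n \<Rightarrow> int \<times> 'n \<Rightarrow> real" where
  "level_rates A = (\<lambda>(k, i) (l, j). A (l - k) $ i $ j)"

text \<open>The state \<open>None\<close> is the cemetery.\<close>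

fun map_gen :: "(int \<Rightarrow> real^'n^'n) \<Rightarrow> (int \<times> 'n) option \<Rightarrow> (int \<times> 'n) option \<Rightarrow> real" where
  "map_gen A (Some u) (Some v) = level_rates A u v"
| "map_gen A (Some u) None = kill_rate A (snd u)"
| "map_gen A None v = 0"

definition skipfree_blocks :: "(int \<Rightarrow> real^'n^'n) \<Rightarrow> bool" where
  "skipfree_blocks A \<longleftrightarrow>
     (\<forall>m\<le>-2. A m = 0) \<and>
     (\<forall>i. A 0 $ i $ i < 0) \<and>
     (\<forall>m i j. m \<noteq> 0 \<or> i \<noteq> j \<longrightarrow> 0 \<le> A m $ i $ j) \<and>
     summable (\<lambda>n. A (int n - 1)) \<and>
     (\<forall>i. 0 \<le> kill_rate A i) \<and>
     irreducible_rates (\<lambda>i j. phase_gen A $ i $ j) \<and>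
     irreducible_rates (level_rates A)"

text \<open>\<open>P i\<close> is the law under which the chain starts in level \<open>0\<close> and phase \<open>i\<close>.\<close>

definition lattice_MAP ::
  "(int \<Rightarrow> real^'n^'n) \<Rightarrow> ('n \<Rightarrow> 'w measure) \<Rightarrow> (real \<Rightarrow> 'w \<Rightarrow> (int \<times> 'n) option) \<Rightarrow> bool" where
  "lattice_MAP A P X \<longleftrightarrow>
     skipfree_blocks A \<and> (\<forall>i. ctmc (P i) (map_gen A) (Some (0, i)) X)"


section \<open>Passage times, local times and the associated matrices\<close>

text \<open>\<open>tau\<close> is the hitting time of a level and \<open>tau_up\<close> is the first passage time over it;
  the infimum of the empty set is \<open>\<infinity>\<close>, and the cemetery has no level.\<close>

definition tau :: "int \<Rightarrow> (real \<Rightarrow> (int \<times> 'n) option) \<Rightarrow> ereal" where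
  "tau m x = (INF t\<in>{t. 0 \<le> t \<and> (\<exists>j. x t = Some (m, j))}. ereal t)"

definition tau_up :: "int \<Rightarrow> (real \<Rightarrow> (int \<times> 'n) option) \<Rightarrow> ereal" where
  "tau_up m x = (INF t\<in>{t. 0 \<le> t \<and> (\<exists>k j. x t = Some (k, j) \<and> m \<le> k)}. ereal t)"

definition local_time :: "'n \<Rightarrow> int \<Rightarrow> ereal \<Rightarrow> (real \<Rightarrow> (int \<times> 'n) option) \<Rightarrow> ennreal" where
  "local_time j m T x =
     (\<integral>\<^sup>+s\<in>{s. 0 \<le> s \<and> ereal s \<le> T}. indicator {s. x s = Some (m, j)} s \<partial>lborel)"

text \<open>\<open>E\<^sub>i [L\<^sub>j (m, \<tau>\<^sub>k\<^sup>+)]\<close>\<close>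

definition mean_local_time ::
  "('n \<Rightarrow> 'w measure) \<Rightarrow> (real \<Rightarrow> 'w \<Rightarrow> (int \<times> 'n) option) \<Rightarrow> int \<Rightarrow> int \<Rightarrow> 'n \<Rightarrow> 'n \<Rightarrow> ennreal"
  where
  "mean_local_time P X m k i j =
     (\<integral>\<^sup>+w. local_time j m (tau_up k (\<lambda>t. X t w)) (\<lambda>t. X t w) \<partial>P i)"

definition Phi ::
  "('n \<Rightarrow> 'w measure) \<Rightarrow> (real \<Rightarrow> 'w \<Rightarrow> (int \<times> 'n) option) \<Rightarrow> nat \<Rightarrow> real^'n^'n" where
  "Phi P X m = (\<chi> i j. enn2real (mean_local_time P X (int m) (int m + 1) i j))"

definition Xi ::
  "('n \<Rightarrow> 'w measure) \<Rightarrow> (real \<Rightarrow> 'w \<Rightarrow> (int \<times> 'n) option) \<Rightarrow> nat \<Rightarrow> real^'n^'n" where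
  "Xi P X k = (\<chi> i j. enn2real (mean_local_time P X 0 (int k) i j))"

definition phase_at :: "(real \<Rightarrow> (int \<times> 'n) option) \<Rightarrow> ereal \<Rightarrow> 'n \<Rightarrow> bool" where
  "phase_at x T j \<longleftrightarrow> T < \<infinity> \<and> (\<exists>k. x (real_of_ereal T) = Some (k, j))"

definition hit_before_mat ::
  "('n \<Rightarrow> 'w measure) \<Rightarrow> (real \<Rightarrow> 'w \<Rightarrow> (int \<times> 'n) option) \<Rightarrow> nat \<Rightarrow> nat \<Rightarrow> real^'n^'n" where
  "hit_before_mat P X m n = (\<chi> i j. measure (P i)
     {w\<in>space (P i). tau (int m) (\<lambda>t. X t w) < tau_up (int n) (\<lambda>t. X t w) \<and>
                     phase_at (\<lambda>t. X t w) (tau (int m) (\<lambda>t. X t w)) j})"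

definition hit_exact_mat ::
  "('n \<Rightarrow> 'w measure) \<Rightarrow> (real \<Rightarrow> 'w \<Rightarrow> (int \<times> 'n) option) \<Rightarrow> nat \<Rightarrow> real^'n^'n" where
  "hit_exact_mat P X m = (\<chi> i j. measure (P i)
     {w\<in>space (P i). tau (int m) (\<lambda>t. X t w) = tau_up (int m) (\<lambda>t. X t w) \<and>
                     phase_at (\<lambda>t. X t w) (tau (int m) (\<lambda>t. X t w)) j})"

text \<open>Powers with respect to the matrix product (\<open>^\<close> on vectors is the componentwise power).\<close>

definition matpow :: "real^'n^'n \<Rightarrow> nat \<Rightarrow> real^'n^'n" where
  "matpow B k = (((**) B) ^^ k) (mat 1)"

text \<open>\<open>A\<^sub>-\<^sub>1 + R A\<^sub>0 + R\<^sup>2 A\<^sub>1 + \<dots> = 0\<close>\<close>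

definition nonneg_solution :: "(int \<Rightarrow> real^'n^'n) \<Rightarrow> real^'n^'n \<Rightarrow> bool" where
  "nonneg_solution A R \<longleftrightarrow>
     (\<forall>i j. 0 \<le> R $ i $ j) \<and> (\<lambda>n. matpow R n ** A (int n - 1)) sums 0"

definition minimal_nonneg_solution :: "(int \<Rightarrow> real^'n^'n) \<Rightarrow> real^'n^'n \<Rightarrow> bool" where
  "minimal_nonneg_solution A R \<longleftrightarrow>
     nonneg_solution A R \<and> (\<forall>R'. nonneg_solution A R' \<longrightarrow> (\<forall>i j. R $ i $ j \<le> R' $ i $ j))"

definition scale_W ::
  "('n \<Rightarrow> 'w measure) \<Rightarrow> (real \<Rightarrow> 'w \<Rightarrow> (int \<times> 'n) option) \<Rightarrow> real^'n^'n \<Rightarrow> nat \<Rightarrow> real^'n^'n"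
  where
  "scale_W P X R k = Xi P X k ** matpow (matrix_inv R) k"

end

theory Submission
  imports Defs
begin

text \<open>
  The proof turns every quantity into a Green kernel of the jump chain and decomposes paths at
  suitable visits.

  Since the exit rates depend on the phase only, they are bounded, the chain does not explode, and
  almost every path is determined by its jump chain and holding times (\<open>AE_regular_path\<close>).
  Therefore the law of the first entrance into a set (\<open>hitting_law\<close>) and the expected time spent in
  a state before such an entrance (\<open>mean_occupation_time\<close>) are expressed by \<open>green p B\<close>, the
  expected numbers of visits of the jump chain before its exit from \<open>B\<close>; local times carry the
  additional factor \<open>1 / q\<close> of mean holding times. In particular \<open>Phi m\<close> and \<open>Xi l\<close> are, up to this
  factor, Green kernels of the chain killed on passing above a level. They are finite because every
  state can reach arbitrarily high levels (\<open>green_finite\<close>).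

  Three decompositions yield the theorem. (1) A path that visits level \<open>m\<close> before passing above
  \<open>m + l\<close> is split at its first visit to \<open>m\<close>. By translation invariance the expected local time in
  level \<open>m\<close> is then the passage matrix times \<open>Xi l\<close>, and likewise \<open>Phi m\<close> is the matrix of
  \<open>tau m = tau_up m\<close> times \<open>Phi 0\<close> (\<open>Lt_first_entrance\<close>). The same decomposition with \<open>m = 0\<close>
  exhibits an inverse of \<open>Xi l\<close> (\<open>Lt_invertible\<close>). (2) The same path is split at its last visit to
  the highest level \<open>m + i\<close> it reaches. The first part contributes \<open>Phi (m + i)\<close>, the second one
  descends by \<open>i\<close> levels without coming back; summing over \<open>i < l\<close> gives
  \<open>\<Sum>i<l. Phi (m + i) R\<^sup>i\<close> (\<open>Lt_sum\<close>). For \<open>m = 0\<close> this sum is \<open>Xi l\<close>. (3) That descents by \<open>i\<close>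
  levels are described by \<open>R\<^sup>i\<close> uses that the chain visits every level in between (\<open>N_Suc\<close>) and that
  the matrix \<open>Rs\<close> of local times during a descent by one level is the minimal nonnegative solution
  of the equation for \<open>R\<close>: decomposing at the last step shows that it is a solution
  (\<open>Rs_solution\<close>), and it is dominated by all others (\<open>N_le_solution\<close>), since Green kernels are
  least solutions.

  If \<open>A (-1)\<close> is invertible, so is \<open>R\<close> (\<open>nonneg_solution_invertible\<close>), and the last formula is a
  rearrangement of the previous one (\<open>scale_function_quotient\<close>).
\<close>

section \<open>Taboo Green kernels\<close>
text \<open>A kernel is a matrix with rows and columns indexed by the states and entries in \<open>[0, \<infinity>]\<close>. Sums over
states are integrals against the counting measure, so that they exist and may be interchanged
without side conditions.\<close>
definition kmul :: "('s \<Rightarrow> 's \<Rightarrow> ennreal) \<Rightarrow> ('s \<Rightarrow> 's \<Rightarrow> ennreal) \<Rightarrow> 's \<Rightarrow> 's \<Rightarrow> ennreal"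
    (infixl "\<odot>" 70) where
  "(K \<odot> L) u v = (\<integral>\<^sup>+z. K u z * L z v \<partial>count_space UNIV)"

definition kadd :: "('s \<Rightarrow> 's \<Rightarrow> ennreal) \<Rightarrow> ('s \<Rightarrow> 's \<Rightarrow> ennreal) \<Rightarrow> 's \<Rightarrow> 's \<Rightarrow> ennreal"
    (infixl "\<oplus>" 65) where
  "(K \<oplus> L) u v = K u v + L u v"

definition kid :: "'s \<Rightarrow> 's \<Rightarrow> ennreal" where
  "kid u v = (if u = v then 1 else 0)"

primrec kpow :: "('s \<Rightarrow> 's \<Rightarrow> ennreal) \<Rightarrow> nat \<Rightarrow> 's \<Rightarrow> 's \<Rightarrow> ennreal" where
  "kpow K 0 = kid"
| "kpow K (Suc n) = kpow K n \<odot> K"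

text \<open>The Neumann series \<open>\<Sum>n. K\<^sup>n\<close>.\<close>
definition ksum :: "('s \<Rightarrow> 's \<Rightarrow> ennreal) \<Rightarrow> 's \<Rightarrow> 's \<Rightarrow> ennreal" where
  "ksum K u v = (\<Sum>n. kpow K n u v)"

text \<open>Only the steps into \<open>B\<close> are kept; the state that is left is not restricted.\<close>
definition restr :: "('s \<Rightarrow> 's \<Rightarrow> ennreal) \<Rightarrow> 's set \<Rightarrow> 's \<Rightarrow> 's \<Rightarrow> ennreal" where
  "restr p B u v = p u v * indicator B v"

text \<open>\<open>green p B u v\<close> is the expected number of visits to \<open>v\<close> of the chain with transition kernel \<open>p\<close>
started at \<open>u\<close>, up to its first exit from \<open>B\<close>. Time 0 is always counted, and \<open>u\<close> need not lie in
\<open>B\<close>: the taboo takes effect with the first step. This convention makes excursions that leave a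
set immediately directly expressible.\<close>
definition green :: "('s \<Rightarrow> 's \<Rightarrow> ennreal) \<Rightarrow> 's set \<Rightarrow> 's \<Rightarrow> 's \<Rightarrow> ennreal" where
  "green p B = ksum (restr p B)"

lemma nn_integral_count_space_single:
  "(\<integral>\<^sup>+z. f z * (if z = v then 1 else 0) \<partial>count_space UNIV) = (f v :: ennreal)"
proof -
  have "(\<integral>\<^sup>+z. f z * (if z = v then 1 else 0) \<partial>count_space UNIV)
      = (\<integral>\<^sup>+z. f v * indicator {v} z \<partial>count_space UNIV)"
    by (intro nn_integral_cong) (auto simp: indicator_def)
  then show ?thesis by (simp add: nn_integral_cmult_indicator)
qed

lemma kmul_kid_right [simp]: "K \<odot> kid = K"
  by (intro ext) (simp add: kmul_def kid_def nn_integral_count_space_single)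

lemma kmul_kid_left [simp]: "kid \<odot> K = K"
proof (intro ext)
  fix u v
  have "(kid \<odot> K) u v = (\<integral>\<^sup>+z. K z v * (if z = u then 1 else 0) \<partial>count_space UNIV)"
    unfolding kmul_def kid_def by (intro nn_integral_cong) auto
  then show "(kid \<odot> K) u v = K u v" by (simp add: nn_integral_count_space_single)
qed

lemma kmul_assoc: "(K \<odot> L) \<odot> M = K \<odot> (L \<odot> M)"
proof (intro ext)
  fix u v
  let ?c = "count_space UNIV"
  have "((K \<odot> L) \<odot> M) u v = (\<integral>\<^sup>+z. \<integral>\<^sup>+y. K u y * L y z * M z v \<partial>?c \<partial>?c)"
    unfolding kmul_def by (intro nn_integral_cong, subst nn_integral_multc) auto
  also have "\<dots> = (\<integral>\<^sup>+y. \<integral>\<^sup>+z. K u y * L y z * M z v \<partial>?c \<partial>?c)"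
    using nn_integral_fst_count_space[of "\<lambda>(z,y). K u y * L y z * M z v"]
          nn_integral_snd_count_space[of "\<lambda>(z,y). K u y * L y z * M z v"] by simp
  also have "\<dots> = (K \<odot> (L \<odot> M)) u v"
    unfolding kmul_def
    by (intro nn_integral_cong, subst nn_integral_cmult[symmetric]) (auto simp: mult.assoc)
  finally show "((K \<odot> L) \<odot> M) u v = (K \<odot> (L \<odot> M)) u v" .
qed

lemma kmul_add_left: "(K \<oplus> L) \<odot> M = (K \<odot> M) \<oplus> (L \<odot> M)"
  by (intro ext) (simp add: kmul_def kadd_def distrib_right nn_integral_add)

lemma kmul_add_right: "K \<odot> (L \<oplus> M) = (K \<odot> L) \<oplus> (K \<odot> M)"
  by (intro ext) (simp add: kmul_def kadd_def distrib_left nn_integral_add)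

lemma kadd_assoc: "(K \<oplus> L) \<oplus> M = K \<oplus> (L \<oplus> M)"
  by (intro ext) (simp add: kadd_def add.assoc)

lemma kadd_commute: "K \<oplus> L = L \<oplus> K"
  by (intro ext) (simp add: kadd_def add.commute)

lemma kmul_mono: "K \<le> K' \<Longrightarrow> L \<le> L' \<Longrightarrow> K \<odot> L \<le> K' \<odot> L'"
  unfolding kmul_def le_fun_def by (auto intro!: nn_integral_mono mult_mono)

lemma kadd_mono: "K \<le> K' \<Longrightarrow> L \<le> L' \<Longrightarrow> K \<oplus> L \<le> K' \<oplus> L'"
  unfolding kadd_def le_fun_def by (auto intro!: add_mono)

lemma kpow_Suc_left: "kpow K (Suc n) = K \<odot> kpow K n"
  by (induction n) (simp_all add: kmul_assoc)

lemma ksum_right: "kid \<oplus> (ksum K \<odot> K) = ksum K"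
proof (intro ext)
  fix u v
  have "(ksum K \<odot> K) u v = (\<Sum>n. kpow K (Suc n) u v)"
    unfolding ksum_def kmul_def kpow.simps by (simp add: nn_integral_suminf flip: ennreal_suminf_multc)
  then show "(kid \<oplus> (ksum K \<odot> K)) u v = ksum K u v"
    unfolding ksum_def kadd_def by (simp add: suminf_offset[of "\<lambda>n. kpow K n u v" 1] add.commute)
qed

lemma ksum_left: "kid \<oplus> (K \<odot> ksum K) = ksum K"
proof (intro ext)
  fix u v
  have "(K \<odot> ksum K) u v = (\<Sum>n. kpow K (Suc n) u v)"
    unfolding ksum_def kmul_def kpow_Suc_left by (simp add: nn_integral_suminf flip: ennreal_suminf_cmult)
  then show "(kid \<oplus> (K \<odot> ksum K)) u v = ksum K u v"
    unfolding ksum_def kadd_def by (simp add: suminf_offset[of "\<lambda>n. kpow K n u v" 1] add.commute)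
qed

text \<open>\<open>ksum K \<odot> F\<close> is the least solution of \<open>H = F + K H\<close>. Leastness, here and in the mirrored version,
is the only property of the Neumann series behind the two resolvent identities.\<close>
lemma ksum_least_left:
  assumes "F \<oplus> (K \<odot> H) \<le> H"
  shows "ksum K \<odot> F \<le> H"
proof (intro le_funI)
  fix u v
  have partial: "(\<Sum>n<T. (kpow K n \<odot> F) u v) \<le> H u v" for T u v
  proof (induction T arbitrary: u v)
    case (Suc T)
    have "(\<Sum>n<Suc T. (kpow K n \<odot> F) u v) = F u v + (\<Sum>n<T. (K \<odot> (kpow K n \<odot> F)) u v)"
      by (subst sum.lessThan_Suc_shift) (simp add: kpow_Suc_left kmul_assoc del: kpow.simps(2))
    also have "(\<Sum>n<T. (K \<odot> (kpow K n \<odot> F)) u v) = (\<integral>\<^sup>+z. K u z * (\<Sum>n<T. (kpow K n \<odot> F) z v) \<partial>count_space UNIV)"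
      unfolding kmul_def[of K] by (subst nn_integral_sum[symmetric]) (auto simp: sum_distrib_left)
    also have "\<dots> \<le> (K \<odot> H) u v"
      unfolding kmul_def[of K H] by (intro nn_integral_mono mult_left_mono Suc.IH) simp
    also have "F u v + (K \<odot> H) u v \<le> H u v"
      using assms by (simp add: kadd_def le_fun_def)
    finally show ?case by (simp add: add_left_mono)
  qed simp
  have "(ksum K \<odot> F) u v = (\<Sum>n. (kpow K n \<odot> F) u v)"
    unfolding ksum_def kmul_def by (simp add: nn_integral_suminf flip: ennreal_suminf_multc)
  also have "\<dots> \<le> H u v"
    by (rule suminf_le_const[OF summableI partial])
  finally show "(ksum K \<odot> F) u v \<le> H u v" .
qed

lemma ksum_least_right:
  assumes "F \<oplus> (H \<odot> K) \<le> H"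
  shows "F \<odot> ksum K \<le> H"
proof (intro le_funI)
  fix u v
  have partial: "(\<Sum>n<T. (F \<odot> kpow K n) u v) \<le> H u v" for T u v
  proof (induction T arbitrary: u v)
    case (Suc T)
    have "(\<Sum>n<Suc T. (F \<odot> kpow K n) u v) = F u v + (\<Sum>n<T. ((F \<odot> kpow K n) \<odot> K) u v)"
      by (subst sum.lessThan_Suc_shift) (simp add: kmul_assoc)
    also have "(\<Sum>n<T. ((F \<odot> kpow K n) \<odot> K) u v) = (\<integral>\<^sup>+z. (\<Sum>n<T. (F \<odot> kpow K n) u z) * K z v \<partial>count_space UNIV)"
      unfolding kmul_def[of _ K] by (subst nn_integral_sum[symmetric]) (auto simp: sum_distrib_right)
    also have "\<dots> \<le> (H \<odot> K) u v"
      unfolding kmul_def[of H K] by (intro nn_integral_mono mult_right_mono Suc.IH) simp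
    also have "F u v + (H \<odot> K) u v \<le> H u v"
      using assms by (simp add: kadd_def le_fun_def)
    finally show ?case by (simp add: add_left_mono)
  qed simp
  have "(F \<odot> ksum K) u v = (\<Sum>n. (F \<odot> kpow K n) u v)"
    unfolding ksum_def kmul_def by (simp add: nn_integral_suminf flip: ennreal_suminf_cmult)
  also have "\<dots> \<le> H u v"
    by (rule suminf_le_const[OF summableI partial])
  finally show "(F \<odot> ksum K) u v \<le> H u v" .
qed

lemma ksum_fix_left: "F \<oplus> (K \<odot> (ksum K \<odot> F)) = ksum K \<odot> F"
  by (metis ksum_left kmul_add_left kmul_assoc kmul_kid_left)

lemma ksum_fix_right: "F \<oplus> ((F \<odot> ksum K) \<odot> K) = F \<odot> ksum K"
  by (metis ksum_right kmul_add_right kmul_assoc kmul_kid_right)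

lemma ksum_resolvent_left:
  "ksum (K \<oplus> L) = ksum K \<oplus> (ksum K \<odot> (L \<odot> ksum (K \<oplus> L)))"
proof -
  let ?G = "ksum (K \<oplus> L)"
  let ?F = "kid \<oplus> (L \<odot> ?G)"
  \<comment> \<open>\<open>?H\<close> and \<open>?G\<close> each satisfy the inequality whose least solution is the other one.\<close>
  let ?H = "ksum K \<odot> ?F"
  have "?F \<oplus> (K \<odot> ?G) = ?G"
    using ksum_left[of "K \<oplus> L"] by (metis kadd_assoc kadd_commute kmul_add_left)
  then have le: "?H \<le> ?G" by (intro ksum_least_left) simp
  have "kid \<oplus> ((K \<oplus> L) \<odot> ?H) = (kid \<oplus> (L \<odot> ?H)) \<oplus> (K \<odot> ?H)"
    by (metis kadd_assoc kadd_commute kmul_add_left)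
  also have "\<dots> \<le> ?F \<oplus> (K \<odot> ?H)"
    using le by (intro kadd_mono kmul_mono order_refl)
  also have "\<dots> = ?H" by (rule ksum_fix_left)
  finally have "?G \<odot> kid \<le> ?H" by (rule ksum_least_left)
  with le have "?G = ?H" by simp
  then show ?thesis by (simp add: kmul_add_right)
qed

lemma ksum_resolvent_right:
  "ksum (K \<oplus> L) = ksum K \<oplus> (ksum (K \<oplus> L) \<odot> (L \<odot> ksum K))"
proof -
  let ?G = "ksum (K \<oplus> L)"
  let ?F = "kid \<oplus> (?G \<odot> L)"
  let ?H = "?F \<odot> ksum K"
  have "?F \<oplus> (?G \<odot> K) = ?G"
    using ksum_right[of "K \<oplus> L"] by (metis kadd_assoc kadd_commute kmul_add_right)
  then have le: "?H \<le> ?G" by (intro ksum_least_right) simp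
  have "kid \<oplus> (?H \<odot> (K \<oplus> L)) = (kid \<oplus> (?H \<odot> L)) \<oplus> (?H \<odot> K)"
    by (metis kadd_assoc kadd_commute kmul_add_right)
  also have "\<dots> \<le> ?F \<oplus> (?H \<odot> K)"
    using le by (intro kadd_mono kmul_mono order_refl)
  also have "\<dots> = ?H" by (rule ksum_fix_right)
  finally have "kid \<odot> ?G \<le> ?H" by (rule ksum_least_right)
  with le have "?G = ?H" by simp
  then show ?thesis by (simp add: kmul_add_left kmul_assoc)
qed

lemma restr_Un: "B \<inter> C = {} \<Longrightarrow> restr p (B \<union> C) = restr p B \<oplus> restr p C"
  by (intro ext) (auto simp: restr_def kadd_def indicator_def)

lemma kmul_restr: "(K \<odot> restr p B) u v = (K \<odot> p) u v * indicator B v"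
  unfolding kmul_def restr_def by (simp add: mult.assoc[symmetric] nn_integral_multc)

lemma green_unfold: "green p B u v = kid u v + (green p B \<odot> p) u v * indicator B v"
  using ksum_right[of "restr p B"] unfolding green_def
  by (metis kadd_def kmul_restr)

lemma green_notin: "v \<notin> B \<Longrightarrow> green p B u v = kid u v"
  by (subst green_unfold) simp

lemma green_self_ge_1: "1 \<le> green p B v v"
  by (subst green_unfold) (simp add: kid_def)

text \<open>Decomposition of a path to \<open>v \<in> C\<close> at its first entrance into \<open>C\<close>.\<close>
lemma green_first_entrance:
  assumes "B \<inter> C = {}" "v \<in> C"
  shows "green p (B \<union> C) u v =
    kid u v + (\<integral>\<^sup>+y. (green p B \<odot> p) u y * green p (B \<union> C) y v * indicator C y \<partial>count_space UNIV)"
proof -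
  have "green p (B \<union> C) u v
      = green p B u v + ((green p B \<odot> restr p C) \<odot> green p (B \<union> C)) u v"
    using ksum_resolvent_left[of "restr p B" "restr p C"] assms(1)
    unfolding green_def by (metis kadd_def kmul_assoc restr_Un)
  also have "green p B u v = kid u v"
    using assms by (intro green_notin) auto
  also have "((green p B \<odot> restr p C) \<odot> green p (B \<union> C)) u v =
      (\<integral>\<^sup>+y. (green p B \<odot> p) u y * green p (B \<union> C) y v * indicator C y \<partial>count_space UNIV)"
    unfolding kmul_def[of "green p B \<odot> restr p C"] kmul_restr by (simp add: ac_simps)
  finally show ?thesis .
qed

text \<open>Decomposition of a path at its last visit to \<open>C\<close>.\<close>
lemma green_last_exit:
  assumes "B \<inter> C = {}" "u \<notin> C"
  shows "green p (B \<union> C) u v =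
    green p B u v + (\<integral>\<^sup>+y. green p (B \<union> C) u y * green p B y v * indicator C y \<partial>count_space UNIV)"
proof -
  have "green p (B \<union> C) u v
      = green p B u v + ((green p (B \<union> C) \<odot> restr p C) \<odot> green p B) u v"
    using ksum_resolvent_right[of "restr p B" "restr p C"] assms(1)
    unfolding green_def by (metis kadd_def kmul_assoc restr_Un)
  also have "((green p (B \<union> C) \<odot> restr p C) \<odot> green p B) u v =
      (\<integral>\<^sup>+y. green p (B \<union> C) u y * green p B y v * indicator C y \<partial>count_space UNIV)"
    unfolding kmul_def[of "green p (B \<union> C) \<odot> restr p C"]
  proof (intro nn_integral_cong)
    fix y
    have "y \<in> C \<Longrightarrow> green p (B \<union> C) u y = (green p (B \<union> C) \<odot> p) u y"
      using assms by (subst green_unfold) (auto simp: kid_def)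
    then show "(green p (B \<union> C) \<odot> restr p C) u y * green p B y v
        = green p (B \<union> C) u y * green p B y v * indicator C y"
      by (cases "y \<in> C") (simp_all add: kmul_restr)
  qed
  finally show ?thesis .
qed

lemma green_last_visit:
  assumes "v \<in> B"
  shows "green p B v w = green p B v v * green p (B - {v}) v w"
proof -
  let ?g = "green p (B - {v})"
  have B: "(B - {v}) \<union> {v} = B" and disj: "(B - {v}) \<inter> {v} = {}" using assms by auto
  have "green p B v w = ?g v w + ((green p B \<odot> restr p {v}) \<odot> ?g) v w"
    using ksum_resolvent_right[of "restr p (B - {v})" "restr p {v}"] restr_Un[OF disj, of p]
    unfolding green_def by (metis B kadd_def kmul_assoc)
  also have "((green p B \<odot> restr p {v}) \<odot> ?g) v w =
      (\<integral>\<^sup>+y. (green p B \<odot> p) v v * ?g v w * indicator {v} y \<partial>count_space UNIV)"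
    unfolding kmul_def[of "green p B \<odot> restr p {v}"] kmul_restr
    by (intro nn_integral_cong) (auto simp: indicator_def)
  also have "\<dots> = (green p B \<odot> p) v v * ?g v w"
    by (subst nn_integral_cmult_indicator) auto
  also have "?g v w + (green p B \<odot> p) v v * ?g v w = green p B v v * ?g v w"
    using assms by (subst (2) green_unfold) (simp add: kid_def distrib_right)
  finally show ?thesis .
qed

lemma green_closed:
  assumes D: "\<And>u v. u \<in> D \<Longrightarrow> v \<in> B \<Longrightarrow> v \<notin> D \<Longrightarrow> p u v = 0"
    and "u \<in> D" "v \<notin> D"
  shows "green p B u v = 0"
proof -
  have "kpow (restr p B) n u v = 0" if "v \<notin> D" for n v
    using that
  proof (induction n arbitrary: v)
    case 0 then show ?case using assms(2) by (auto simp: kid_def)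
  next
    case (Suc n)
    have "kpow (restr p B) n u z * restr p B z v = 0" for z
    proof (cases "z \<in> D")
      case True
      then have "restr p B z v = 0"
        using D[of z v] Suc.prems by (auto simp: restr_def indicator_def)
      then show ?thesis by simp
    qed (simp add: Suc.IH)
    then have "(\<lambda>z. kpow (restr p B) n u z * restr p B z v) = (\<lambda>_. 0)" by blast
    then show ?case by (simp add: kmul_def del: mult_eq_0_iff)
  qed
  then show ?thesis using assms(3) by (simp add: green_def ksum_def)
qed

lemma green_bij:
  assumes "bij \<sigma>" and p: "\<And>u v. p (\<sigma> u) (\<sigma> v) = p u v"
  shows "green p (\<sigma> ` B) (\<sigma> u) (\<sigma> v) = green p B u v"
proof -
  have inj: "inj \<sigma>" using assms(1) by (rule bij_is_inj)
  have "kpow (restr p (\<sigma> ` B)) n (\<sigma> u) (\<sigma> v) = kpow (restr p B) n u v" for n u v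
  proof (induction n arbitrary: v)
    case 0 show ?case using inj by (simp add: kid_def inj_eq)
  next
    case (Suc n)
    have "kpow (restr p (\<sigma> ` B)) (Suc n) (\<sigma> u) (\<sigma> v) = 
      (\<integral>\<^sup>+z. kpow (restr p (\<sigma> ` B)) n (\<sigma> u) (\<sigma> z) * restr p (\<sigma> ` B) (\<sigma> z) (\<sigma> v) \<partial>count_space UNIV)"
      by (simp add: kmul_def)
         (rule nn_integral_bij_count_space[symmetric, OF assms(1)])
    also have "\<dots> = kpow (restr p B) (Suc n) u v"
      unfolding Suc.IH using inj
      by (simp add: kmul_def restr_def p indicator_def inj_image_mem_iff)
    finally show ?case .
  qed
  then show ?thesis by (simp add: green_def ksum_def)
qed

text \<open>The probability, starting at \<open>u\<close>, that the chain moves from \<open>B\<close> (or from \<open>u\<close> itself) into \<open>D\<close>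
before any other departure from \<open>B\<close>, for \<open>D\<close> disjoint from \<open>B\<close>. The dummy second argument makes the inner function a kernel.\<close>
definition exit_prob :: "('s \<Rightarrow> 's \<Rightarrow> ennreal) \<Rightarrow> 's set \<Rightarrow> 's set \<Rightarrow> 's \<Rightarrow> ennreal" where
  "exit_prob p B D u = (green p B \<odot> (\<lambda>z _. \<integral>\<^sup>+w. p z w * indicator D w \<partial>count_space UNIV)) u u"

lemma exit_prob_le_1:
  assumes p: "\<And>u. (\<integral>\<^sup>+v. p u v \<partial>count_space UNIV) \<le> 1" and "B \<inter> D = {}"
  shows "exit_prob p B D u \<le> 1"
proof -
  let ?F = "\<lambda>z (_::'a). \<integral>\<^sup>+w. p z w * indicator D w \<partial>count_space UNIV"
  have "?F \<oplus> (restr p B \<odot> (\<lambda>_ _. 1)) \<le> (\<lambda>_ _. 1)"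
  proof (intro le_funI)
    fix u v
    have "(?F \<oplus> (restr p B \<odot> (\<lambda>_ _. 1))) u v =
       (\<integral>\<^sup>+w. p u w * indicator D w + p u w * indicator B w \<partial>count_space UNIV)"
      by (simp add: kadd_def kmul_def restr_def nn_integral_add)
    also have "\<dots> \<le> (\<integral>\<^sup>+w. p u w \<partial>count_space UNIV)"
      using assms(2) by (intro nn_integral_mono) (auto simp: indicator_def)
    finally show "(?F \<oplus> (restr p B \<odot> (\<lambda>_ _. 1))) u v \<le> 1" using p[of u] by order
  qed
  then have "ksum (restr p B) \<odot> ?F \<le> (\<lambda>_ _. 1)" by (rule ksum_least_left)
  then show ?thesis by (simp add: exit_prob_def green_def le_fun_def)
qed

lemma exit_prob_eq:
  "exit_prob p B D u = (\<integral>\<^sup>+z. green p B u z * (\<integral>\<^sup>+w. p z w * indicator D w \<partial>count_space UNIV) \<partial>count_space UNIV)"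
  by (simp add: exit_prob_def kmul_def)

lemma exit_prob_unfold:
  "exit_prob p B D u = (\<integral>\<^sup>+w. p u w * indicator D w \<partial>count_space UNIV)
     + (\<integral>\<^sup>+z. p u z * indicator B z * exit_prob p B D z \<partial>count_space UNIV)"
proof -
  let ?F = "\<lambda>z (_::'a). \<integral>\<^sup>+w. p z w * indicator D w \<partial>count_space UNIV"
  have "exit_prob p B D u = (?F \<oplus> (restr p B \<odot> (green p B \<odot> ?F))) u u"
    unfolding exit_prob_def green_def ksum_fix_left ..
  also have "\<dots> = (\<integral>\<^sup>+w. p u w * indicator D w \<partial>count_space UNIV)
     + (\<integral>\<^sup>+z. restr p B u z * exit_prob p B D z \<partial>count_space UNIV)"
    by (simp add: kadd_def kmul_def exit_prob_eq)
  finally show ?thesis by (simp add: restr_def)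
qed

lemma nn_integral_count_space_ge:
  "f v \<le> (\<integral>\<^sup>+z. f z \<partial>count_space UNIV)" for f :: "'a \<Rightarrow> ennreal"
proof -
  have "f v = (\<integral>\<^sup>+z. f z * (if z = v then 1 else 0) \<partial>count_space UNIV)"
    by (simp add: nn_integral_count_space_single)
  also have "\<dots> \<le> (\<integral>\<^sup>+z. f z \<partial>count_space UNIV)"
    by (intro nn_integral_mono) auto
  finally show ?thesis .
qed

text \<open>Splitting at the last visit to \<open>v\<close>, the number of visits to \<open>v\<close> times the probability of leaving
\<open>B\<close> without returning to \<open>v\<close> is at most 1, and this probability is positive as soon as some path
leads from \<open>v\<close> out of \<open>B\<close>.\<close>
lemma green_finite:
  assumes p: "\<And>u. (\<integral>\<^sup>+v. p u v \<partial>count_space UNIV) \<le> 1"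
    and path: "(\<lambda>x y. p x y > 0)\<^sup>*\<^sup>* v w" and v: "v \<in> B" and w: "w \<notin> B"
  shows "green p B u v < \<infinity>"
proof -
  let ?k = "exit_prob p (B - {v}) (- B)"
  \<comment> \<open>Walking back along the path from \<open>w\<close>. A path that returns to \<open>v\<close> yields the last alternative.\<close>
  have "x \<notin> B \<or> ?k x > 0 \<or> ?k v > 0" if "(\<lambda>x y. p x y > 0)\<^sup>*\<^sup>* x w" for x
    using that
  proof (induction rule: converse_rtranclp_induct)
    case (step x y)
    have k: "?k x = (\<integral>\<^sup>+w. p x w * indicator (- B) w \<partial>count_space UNIV)
     + (\<integral>\<^sup>+z. p x z * indicator (B - {v}) z * ?k z \<partial>count_space UNIV)"
      by (rule exit_prob_unfold)
    have ge1: "p x y * indicator (- B) y \<le> ?k x"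
      unfolding k using nn_integral_count_space_ge[of "\<lambda>y. p x y * indicator (- B) y" y]
      by (rule order_trans) simp
    have ge2: "p x y * indicator (B - {v}) y * ?k y \<le> ?k x"
      unfolding k
      using nn_integral_count_space_ge[of "\<lambda>y. p x y * indicator (B - {v}) y * ?k y" y]
      by (rule order_trans) simp
    from step(3) consider "y \<notin> B" | "?k v > 0" | "y \<in> B - {v}" "?k y > 0" by auto
    then show ?case
    proof cases
      case 1
      then have "0 < p x y * indicator (- B) y" using step(1) by simp
      also note ge1
      finally show ?thesis by simp
    next
      case 3
      then have "0 < p x y * indicator (B - {v}) y * ?k y"
        using step(1) by (simp add: ennreal_zero_less_mult_iff)
      also note ge2
      finally show ?thesis by simp
    qed simp
  qed (use w in auto)
  from this[OF path] v have pos: "?k v > 0" by auto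
  have "green p B v v * ?k v = exit_prob p B (- B) v"
    unfolding exit_prob_eq
    by (subst (2) green_last_visit[OF v]) (simp add: nn_integral_cmult[symmetric] mult.assoc)
  also have "\<dots> \<le> 1" by (intro exit_prob_le_1 p) auto
  finally have "green p B v v * ?k v \<le> 1" .
  then have fin: "green p B v v < \<infinity>"
    using pos by (auto simp: less_top[symmetric] ennreal_top_mult top_unique split: if_splits)
  show ?thesis
  proof (cases "u = v")
    case False
    have B: "(B - {v}) \<union> {v} = B" using v by auto
    have "green p B u v = (\<integral>\<^sup>+y. (green p (B - {v}) \<odot> p) u v * green p B v v * indicator {v} y \<partial>count_space UNIV)"
      using green_first_entrance[of "B - {v}" "{v}" v p u] False unfolding B
      by (auto simp: kid_def intro!: nn_integral_cong split: split_indicator)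
    also have "\<dots> = (green p (B - {v}) \<odot> p) u v * green p B v v"
      by (subst nn_integral_cmult_indicator) auto
    also have "(green p (B - {v}) \<odot> p) u v = exit_prob p (B - {v}) {v} u"
    proof -
      have "(\<integral>\<^sup>+w. p z w * indicator {v} w \<partial>count_space UNIV) = p z v" for z
        by (subst nn_integral_indicator_finite) auto
      then show ?thesis by (simp add: exit_prob_eq kmul_def)
    qed
    also have "exit_prob p (B - {v}) {v} u * green p B v v \<le> 1 * green p B v v"
      by (intro mult_right_mono exit_prob_le_1 p) auto
    finally show ?thesis using fin by (simp add: order_le_less_trans)
  qed (use fin in simp)
qed

lemma nn_integral_indicator_range:
  fixes f :: "'i::finite \<Rightarrow> 's" and F :: "'s \<Rightarrow> ennreal"
  assumes "inj f"
  shows "(\<integral>\<^sup>+y. F y * indicator (range f) y \<partial>count_space UNIV) = (\<Sum>i\<in>UNIV. F (f i))"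
  using assms by (subst nn_integral_indicator_finite) (auto simp: sum.reindex)

section \<open>Hitting times of right-continuous step paths\<close>
text \<open>The first hitting time of \<open>D\<close>, as an infimum; \<open>\<infinity>\<close> if \<open>D\<close> is never visited.\<close>
definition hit :: "'s set \<Rightarrow> (real \<Rightarrow> 's) \<Rightarrow> ereal" where
  "hit D x = (INF t\<in>{t. 0 \<le> t \<and> x t \<in> D}. ereal t)"

lemma hit_le: "0 \<le> t \<Longrightarrow> x t \<in> D \<Longrightarrow> hit D x \<le> ereal t"
  unfolding hit_def by (rule INF_lower) simp

lemma hit_nonneg: "0 \<le> hit D x"
  unfolding hit_def by (rule INF_greatest) simp

lemma hit_less_iff: "hit D x < c \<longleftrightarrow> (\<exists>t\<ge>0. x t \<in> D \<and> ereal t < c)"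
  unfolding hit_def by (auto simp: INF_less_iff)

lemma hit_antimono: "D \<subseteq> D' \<Longrightarrow> hit D' x \<le> hit D x"
  unfolding hit_def by (rule INF_superset_mono) auto

lemma hit_Un: "hit (C \<union> D) x = min (hit C x) (hit D x)"
proof -
  have "{t. 0 \<le> t \<and> x t \<in> C \<union> D} = {t. 0 \<le> t \<and> x t \<in> C} \<union> {t. 0 \<le> t \<and> x t \<in> D}" by auto
  then show ?thesis by (simp add: hit_def INF_union inf_min)
qed

lemma hit_attained:
  assumes rc: "\<forall>t\<ge>0. eventually (\<lambda>s. x s = x t) (at_right t)"
    and fin: "hit D x < \<infinity>"
  obtains t where "0 \<le> t" "hit D x = ereal t" "x t \<in> D"
proof -
  obtain t where t: "hit D x = ereal t" "0 \<le> t"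
    using fin hit_nonneg[of D x] by (cases "hit D x") auto
  obtain b where b: "b > t" "\<And>s. t < s \<Longrightarrow> s < b \<Longrightarrow> x s = x t"
    using rc t(2) unfolding eventually_at_right_field by auto
  obtain s where s: "0 \<le> s" "x s \<in> D" "s < b"
    using hit_less_iff[of D x "ereal b"] b t by auto
  moreover have "t \<le> s" using hit_le[of s x D] s t by simp
  ultimately have "x t \<in> D" using b(2)[of s] by (cases "s = t") auto
  with that t show ?thesis by blast
qed

lemma jump_time_nonneg: "0 \<le> jump_time x n"
proof (cases n)
  case (Suc m)
  then show ?thesis by (auto intro!: INF_greatest)
qed simp

lemma jump_time_le_Suc: "jump_time x n \<le> jump_time x (Suc n)"
  by (auto intro!: INF_greatest)

lemma jump_time_mono: "m \<le> n \<Longrightarrow> jump_time x m \<le> jump_time x n"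
  by (rule lift_Suc_mono_le[of "jump_time x"]) (auto intro: jump_time_le_Suc simp del: jump_time.simps)

lemma jump_chain_eq: "jump_time x n < \<infinity> \<Longrightarrow> jump_chain x n = x (real_of_ereal (jump_time x n))"
  by (cases n) auto

lemma path_between_jumps:
  assumes "jump_time x n \<le> ereal t" "ereal t < jump_time x (Suc n)"
  shows "x t = jump_chain x n"
proof (rule ccontr)
  assume neq: "x t \<noteq> jump_chain x n"
  have fin: "jump_time x n < \<infinity>" using assms(1) by auto
  have "0 \<le> t" using jump_time_nonneg[of x n] assms(1) by (metis ereal_less_eq(5) order_trans)
  then have "jump_time x (Suc n) \<le> ereal t"
    using neq assms(1) unfolding jump_chain_eq[OF fin] jump_time.simps by (intro INF_lower) simp
  with assms(2) show False by simp
qed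

text \<open>After the last jump the jump chain repeats its value, so every value it takes is taken at an index
with a finite jump time.\<close>
lemma jump_chain_frozen:
  "jump_time x n = \<infinity> \<Longrightarrow> \<exists>k<n. jump_time x k < \<infinity> \<and> jump_chain x k = jump_chain x n"
proof (induction n)
  case (Suc n)
  show ?case
  proof (cases "jump_time x n = \<infinity>")
    case True
    with Suc show ?thesis by (metis jump_chain.simps(2) less_SucI)
  next
    case False
    then have "jump_time x n < \<infinity>" by simp
    moreover have "jump_chain x n = jump_chain x (Suc n)" using Suc.prems by simp
    ultimately show ?thesis by blast
  qed
qed simp

text \<open>The path really stays in each state of its jump chain and its jump times exhaust \<open>[0, \<infinity>)\<close>, so that
it is determined by the jump chain and the holding times.\<close>
definition regular_path :: "(real \<Rightarrow> 's) \<Rightarrow> bool" where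
  "regular_path x \<longleftrightarrow> (\<forall>n. 0 < holding_time x n) \<and> (\<forall>t. \<exists>n. ereal t < jump_time x n)"

lemma regular_path_jump_less:
  assumes "regular_path x" "jump_time x m < \<infinity>" "m < n"
  shows "jump_time x m < jump_time x n"
proof -
  have "0 < jump_time x (Suc m) - jump_time x m"
    using assms(1,2) by (metis regular_path_def holding_time_def less_irrefl)
  then have "jump_time x m < jump_time x (Suc m)"
    using assms(2) jump_time_nonneg[of x m]
    by (cases "jump_time x m"; cases "jump_time x (Suc m)") auto
  also have "\<dots> \<le> jump_time x n" using assms(3) by (intro jump_time_mono) simp
  finally show ?thesis .
qed

lemma regular_path_index:
  assumes "regular_path x" "0 \<le> t"
  obtains n where "jump_time x n \<le> ereal t" "ereal t < jump_time x (Suc n)"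
proof -
  let ?m = "LEAST n. ereal t < jump_time x n"
  have ex: "\<exists>n. ereal t < jump_time x n" using assms(1) by (auto simp: regular_path_def)
  have m: "ereal t < jump_time x ?m" using ex by (rule LeastI_ex)
  have "?m \<noteq> 0"
  proof
    assume "?m = 0" then show False using m assms(2) by simp
  qed
  then obtain n where n: "?m = Suc n" by (cases ?m) auto
  then have "\<not> ereal t < jump_time x n" by (metis lessI not_less_Least)
  with m n that[of n] show ?thesis by (auto simp del: jump_time.simps)
qed

lemma regular_pathI:
  assumes pos: "\<And>n. 0 < holding_time x n" and inf: "\<And>n. \<exists>m\<ge>n. 1 < holding_time x m"
  shows "regular_path x"
proof -
  have "\<exists>n. ereal (real k) \<le> jump_time x n" for k :: nat
  proof (induction k)
    case 0
    show ?case by (rule exI[of _ 0]) simp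
  next
    case (Suc k)
    then obtain n where n: "ereal (real k) \<le> jump_time x n" by blast
    obtain m where m: "m \<ge> n" "1 < holding_time x m" using inf by blast
    have km: "ereal (real k) \<le> jump_time x m" using n jump_time_mono[OF m(1), of x] by order
    have "ereal (real (Suc k)) \<le> jump_time x (Suc m)"
    proof (cases "jump_time x m = \<infinity>")
      case True
      then have "jump_time x (Suc m) = \<infinity>"
        using jump_time_le_Suc[of x m] by (metis ereal_infty_less_eq(1))
      then show ?thesis by simp
    next
      case False
      then have "1 < jump_time x (Suc m) - jump_time x m"
        using m(2) by (simp add: holding_time_def del: jump_time.simps)
      then show ?thesis using km False jump_time_nonneg[of x m]
        by (cases "jump_time x m"; cases "jump_time x (Suc m)") auto
    qed
    then show ?case by blast
  qed
  moreover have "\<exists>k::nat. t < real k" for t using reals_Archimedean2 by blast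
  ultimately have "\<exists>n. ereal t < jump_time x n" for t
    by (meson ereal_less(2) less_ereal.simps(1) order_less_le_trans)
  then show ?thesis using pos by (simp add: regular_path_def)
qed

lemma hit_eq_jump_time:
  assumes good: "regular_path x" and before: "\<And>k. k < n \<Longrightarrow> jump_chain x k \<notin> D"
    and at: "jump_chain x n \<in> D"
  shows "hit D x = jump_time x n" "jump_time x n < \<infinity>"
proof -
  show fin: "jump_time x n < \<infinity>"
  proof (rule ccontr)
    assume "\<not> jump_time x n < \<infinity>"
    then have "jump_time x n = \<infinity>" by simp
    from jump_chain_frozen[OF this] obtain k where "k < n" "jump_chain x k = jump_chain x n" by blast
    with before[of k] at show False by simp
  qed
  define t where "t = real_of_ereal (jump_time x n)"
  have t: "jump_time x n = ereal t" "0 \<le> t"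
    using fin jump_time_nonneg[of x n] by (cases "jump_time x n"; auto simp: t_def)+
  have "x t \<in> D" using at jump_chain_eq[OF fin] by (simp add: t_def)
  then have le: "hit D x \<le> jump_time x n" using t hit_le[of t x D] by simp
  have "ereal t \<le> ereal s" if s: "0 \<le> s" "x s \<in> D" for s
  proof (rule ccontr)
    assume less: "\<not> ereal t \<le> ereal s"
    obtain k where k: "jump_time x k \<le> ereal s" "ereal s < jump_time x (Suc k)"
      using regular_path_index[OF good s(1)] .
    have "k < n"
    proof (rule ccontr)
      assume "\<not> k < n"
      then have "jump_time x n \<le> jump_time x k" by (intro jump_time_mono) simp
      then have "ereal t \<le> ereal s" using k(1) t(1) by order
      then show False using less by simp
    qed
    then show False using before path_between_jumps[OF k] s(2) by auto
  qed
  then have "jump_time x n \<le> hit D x" unfolding hit_def t(1) by (intro INF_greatest) auto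
  with le show "hit D x = jump_time x n" by order
qed

lemma hit_less_infty_iff:
  assumes "regular_path x"
  shows "hit D x < \<infinity> \<longleftrightarrow> (\<exists>n. jump_chain x n \<in> D)"
proof
  assume "hit D x < \<infinity>"
  then obtain t where t: "0 \<le> t" "x t \<in> D" unfolding hit_less_iff by blast
  obtain k where "jump_time x k \<le> ereal t" "ereal t < jump_time x (Suc k)"
    using regular_path_index[OF assms t(1)] .
  from path_between_jumps[OF this] t(2) show "\<exists>n. jump_chain x n \<in> D" by auto
next
  assume "\<exists>n. jump_chain x n \<in> D"
  from exists_least_iff[THEN iffD1, OF this]
  obtain n where n: "jump_chain x n \<in> D" "\<forall>k<n. jump_chain x k \<notin> D" by blast
  have "hit D x = jump_time x n" "jump_time x n < \<infinity>"
    by (rule hit_eq_jump_time[OF assms _ n(1)]; use n(2) in blast)+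
  then show "hit D x < \<infinity>" by simp
qed

text \<open>For a regular path, \<open>D\<close> is first entered at \<open>v\<close> iff the hitting times of \<open>D\<close> and of \<open>v\<close> agree and are finite. The
left-hand side is a measurable event, being a relation between two hitting times.\<close>
lemma hit_at_state_iff:
  assumes good: "regular_path x" and v: "v \<in> D"
  shows "hit D x = hit {v} x \<and> hit D x < \<infinity> \<longleftrightarrow>
    (\<exists>n. (\<forall>k<n. jump_chain x k \<notin> D) \<and> jump_chain x n = v)"
proof
  assume eq: "hit D x = hit {v} x \<and> hit D x < \<infinity>"
  have first: "\<exists>n. (\<forall>k<n. jump_chain x k \<notin> F) \<and> jump_chain x n \<in> F" if "hit F x < \<infinity>" for F
    using exists_least_iff[THEN iffD1, OF that[unfolded hit_less_infty_iff[OF good]]] by blast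
  obtain n where n: "\<forall>k<n. jump_chain x k \<notin> D" "jump_chain x n \<in> D"
    using first[of D] eq by blast
  obtain m where m: "\<forall>k<m. jump_chain x k \<notin> {v}" "jump_chain x m \<in> {v}"
    using first[of "{v}"] eq by auto
  have Tn: "hit D x = jump_time x n" "jump_time x n < \<infinity>"
    by (rule hit_eq_jump_time[OF good _ n(2)]; use n(1) in blast)+
  have Tm: "hit {v} x = jump_time x m" "jump_time x m < \<infinity>"
    by (rule hit_eq_jump_time[OF good _ m(2)]; use m(1) in blast)+
  have "n = m"
  proof (rule linorder_cases[of n m])
    assume "n < m"
    from regular_path_jump_less[OF good Tn(2) this] Tn(1) Tm(1) eq show ?thesis by simp
  next
    assume "m < n"
    from regular_path_jump_less[OF good Tm(2) this] Tn(1) Tm(1) eq show ?thesis by simp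
  qed
  with n m show "\<exists>n. (\<forall>k<n. jump_chain x k \<notin> D) \<and> jump_chain x n = v" by auto
next
  assume "\<exists>n. (\<forall>k<n. jump_chain x k \<notin> D) \<and> jump_chain x n = v"
  then obtain n where n: "\<And>k. k < n \<Longrightarrow> jump_chain x k \<notin> D" "jump_chain x n = v" by blast
  have "hit D x = jump_time x n" "jump_time x n < \<infinity>"
    using hit_eq_jump_time[OF good, of n D] n v by simp_all
  moreover have "hit {v} x = jump_time x n"
  proof (rule hit_eq_jump_time(1)[OF good])
    fix k assume "k < n"
    then show "jump_chain x k \<notin> {v}" using n(1)[of k] v by blast
  qed (simp add: n(2))
  ultimately show "hit D x = hit {v} x \<and> hit D x < \<infinity>" by simp
qed

text \<open>The time spent in \<open>v\<close> before hitting \<open>D\<close> is the sum of the holding times of those visits of the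
jump chain to \<open>v\<close> that precede \<open>D\<close>.\<close>
lemma occupation_time_eq_suminf:
  assumes good: "regular_path x" and v: "v \<notin> D"
    and fin: "\<And>n. jump_chain x n = v \<Longrightarrow> holding_time x n < \<infinity>"
  shows "(\<integral>\<^sup>+s\<in>{s. 0 \<le> s \<and> ereal s \<le> hit D x}. indicator {s. x s = v} s \<partial>lborel) =
    (\<Sum>n. e2ennreal (holding_time x n) *
       (if (\<forall>k<n. jump_chain x k \<notin> D) \<and> jump_chain x n = v then 1 else 0))"
proof -
  define c where "c n \<longleftrightarrow> (\<forall>k<n. jump_chain x k \<notin> D) \<and> jump_chain x n = v" for n
  define I where "I n = (if c n then {real_of_ereal (jump_time x n)..<real_of_ereal (jump_time x (Suc n))} else {})" for n
  have finT: "jump_time x n < \<infinity> \<and> jump_time x (Suc n) < \<infinity>" if "c n" for n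
  proof -
    have "holding_time x n < \<infinity>" using fin that by (simp add: c_def)
    then show ?thesis using jump_time_nonneg[of x n]
      by (cases "jump_time x n"; cases "jump_time x (Suc n)") (auto simp: holding_time_def)
  qed
  have memI: "s \<in> I n \<longleftrightarrow> c n \<and> jump_time x n \<le> ereal s \<and> ereal s < jump_time x (Suc n)" for s n
    using finT[of n] jump_time_nonneg[of x n] jump_time_nonneg[of x "Suc n"]
    by (cases "jump_time x n"; cases "jump_time x (Suc n)") (auto simp: I_def simp del: jump_time.simps)
  have point: "indicator {s. x s = v} s * indicator {s. 0 \<le> s \<and> ereal s \<le> hit D x} s
      = (\<Sum>n. indicator (I n) s :: ennreal)" for s
  proof (cases "0 \<le> s")
    case False
    have "s \<notin> I n" for n
    proof
      assume "s \<in> I n"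
      then have "jump_time x n \<le> ereal s" by (simp add: memI)
      with jump_time_nonneg[of x n] have "0 \<le> ereal s" by order
      then show False using False by simp
    qed
    then show ?thesis using False by simp
  next
    case True
    obtain n where n: "jump_time x n \<le> ereal s" "ereal s < jump_time x (Suc n)"
      using regular_path_index[OF good True] .
    have xs: "x s = jump_chain x n" using path_between_jumps[OF n] .
    have other: "s \<notin> I m" if "m \<noteq> n" for m
    proof
      assume "s \<in> I m"
      then have m: "jump_time x m \<le> ereal s" "ereal s < jump_time x (Suc m)" by (auto simp: memI)
      from that consider "Suc m \<le> n" | "Suc n \<le> m" by linarith
      then show False
      proof cases
        case 1 from jump_time_mono[OF this, of x] m n show False by order
      next
        case 2 from jump_time_mono[OF this, of x] m n show False by order
      qed
    qed
    have "(\<Sum>n. indicator (I n) s :: ennreal) = indicator (I n) s"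
      using suminf_finite[of "{n}" "\<lambda>n. indicator (I n) s :: ennreal"] other by simp
    moreover have "ereal s \<le> hit D x \<and> x s = v \<longleftrightarrow> c n"
    proof
      assume a: "ereal s \<le> hit D x \<and> x s = v"
      have "jump_chain x k \<notin> D" if k: "k < n" for k
      proof
        assume D: "jump_chain x k \<in> D"
        have "jump_time x k \<le> ereal s"
          using jump_time_mono[of k n x] k n(1) by (meson less_imp_le order_trans)
        then have Tk: "jump_time x k < \<infinity>" by auto
        then obtain t where t: "jump_time x k = ereal t" "0 \<le> t"
          using jump_time_nonneg[of x k] by (cases "jump_time x k") auto
        then have "hit D x \<le> jump_time x k" using D jump_chain_eq[OF Tk] hit_le[of t x D] by simp
        then show False using regular_path_jump_less[OF good Tk k] n(1) a[THEN conjunct1] by order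
      qed
      then show "c n" using a xs by (simp add: c_def)
    next
      assume c: "c n"
      have "ereal s \<le> ereal t" if t: "0 \<le> t" "x t \<in> D" for t
      proof (rule ccontr)
        assume less: "\<not> ereal s \<le> ereal t"
        obtain k where k: "jump_time x k \<le> ereal t" "ereal t < jump_time x (Suc k)"
          using regular_path_index[OF good t(1)] .
        have "k \<le> n"
        proof (rule ccontr)
          assume "\<not> k \<le> n"
          then have "jump_time x (Suc n) \<le> jump_time x k" by (intro jump_time_mono) simp
          then have "ereal s \<le> ereal t" using k(1) n(2) by order
          then show False using less by simp
        qed
        then show False using c v path_between_jumps[OF k] t(2)
          by (cases "k = n") (auto simp: c_def)
      qed
      then have "ereal s \<le> hit D x" unfolding hit_def by (intro INF_greatest) auto
      then show "ereal s \<le> hit D x \<and> x s = v" using c xs by (simp add: c_def)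
    qed
    moreover have "s \<in> I n \<longleftrightarrow> c n" using n by (simp add: memI del: jump_time.simps)
    ultimately show ?thesis using True by (simp add: indicator_def) metis
  qed
  have "(\<integral>\<^sup>+s\<in>{s. 0 \<le> s \<and> ereal s \<le> hit D x}. indicator {s. x s = v} s \<partial>lborel) =
      (\<Sum>n. emeasure lborel (I n))"
    unfolding point by (subst nn_integral_suminf) (auto simp: I_def)
  also have "(\<lambda>n. emeasure lborel (I n)) = (\<lambda>n. e2ennreal (holding_time x n) * (if c n then 1 else 0))"
  proof (rule ext)
    fix n
    show "emeasure lborel (I n) = e2ennreal (holding_time x n) * (if c n then 1 else 0)"
    proof (cases "c n")
      case True
      obtain a b where ab: "jump_time x n = ereal a" "jump_time x (Suc n) = ereal b"
        using finT[OF True] jump_time_nonneg[of x n] jump_time_nonneg[of x "Suc n"]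
        by (cases "jump_time x n"; cases "jump_time x (Suc n)") auto
      then have "a \<le> b" using jump_time_le_Suc[of x n] by simp
      with True ab show ?thesis by (simp add: I_def holding_time_def del: jump_time.simps)
    qed (simp add: I_def)
  qed
  finally show ?thesis by (simp add: c_def)
qed

section \<open>Hitting probabilities and occupation times of a Markov chain\<close>
text \<open>A chain with bounded exit rates and a stochastic jump kernel. These properties exclude explosion.\<close>
locale ctmc_law =
  fixes M :: "'w measure" and G :: "'s::countable \<Rightarrow> 's \<Rightarrow> real" and a :: 's
    and X :: "real \<Rightarrow> 'w \<Rightarrow> 's" and qmax :: real
  assumes ctmc: "ctmc M G a X"
    and rate_nonneg: "0 \<le> exit_rate G u" and rate_le: "exit_rate G u \<le> qmax"
    and prob_nonneg: "0 \<le> jump_prob G u v"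
    and prob_sum: "(\<integral>\<^sup>+v. ennreal (jump_prob G u v) \<partial>count_space UNIV) = 1"
begin

sublocale prob_space M
  using ctmc by (simp add: ctmc_def)

abbreviation path :: "'w \<Rightarrow> real \<Rightarrow> 's" where "path w \<equiv> \<lambda>s. X s w"
abbreviation T :: "nat \<Rightarrow> 'w \<Rightarrow> ereal" where "T n w \<equiv> jump_time (path w) n"
abbreviation Y :: "nat \<Rightarrow> 'w \<Rightarrow> 's" where "Y n w \<equiv> jump_chain (path w) n"
abbreviation H :: "nat \<Rightarrow> 'w \<Rightarrow> ereal" where "H n w \<equiv> holding_time (path w) n"
abbreviation p :: "'s \<Rightarrow> 's \<Rightarrow> ennreal" where "p u v \<equiv> ennreal (jump_prob G u v)"
abbreviation q :: "'s \<Rightarrow> real" where "q \<equiv> exit_rate G"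

lemma X_meas: "0 \<le> t \<Longrightarrow> X t \<in> measurable M (count_space UNIV)"
  using ctmc by (simp add: ctmc_def)

text \<open>The condition \<open>0 \<le> t\<close> is included because nothing is known about \<open>X t\<close> for negative \<open>t\<close>.\<close>
definition visits :: "real \<Rightarrow> 's set \<Rightarrow> 'w \<Rightarrow> bool" where
  "visits t D w \<longleftrightarrow> 0 \<le> t \<and> X t w \<in> D"

lemma visits_measurable [measurable]: "Measurable.pred M (visits t D)"
proof (cases "0 \<le> t")
  case True
  note X_meas[OF True, measurable]
  have "Measurable.pred M (\<lambda>w. X t w \<in> D)" by simp
  moreover have "visits t D = (\<lambda>w. X t w \<in> D)" using True by (auto simp: visits_def)
  ultimately show ?thesis by simp
next
  case False
  then have "visits t D = (\<lambda>_. False)" by (auto simp: visits_def)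
  then show ?thesis by simp
qed

lemma right_cont: "w \<in> space M \<Longrightarrow> 0 \<le> t \<Longrightarrow> eventually (\<lambda>s. X s w = X t w) (at_right t)"
  using ctmc by (simp add: ctmc_def)

lemma rational_right:
  assumes "w \<in> space M" "0 \<le> t" "ereal t < c"
  obtains r :: rat where "t < of_rat r" "ereal (of_rat r) < c" "X (of_rat r) w = X t w"
proof -
  obtain b where b: "b > t" "\<And>s. t < s \<Longrightarrow> s < b \<Longrightarrow> X s w = X t w"
    using right_cont[OF assms(1,2)] unfolding eventually_at_right_field by auto
  obtain d where d: "t < d" "d \<le> b" "ereal d \<le> c"
  proof (cases c)
    case (real c')
    then show ?thesis using that[of "min b c'"] b(1) assms(3) by auto
  next
    case PInf
    then show ?thesis using that[of b] b(1) by auto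
  qed (use assms(3) in auto)
  obtain r where "r \<in> \<rat>" "t < r" "r < d" using Rats_dense_in_real[OF d(1)] by blast
  then obtain r' :: rat where "r = of_rat r'" by (auto elim: Rats_cases)
  moreover have "ereal r < c" using \<open>r < d\<close> d(3) by (meson less_ereal.simps(1) less_le_trans)
  ultimately show ?thesis using \<open>t < r\<close> \<open>r < d\<close> d(2) b(2)[of r] that[of r'] by simp
qed

lemma hit_measurable [measurable]: "(\<lambda>w. hit D (path w)) \<in> borel_measurable M"
proof (rule borel_measurableI_less)
  fix c :: ereal
  have "{w\<in>space M. hit D (path w) < c} =
    {w\<in>space M. \<exists>r::rat. visits (of_rat r) D w \<and> ereal (of_rat r) < c}"
    (is "?L = ?R")
  proof (intro set_eqI iffI)
    fix w assume "w \<in> ?L"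
    then obtain t where t: "w \<in> space M" "0 \<le> t" "X t w \<in> D" "ereal t < c"
      by (auto simp: hit_less_iff)
    obtain r :: rat where "t < of_rat r" "ereal (of_rat r) < c" "X (of_rat r) w = X t w"
      using rational_right[OF t(1,2,4)] .
    with t show "w \<in> ?R" by (auto intro!: exI[of _ r] simp: visits_def simp del: zero_le_of_rat_iff)
  next
    fix w assume "w \<in> ?R"
    then obtain r :: rat where "w \<in> space M" "0 \<le> real_of_rat r" "X (of_rat r) w \<in> D" "ereal (of_rat r) < c"
      unfolding visits_def by blast
    then show "w \<in> ?L" by (auto simp: hit_less_iff simp del: zero_le_of_rat_iff)
  qed
  also have "\<dots> \<in> sets M" by measurable
  finally show "{w\<in>space M. hit D (path w) < c} \<in> sets M" .
qed

text \<open>By right-continuity, \<open>X\<close> has the value \<open>v\<close> at time \<open>S\<close> iff it has this value at all rational times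
in some interval to the right of \<open>S\<close>.\<close>
lemma value_at_random_time:
  assumes [measurable]: "S \<in> borel_measurable M" and nonneg: "\<And>w. 0 \<le> S w"
  shows "{w\<in>space M. S w < \<infinity> \<and> X (real_of_ereal (S w)) w = v} \<in> sets M"
proof -
  have "{w\<in>space M. S w < \<infinity> \<and> X (real_of_ereal (S w)) w = v} =
    {w\<in>space M. \<exists>b::rat. S w < ereal (of_rat b) \<and>
      (\<forall>r::rat. S w < ereal (of_rat r) \<and> ereal (of_rat r) < ereal (of_rat b) \<longrightarrow>
         visits (of_rat r) {v} w)}" (is "?L = ?R")
  proof (intro set_eqI iffI)
    fix w assume w: "w \<in> ?L"
    then obtain t where t: "S w = ereal t" "0 \<le> t" using nonneg[of w] by (cases "S w") auto
    obtain b where b: "b > t" "\<And>s. t < s \<Longrightarrow> s < b \<Longrightarrow> X s w = X t w"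
      using right_cont[OF _ t(2), of w] w unfolding eventually_at_right_field by auto
    obtain r where "r \<in> \<rat>" "t < r" "r < b" using Rats_dense_in_real[OF b(1)] by blast
    then obtain r' :: rat where "t < of_rat r'" "of_rat r' < b" by (auto elim: Rats_cases)
    moreover have "visits (of_rat s) {v} w"
      if "t < of_rat s" "real_of_rat s < of_rat r'" for s
      using b(2)[of "of_rat s"] that t w \<open>of_rat r' < b\<close> by (auto simp: visits_def simp del: zero_le_of_rat_iff)
    ultimately show "w \<in> ?R" using t w
      by (auto intro!: exI[of _ r'] )
  next
    fix w assume w: "w \<in> ?R"
    then have ws: "w \<in> space M" by simp
    from w obtain b :: rat where b0: "S w < ereal (of_rat b)"
      and b1: "\<forall>r::rat. S w < ereal (of_rat r) \<and> ereal (of_rat r) < ereal (of_rat b) \<longrightarrow>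
         visits (of_rat r) {v} w"
      unfolding mem_Collect_eq by (elim conjE exE) (rule that)
    obtain t where t: "S w = ereal t" "0 \<le> t" using nonneg[of w] b0 by (cases "S w") auto
    obtain r :: rat where r: "t < of_rat r" "ereal (of_rat r) < ereal (of_rat b)" "X (of_rat r) w = X t w"
      using rational_right[OF ws t(2), of "ereal (of_rat b)"] b0 t(1) by metis
    have "X (of_rat r) w = v" using b1[rule_format, of r] r(1,2) t(1) by (simp add: visits_def)
    then show "w \<in> ?L" using r(3) t ws by simp
  qed
  also have "\<dots> \<in> sets M" by measurable
  finally show ?thesis .
qed

lemma T_Y_measurable: "T n \<in> borel_measurable M \<and> Y n \<in> measurable M (count_space UNIV)"
proof (induction n)
  case 0
  show ?case using X_meas[of 0] by simp
next
  case (Suc n)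
  then have [measurable]: "T n \<in> borel_measurable M" "Y n \<in> measurable M (count_space UNIV)" by auto
  have TSuc [measurable]: "T (Suc n) \<in> borel_measurable M"
  proof (rule borel_measurableI_less)
    fix c :: ereal
    have "{w\<in>space M. T (Suc n) w < c} =
      {w\<in>space M. \<exists>(r::rat) v. visits (of_rat r) (- {v}) w \<and> Y n w = v \<and>
          T n w \<le> ereal (of_rat r) \<and> ereal (of_rat r) < c}" (is "?L = ?R")
    proof (intro set_eqI iffI)
      fix w assume w: "w \<in> ?L"
      then obtain t where t: "0 \<le> t" "T n w \<le> ereal t" "X t w \<noteq> X (real_of_ereal (T n w)) w" "ereal t < c"
        by (auto simp: INF_less_iff)
      have Y: "Y n w = X (real_of_ereal (T n w)) w" using t(2) by (intro jump_chain_eq) auto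
      obtain r :: rat where r: "t < of_rat r" "ereal (of_rat r) < c" "X (of_rat r) w = X t w"
        using rational_right[OF _ t(1,4)] w by blast
      have "T n w \<le> ereal (of_rat r)" using t(2) r(1) by (meson ereal_less_eq(3) less_imp_le order_trans)
      moreover have "visits (of_rat r) (- {Y n w}) w"
        using r t Y by (simp add: visits_def del: zero_le_of_rat_iff)
      ultimately show "w \<in> ?R" using w r(2) by blast
    next
      fix w assume w: "w \<in> ?R"
      then have ws: "w \<in> space M" by simp
      from w obtain r :: rat where r: "0 \<le> real_of_rat r" "X (of_rat r) w \<noteq> Y n w"
          "T n w \<le> ereal (of_rat r)" "ereal (of_rat r) < c"
        by (auto simp: visits_def simp del: zero_le_of_rat_iff)
      have "Y n w = X (real_of_ereal (T n w)) w" using r(3) by (intro jump_chain_eq) auto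
      then show "w \<in> ?L" using r ws
        by (auto simp: INF_less_iff simp del: zero_le_of_rat_iff intro!: exI[of _ "of_rat r"])
    qed
    also have "\<dots> \<in> sets M" by measurable
    finally show "{w\<in>space M. T (Suc n) w < c} \<in> sets M" .
  qed
  define U where "U = T (Suc n)"
  have [measurable]: "U \<in> borel_measurable M" using TSuc by (simp only: U_def)
  have val: "{w\<in>space M. U w < \<infinity> \<and> X (real_of_ereal (U w)) w = v} \<in> sets M" for v
    by (rule value_at_random_time) (simp_all only: U_def jump_time_nonneg TSuc)
  have Y_Suc: "Y (Suc n) w = (if U w = \<infinity> then Y n w else X (real_of_ereal (U w)) w)" for w
    by (simp only: U_def jump_chain.simps)
  have "Y (Suc n) -` {v} \<inter> space M \<in> sets M" for v
  proof -
    have "Y (Suc n) -` {v} \<inter> space M =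
      {w\<in>space M. U w = \<infinity> \<and> Y n w = v} \<union>
      {w\<in>space M. U w < \<infinity> \<and> X (real_of_ereal (U w)) w = v}"
      unfolding vimage_def Y_Suc by auto
    also have "\<dots> \<in> sets M" by (intro sets.Un val) measurable
    finally show ?thesis .
  qed
  then have "Y (Suc n) \<in> measurable M (count_space UNIV)"
    by (simp add: measurable_count_space_eq2_countable del: jump_chain.simps)
  with TSuc show ?case by blast
qed

lemma Y_measurable [measurable]: "Y n \<in> measurable M (count_space UNIV)"
  using T_Y_measurable by blast

lemma T_measurable [measurable]: "T n \<in> borel_measurable M"
  using T_Y_measurable by blast

lemma H_measurable [measurable]: "H n \<in> borel_measurable M"
  unfolding holding_time_def by measurable

text \<open>The probability that the jump chain follows \<open>y\<close> up to step \<open>n\<close>.\<close>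
definition weight :: "nat \<Rightarrow> (nat \<Rightarrow> 's) \<Rightarrow> real" where
  "weight n y = (if y 0 = a then 1 else 0) * (\<Prod>k<n. jump_prob G (y k) (y (Suc k)))"

lemma weight_nonneg: "0 \<le> weight n y"
  unfolding weight_def by (auto intro!: prod_nonneg prob_nonneg)

lemma cylinder:
  assumes "\<And>k. k \<le> n \<Longrightarrow> 0 \<le> t k"
  shows "measure M {w\<in>space M. \<forall>k\<le>n. Y k w = y k \<and> H k w > ereal (t k)} =
    weight n y * (\<Prod>k\<le>n. exp (- q (y k) * t k))"
  using ctmc assms unfolding ctmc_def weight_def by blast

text \<open>From the tails of the holding times to holding times in \<open>(t k, 1]\<close> for \<open>k \<in> F\<close>, removing one
upper bound at a time by inclusion and exclusion.\<close>
lemma box: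
  assumes "finite F" "F \<subseteq> {..n}" "\<And>k. k \<le> n \<Longrightarrow> 0 \<le> t k" "\<And>k. k \<in> F \<Longrightarrow> t k \<le> 1"
  shows "measure M {w\<in>space M. \<forall>k\<le>n. Y k w = y k \<and> H k w > ereal (t k) \<and> (k \<in> F \<longrightarrow> H k w \<le> 1)} =
    weight n y * (\<Prod>k\<le>n. exp (- q (y k) * t k) - (if k \<in> F then exp (- q (y k)) else 0))"
  using assms
proof (induction F arbitrary: t rule: finite_induct)
  case empty
  then show ?case using cylinder[of n t y] by simp
next
  case (insert b F)
  define E where "E F t = {w\<in>space M. \<forall>k\<le>n. Y k w = y k \<and> H k w > ereal (t k) \<and> (k \<in> F \<longrightarrow> H k w \<le> 1)}" for F and t :: "nat \<Rightarrow> real"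
  have [measurable]: "E F t \<in> sets M" for F t unfolding E_def by measurable
  define t' where "t' = t(b := 1)"
  have b: "b \<le> n" using insert.prems by auto
  have ins: "E (insert b F) t = {w\<in>E F t. H b w \<le> 1}"
    using b unfolding E_def by blast
  have t': "E F t' = {w\<in>E F t. 1 < H b w}"
  proof (intro set_eqI iffI)
    fix w assume w: "w \<in> E F t'"
    have "ereal (t k) < H k w" if "k \<le> n" for k
    proof -
      have "ereal (t' k) < H k w" using w that by (simp add: E_def)
      moreover have "ereal (t k) \<le> ereal (t' k)" using insert.prems(3)[of b] by (simp add: t'_def)
      ultimately show ?thesis by (rule le_less_trans[rotated])
    qed
    moreover have "ereal (t' b) < H b w" using w b by (simp add: E_def)
    ultimately show "w \<in> {w\<in>E F t. 1 < H b w}"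
      using w by (simp add: E_def t'_def one_ereal_def)
  next
    fix w assume "w \<in> {w\<in>E F t. 1 < H b w}"
    then show "w \<in> E F t'" by (simp add: E_def t'_def one_ereal_def)
  qed
  have "E (insert b F) t = E F t - E F t'" unfolding ins t' by auto
  moreover have "E F t' \<subseteq> E F t" unfolding t' by auto
  ultimately have "measure M (E (insert b F) t) = measure M (E F t) - measure M (E F t')"
    by (simp add: finite_measure_Diff)
  also have "measure M (E F t) = weight n y * (\<Prod>k\<le>n. exp (- q (y k) * t k) - (if k \<in> F then exp (- q (y k)) else 0))"
    unfolding E_def using insert by (intro insert.IH) auto
  also have "measure M (E F t') = weight n y * (\<Prod>k\<le>n. exp (- q (y k) * t' k) - (if k \<in> F then exp (- q (y k)) else 0))"
    unfolding E_def using insert by (intro insert.IH) (auto simp: t'_def)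
  also have "(\<Prod>k\<le>n. exp (- q (y k) * t k) - (if k \<in> F then exp (- q (y k)) else 0)) =
      exp (- q (y b) * t b) * (\<Prod>k\<in>{..n} - {b}. exp (- q (y k) * t k) - (if k \<in> F then exp (- q (y k)) else 0))"
    using b insert.hyps by (subst prod.remove[of _ b]) auto
  also have "(\<Prod>k\<le>n. exp (- q (y k) * t' k) - (if k \<in> F then exp (- q (y k)) else 0)) =
      exp (- q (y b)) * (\<Prod>k\<in>{..n} - {b}. exp (- q (y k) * t k) - (if k \<in> F then exp (- q (y k)) else 0))"
    using b insert.hyps by (subst prod.remove[of _ b]) (auto simp: t'_def intro!: prod.cong)
  finally have "measure M (E (insert b F) t) = weight n y *
    ((exp (- q (y b) * t b) - exp (- q (y b))) * (\<Prod>k\<in>{..n} - {b}. exp (- q (y k) * t k) - (if k \<in> F then exp (- q (y k)) else 0)))"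
    by (simp add: algebra_simps)
  also have "(exp (- q (y b) * t b) - exp (- q (y b))) * (\<Prod>k\<in>{..n} - {b}. exp (- q (y k) * t k) - (if k \<in> F then exp (- q (y k)) else 0))
    = (\<Prod>k\<le>n. exp (- q (y k) * t k) - (if k \<in> insert b F then exp (- q (y k)) else 0))"
    using b by (subst (2) prod.remove[of _ b]) (auto intro!: prod.cong)
  finally show ?case by (simp add: E_def)
qed

text \<open>The first \<open>n + 1\<close> states of the jump chain, as a value in a countable type.\<close>
definition prefix :: "nat \<Rightarrow> 'w \<Rightarrow> 's list" where
  "prefix n w = map (\<lambda>k. Y k w) [0..<Suc n]"

lemma prefix_eq_iff: "prefix n w = ys \<longleftrightarrow> length ys = Suc n \<and> (\<forall>k\<le>n. Y k w = ys ! k)"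
proof -
  have "length (prefix n w) = Suc n" "\<And>k. k \<le> n \<Longrightarrow> prefix n w ! k = Y k w"
    by (simp_all add: prefix_def del: upt_Suc)
  then show ?thesis by (metis less_Suc_eq_le nth_equalityI)
qed

lemma prefix_measurable [measurable]: "prefix n \<in> measurable M (count_space UNIV)"
proof -
  have "prefix n -` {ys} \<inter> space M = {w\<in>space M. length ys = Suc n \<and> (\<forall>k\<le>n. Y k w = ys ! k)}" for ys
    unfolding vimage_def using prefix_eq_iff[of n _ ys] by blast
  then show ?thesis by (simp add: measurable_count_space_eq2_countable)
qed

lemma emeasure_partition:
  fixes Z :: "'w \<Rightarrow> 'i::countable"
  assumes [measurable]: "E \<in> sets M" "Z \<in> measurable M (count_space UNIV)"
  shows "emeasure M E = (\<integral>\<^sup>+z. emeasure M {w\<in>E. Z w = z} \<partial>count_space UNIV)"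
proof -
  have E: "E = (\<Union>z. {w\<in>E. Z w = z})" by auto
  have "{w\<in>E. Z w = z} = E \<inter> {w\<in>space M. Z w = z}" for z using sets.sets_into_space[OF assms(1)] by auto
  then have "{w\<in>E. Z w = z} \<in> sets M" for z by simp
  then have "emeasure M (\<Union>z. {w\<in>E. Z w = z}) = (\<integral>\<^sup>+z. emeasure M {w\<in>E. Z w = z} \<partial>count_space UNIV)"
    by (intro emeasure_UN_countable) (auto simp: disjoint_family_on_def)
  with E show ?thesis by simp
qed

end

text \<open>From here on jump times and jump chains are used only through the facts above; unfolding their
recursion would bring back the infima over uncountable sets.\<close>
declare jump_time.simps(2) [simp del] jump_chain.simps(2) [simp del]

context ctmc_law begin

text \<open>The event that the first \<open>n + 1\<close> holding times are positive and those with index in \<open>F\<close> are at most 1.\<close>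
definition slow :: "nat \<Rightarrow> nat set \<Rightarrow> 'w set" where
  "slow n F = {w\<in>space M. \<forall>k\<le>n. 0 < H k w \<and> (k \<in> F \<longrightarrow> H k w \<le> 1)}"

lemma slow_measurable [measurable]: "slow n F \<in> sets M"
  unfolding slow_def by measurable

lemma slow_prefix:
  assumes "F \<subseteq> {..n}"
  shows "emeasure M {w\<in>slow n F. prefix n w = ys} = (if length ys = Suc n then
    ennreal (weight n ((!) ys) * (\<Prod>k\<le>n. 1 - (if k \<in> F then exp (- q (ys ! k)) else 0))) else 0)"
proof (cases "length ys = Suc n")
  case True
  have "{w\<in>slow n F. prefix n w = ys} =
    {w\<in>space M. \<forall>k\<le>n. Y k w = ys ! k \<and> H k w > ereal 0 \<and> (k \<in> F \<longrightarrow> H k w \<le> 1)}"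
    unfolding slow_def prefix_eq_iff zero_ereal_def[symmetric] using True by blast
  then have "emeasure M {w\<in>slow n F. prefix n w = ys} =
    ennreal (measure M {w\<in>space M. \<forall>k\<le>n. Y k w = ys ! k \<and> H k w > ereal 0 \<and> (k \<in> F \<longrightarrow> H k w \<le> 1)})"
    by (simp only: emeasure_eq_measure)
  also have "\<dots> = ennreal (weight n ((!) ys) * (\<Prod>k\<le>n. 1 - (if k \<in> F then exp (- q (ys ! k)) else 0)))"
    using assms by (subst box[of F n "\<lambda>_. 0"]) (auto intro: finite_subset)
  finally show ?thesis using True by simp
next
  case False
  then have "{w\<in>slow n F. prefix n w = ys} = {}" unfolding prefix_eq_iff by blast
  then show ?thesis unfolding \<open>{w\<in>slow n F. prefix n w = ys} = {}\<close> using False by simp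
qed

lemma slow_bound:
  assumes F: "F \<subseteq> {..n}"
  shows "emeasure M (slow n F) \<le> ennreal ((1 - exp (- qmax)) ^ card F)"
proof -
  let ?c = "1 - exp (- qmax)"
  have c: "0 \<le> ?c" using rate_nonneg[of a] rate_le[of a] by simp
  have "emeasure M {w\<in>slow n F. prefix n w = ys}
      \<le> ennreal (?c ^ card F) * emeasure M {w\<in>slow n {}. prefix n w = ys}" for ys
  proof (cases "length ys = Suc n")
    case True
    have "(\<Prod>k\<le>n. 1 - (if k \<in> F then exp (- q (ys ! k)) else 0)) = (\<Prod>k\<in>F. 1 - exp (- q (ys ! k)))"
      using F by (intro prod.mono_neutral_cong_right) auto
    also have "\<dots> \<le> (\<Prod>k\<in>F. ?c)"
      using rate_nonneg rate_le by (intro prod_mono) auto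
    finally have "(\<Prod>k\<le>n. 1 - (if k \<in> F then exp (- q (ys ! k)) else 0)) \<le> ?c ^ card F" by simp
    then have "weight n ((!) ys) * (\<Prod>k\<le>n. 1 - (if k \<in> F then exp (- q (ys ! k)) else 0))
        \<le> ?c ^ card F * weight n ((!) ys)"
      using weight_nonneg[of n "(!) ys"] by (subst mult.commute, intro mult_right_mono)
    then show ?thesis
      using True c F weight_nonneg[of n "(!) ys"]
      by (simp add: slow_prefix ennreal_mult[symmetric] ennreal_leI)
  qed (simp add: slow_prefix F)
  then have "(\<integral>\<^sup>+ys. emeasure M {w\<in>slow n F. prefix n w = ys} \<partial>count_space UNIV)
     \<le> (\<integral>\<^sup>+ys. ennreal (?c ^ card F) * emeasure M {w\<in>slow n {}. prefix n w = ys} \<partial>count_space UNIV)"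
    by (intro nn_integral_mono)
  then have "emeasure M (slow n F) \<le> ennreal (?c ^ card F) * emeasure M (slow n {})"
    by (simp add: nn_integral_cmult emeasure_partition[symmetric])
  also have "\<dots> \<le> ennreal (?c ^ card F) * 1"
    by (intro mult_left_mono emeasure_le_1) simp
  finally show ?thesis by simp
qed

lemma weight_snoc:
  assumes "length ys = Suc n"
  shows "weight (Suc n) ((!) (ys @ [v])) = weight n ((!) ys) * jump_prob G (ys ! n) v"
proof -
  have "(\<Prod>k<n. jump_prob G ((ys @ [v]) ! k) ((ys @ [v]) ! Suc k)) = (\<Prod>k<n. jump_prob G (ys ! k) (ys ! Suc k))"
    using assms by (intro prod.cong) (auto simp: nth_append)
  then show ?thesis using assms by (simp add: weight_def nth_append)
qed

lemma prefix_Suc_eq: "prefix (Suc n) w = ys @ [v] \<longleftrightarrow> prefix n w = ys \<and> Y (Suc n) w = v"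
  by (simp add: prefix_def)

lemma slow_empty: "emeasure M (slow n {}) = 1"
proof (induction n)
  case 0
  have "measure M {w\<in>space M. \<forall>k\<le>0. Y k w = (\<lambda>_. a) k \<and> H k w > ereal ((\<lambda>_. 0) k)} = 1"
    by (subst cylinder) (simp_all add: weight_def)
  then have "1 = emeasure M {w\<in>space M. \<forall>k\<le>0. Y k w = (\<lambda>_. a) k \<and> H k w > ereal ((\<lambda>_. 0) k)}"
    by (simp only: emeasure_eq_measure ennreal_1)
  also have "\<dots> \<le> emeasure M (slow 0 {})"
    by (rule emeasure_mono) (auto simp: slow_def zero_ereal_def)
  finally have "1 \<le> emeasure M (slow 0 {})" .
  with emeasure_le_1[of "slow 0 {}"] show ?case by (rule antisym)
next
  case (Suc n)
  have "emeasure M {w\<in>slow (Suc n) {}. prefix n w = ys} = emeasure M {w\<in>slow n {}. prefix n w = ys}" for ys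
  proof (cases "length ys = Suc n")
    case True
    have [measurable]: "{w\<in>slow (Suc n) {}. prefix n w = ys} \<in> sets M"
    proof -
      have "{w\<in>slow (Suc n) {}. prefix n w = ys} = slow (Suc n) {} \<inter> {w\<in>space M. prefix n w = ys}"
        by (auto simp: slow_def)
      then show ?thesis by simp
    qed
    have "emeasure M {w\<in>slow (Suc n) {}. prefix n w = ys}
       = (\<integral>\<^sup>+v. emeasure M {w\<in>{w\<in>slow (Suc n) {}. prefix n w = ys}. Y (Suc n) w = v} \<partial>count_space UNIV)"
      by (rule emeasure_partition) measurable
    also have "\<dots> = (\<integral>\<^sup>+v. emeasure M {w\<in>slow (Suc n) {}. prefix (Suc n) w = ys @ [v]} \<partial>count_space UNIV)"
      by (simp add: prefix_Suc_eq conj_assoc)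
    also have "\<dots> = (\<integral>\<^sup>+v. ennreal (weight n ((!) ys)) * p (ys ! n) v \<partial>count_space UNIV)"
      using True by (simp add: slow_prefix weight_snoc ennreal_mult weight_nonneg prob_nonneg)
    also have "\<dots> = ennreal (weight n ((!) ys))"
      by (simp add: nn_integral_cmult prob_sum)
    also have "\<dots> = emeasure M {w\<in>slow n {}. prefix n w = ys}"
      using True by (simp add: slow_prefix)
    finally show ?thesis .
  next
    case False
    then have "{w\<in>slow (Suc n) {}. prefix n w = ys} = {}" "{w\<in>slow n {}. prefix n w = ys} = {}"
      unfolding prefix_eq_iff by blast+
    then show ?thesis by (simp only:)
  qed
  then have "(\<integral>\<^sup>+ys. emeasure M {w\<in>slow (Suc n) {}. prefix n w = ys} \<partial>count_space UNIV) =
    (\<integral>\<^sup>+ys. emeasure M {w\<in>slow n {}. prefix n w = ys} \<partial>count_space UNIV)" by simp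
  then show ?case using Suc.IH by (simp add: emeasure_partition[symmetric])
qed

lemma AE_holding_pos: "AE w in M. \<forall>n. 0 < H n w"
proof -
  have "AE w in M. w \<in> slow n {}" for n
  proof (rule AE_prob_1)
    show "prob (slow n {}) = 1" using slow_empty[of n] by (simp add: emeasure_eq_measure)
  qed
  then have "AE w in M. \<forall>n. w \<in> slow n {}" by (simp add: AE_all_countable)
  then show ?thesis by (rule AE_mp) (auto simp: slow_def)
qed

text \<open>Since the rates are bounded by \<open>qmax\<close>, each holding time exceeds 1 with conditional probability at
least \<open>exp (- qmax)\<close>. So infinitely many do, and the jump times tend to infinity.\<close>
lemma AE_holding_large: "AE w in M. \<forall>n. \<exists>m\<ge>n. 1 < H m w"
  unfolding AE_all_countable
proof
  fix n
  let ?c = "1 - exp (- qmax)"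
  have c: "0 \<le> ?c" "?c < 1" using rate_nonneg[of a] rate_le[of a] by auto
  define Z where "Z = {w\<in>space M. (\<forall>k. 0 < H k w) \<and> (\<forall>m\<ge>n. H m w \<le> 1)}"
  have [measurable]: "Z \<in> sets M" unfolding Z_def by measurable
  have "emeasure M Z \<le> ennreal (?c ^ j)" for j
  proof (cases j)
    case (Suc i)
    have "Z \<subseteq> slow (n + i) {n..n+i}" by (auto simp: Z_def slow_def)
    then have "emeasure M Z \<le> emeasure M (slow (n + i) {n..n+i})" by (rule emeasure_mono) measurable
    also have "\<dots> \<le> ennreal (?c ^ card {n..n+i})" by (rule slow_bound) auto
    finally show ?thesis by (simp add: Suc)
  qed (simp add: emeasure_le_1)
  moreover have "(\<lambda>j. ennreal (?c ^ j)) \<longlonglongrightarrow> ennreal 0"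
    using c by (intro tendsto_ennrealI LIMSEQ_realpow_zero) auto
  ultimately have "emeasure M Z \<le> ennreal 0"
    by (intro LIMSEQ_le_const[of _ "ennreal 0"]) auto
  then have "Z \<in> null_sets M" by (simp add: null_sets_def)
  then have "AE w in M. w \<notin> Z" by (rule AE_not_in)
  with AE_holding_pos AE_space show "AE w in M. \<exists>m\<ge>n. 1 < H m w"
    by eventually_elim (auto simp: Z_def not_le)
qed

lemma AE_regular_path: "AE w in M. regular_path (path w)"
  using AE_holding_pos AE_holding_large by eventually_elim (rule regular_pathI, auto)

lemma prefix_next:
  assumes "0 \<le> t"
  shows "emeasure M {w\<in>space M. prefix n w = ys \<and> Y (Suc n) w = v \<and> ereal t < H (Suc n) w} =
    emeasure M {w\<in>space M. prefix n w = ys} * p (last ys) v * ennreal (exp (- q v * t))"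
proof (cases "length ys = Suc n")
  case True
  let ?zs = "ys @ [v]"
  have last: "last ys = ys ! n" using True by (metis diff_Suc_1 last_conv_nth list.size(3) nat.simps(3))
  have "emeasure M {w\<in>space M. prefix n w = ys \<and> Y (Suc n) w = v \<and> ereal t < H (Suc n) w} =
    emeasure M {w\<in>space M. \<forall>k\<le>Suc n. Y k w = ?zs ! k \<and> ereal (if k = Suc n then t else 0) < H k w}"
  proof (rule emeasure_eq_AE)
    show "AE w in M. (w \<in> {w\<in>space M. prefix n w = ys \<and> Y (Suc n) w = v \<and> ereal t < H (Suc n) w}) =
      (w \<in> {w\<in>space M. \<forall>k\<le>Suc n. Y k w = ?zs ! k \<and> ereal (if k = Suc n then t else 0) < H k w})"
      using AE_holding_pos
    proof eventually_elim
      case (elim w)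
      have "prefix n w = ys \<and> Y (Suc n) w = v \<longleftrightarrow> (\<forall>k\<le>Suc n. Y k w = ?zs ! k)"
        using prefix_Suc_eq[of n w ys v] prefix_eq_iff[of "Suc n" w ?zs] True
        by (metis length_append_singleton)
      moreover have "ereal (if k = Suc n then t else 0) < H k w \<longleftrightarrow> (k = Suc n \<longrightarrow> ereal t < H (Suc n) w)" for k
        using elim by (simp add: zero_ereal_def)
      ultimately show ?case by auto
    qed
  qed measurable
  also have "\<dots> = ennreal (weight (Suc n) ((!) ?zs) * (\<Prod>k\<le>Suc n. exp (- q (?zs ! k) * (if k = Suc n then t else 0))))"
    using assms by (simp only: emeasure_eq_measure) (subst cylinder, auto)
  also have "(\<Prod>k\<le>Suc n. exp (- q (?zs ! k) * (if k = Suc n then t else 0))) = exp (- q v * t)"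
    using True by (simp add: nth_append)
  also have "ennreal (weight (Suc n) ((!) ?zs) * exp (- q v * t)) =
      ennreal (weight n ((!) ys)) * p (last ys) v * ennreal (exp (- q v * t))"
    using True by (simp add: weight_snoc last ennreal_mult weight_nonneg prob_nonneg)
  also have "ennreal (weight n ((!) ys)) = emeasure M {w\<in>slow n {}. prefix n w = ys}"
    using True by (simp add: slow_prefix)
  also have "\<dots> = emeasure M {w\<in>space M. prefix n w = ys}"
  proof (rule emeasure_eq_AE)
    show "AE w in M. (w \<in> {w\<in>slow n {}. prefix n w = ys}) = (w \<in> {w\<in>space M. prefix n w = ys})"
      using AE_holding_pos by eventually_elim (auto simp: slow_def)
    have "{w\<in>slow n {}. prefix n w = ys} = slow n {} \<inter> {w\<in>space M. prefix n w = ys}" by (auto simp: slow_def)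
    then show "{w\<in>slow n {}. prefix n w = ys} \<in> sets M" by simp
  qed measurable
  finally show ?thesis .
next
  case False
  then have "{w\<in>space M. prefix n w = ys} = {}"
    "{w\<in>space M. prefix n w = ys \<and> Y (Suc n) w = v \<and> ereal t < H (Suc n) w} = {}"
    unfolding prefix_eq_iff by blast+
  then show ?thesis by (simp only: emeasure_empty mult_zero_left)
qed

lemma last_prefix: "last (prefix n w) = Y n w"
  by (simp add: prefix_def last_map)

lemma set_prefix: "set (prefix n w) = (\<lambda>k. Y k w) ` {..n}"
  by (auto simp: prefix_def less_Suc_eq_le simp del: upt_Suc)

text \<open>The Markov property at step \<open>n\<close>, for an event that depends on the jump chain up to this step.\<close>
lemma markov_step:
  assumes "0 \<le> t"
  shows "emeasure M {w\<in>space M. prefix n w \<in> S \<and> Y (Suc n) w = v \<and> ereal t < H (Suc n) w} =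
    (\<integral>\<^sup>+z. emeasure M {w\<in>space M. prefix n w \<in> S \<and> Y n w = z} * p z v \<partial>count_space UNIV)
      * ennreal (exp (- q v * t))"
proof -
  let ?E = "{w\<in>space M. prefix n w \<in> S \<and> Y (Suc n) w = v \<and> ereal t < H (Suc n) w}"
  let ?F = "\<lambda>z. {w\<in>space M. prefix n w \<in> S \<and> Y n w = z}"
  have "emeasure M {w\<in>?E. Y n w = z} = emeasure M (?F z) * p z v * ennreal (exp (- q v * t))" for z
  proof -
    have "emeasure M {w\<in>{w\<in>?E. Y n w = z}. prefix n w = ys} =
        emeasure M {w\<in>?F z. prefix n w = ys} * (p z v * ennreal (exp (- q v * t)))" for ys
    proof (cases "ys \<in> S \<and> last ys = z")
      case True
      have "{w\<in>{w\<in>?E. Y n w = z}. prefix n w = ys} =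
          {w\<in>space M. prefix n w = ys \<and> Y (Suc n) w = v \<and> ereal t < H (Suc n) w}"
        "{w\<in>?F z. prefix n w = ys} = {w\<in>space M. prefix n w = ys}"
        using True by (auto simp: last_prefix[symmetric])
      then show ?thesis using prefix_next[OF assms, of n ys v] True by (simp only: mult.assoc)
    next
      case False
      then have "{w\<in>{w\<in>?E. Y n w = z}. prefix n w = ys} = {}" "{w\<in>?F z. prefix n w = ys} = {}"
        by (auto simp: last_prefix[symmetric])
      then show ?thesis by (simp only: emeasure_empty mult_zero_left)
    qed
    then have "(\<integral>\<^sup>+ys. emeasure M {w\<in>{w\<in>?E. Y n w = z}. prefix n w = ys} \<partial>count_space UNIV) =
      (\<integral>\<^sup>+ys. emeasure M {w\<in>?F z. prefix n w = ys} \<partial>count_space UNIV) * (p z v * ennreal (exp (- q v * t)))"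
      by (simp only:) (subst nn_integral_multc, auto)
    moreover have "emeasure M {w\<in>?E. Y n w = z} =
        (\<integral>\<^sup>+ys. emeasure M {w\<in>{w\<in>?E. Y n w = z}. prefix n w = ys} \<partial>count_space UNIV)"
    proof (rule emeasure_partition)
      have "{w\<in>?E. Y n w = z} = {w\<in>space M. prefix n w \<in> S \<and> Y (Suc n) w = v \<and> ereal t < H (Suc n) w \<and> Y n w = z}"
        by auto
      then show "{w\<in>?E. Y n w = z} \<in> sets M" by simp
    qed measurable
    moreover have "emeasure M (?F z) = (\<integral>\<^sup>+ys. emeasure M {w\<in>?F z. prefix n w = ys} \<partial>count_space UNIV)"
      by (rule emeasure_partition) measurable
    ultimately show ?thesis by (simp only: mult.assoc)
  qed
  moreover have "emeasure M ?E = (\<integral>\<^sup>+z. emeasure M {w\<in>?E. Y n w = z} \<partial>count_space UNIV)"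
    by (rule emeasure_partition) measurable
  ultimately show ?thesis by (simp only:) (subst nn_integral_multc, auto)
qed

text \<open>The jump chain is at \<open>v\<close> at step \<open>n\<close> and has not been in \<open>D\<close> before.\<close>
definition avoid :: "'s set \<Rightarrow> nat \<Rightarrow> 's \<Rightarrow> 'w set" where
  "avoid D n v = {w\<in>space M. (\<forall>k<n. Y k w \<notin> D) \<and> Y n w = v}"

lemma avoid_measurable [measurable]: "avoid D n v \<in> sets M"
  unfolding avoid_def by measurable

lemma avoid_law:
  assumes "a \<notin> D" "0 \<le> t"
  shows "emeasure M {w\<in>avoid D n v. ereal t < H n w} =
    (case n of 0 \<Rightarrow> kid a v | Suc m \<Rightarrow> (kpow (restr p (- D)) m \<odot> p) a v) * ennreal (exp (- q v * t))"
  using assms(2)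
proof (induction n arbitrary: v t)
  case 0
  have "{w\<in>avoid D 0 v. ereal t < H 0 w} =
      {w\<in>space M. \<forall>k\<le>0. Y k w = (\<lambda>_. v) k \<and> H k w > ereal ((\<lambda>_. t) k)}"
    by (auto simp: avoid_def)
  then have "emeasure M {w\<in>avoid D 0 v. ereal t < H 0 w} =
    ennreal (weight 0 (\<lambda>_. v) * (\<Prod>k\<le>(0::nat). exp (- q ((\<lambda>_. v) k) * (\<lambda>_. t) k)))"
    using 0 by (simp only: emeasure_eq_measure) (subst cylinder, simp_all)
  then show ?case by (simp add: weight_def kid_def ennreal_mult)
next
  case (Suc n)
  let ?S = "{ys. set ys \<inter> D = {}}"
  have S: "prefix n w \<in> ?S \<longleftrightarrow> (\<forall>k<Suc n. Y k w \<notin> D)" for w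
    by (auto simp: set_prefix less_Suc_eq_le)
  have "{w\<in>avoid D (Suc n) v. ereal t < H (Suc n) w} =
    {w\<in>space M. prefix n w \<in> ?S \<and> Y (Suc n) w = v \<and> ereal t < H (Suc n) w}"
    unfolding S avoid_def by blast
  then have "emeasure M {w\<in>avoid D (Suc n) v. ereal t < H (Suc n) w} =
    (\<integral>\<^sup>+z. emeasure M {w\<in>space M. prefix n w \<in> ?S \<and> Y n w = z} * p z v \<partial>count_space UNIV)
      * ennreal (exp (- q v * t))"
    by (simp only: markov_step[OF Suc.prems])
  also have "(\<lambda>z. emeasure M {w\<in>space M. prefix n w \<in> ?S \<and> Y n w = z}) = kpow (restr p (- D)) n a"
  proof (rule ext)
    fix z
    show "emeasure M {w\<in>space M. prefix n w \<in> ?S \<and> Y n w = z} = kpow (restr p (- D)) n a z"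
  proof (cases "z \<in> D")
    case True
    then have "{w\<in>space M. prefix n w \<in> ?S \<and> Y n w = z} = {}" unfolding S by auto
    moreover have "kpow (restr p (- D)) n a z = 0"
      using True assms(1) by (cases n) (auto simp: kid_def kmul_restr)
    ultimately show ?thesis by (simp only: emeasure_empty)
  next
    case False
    have "{w\<in>space M. prefix n w \<in> ?S \<and> Y n w = z} = avoid D n z"
      unfolding S avoid_def less_Suc_eq using False by blast
    then have "emeasure M {w\<in>space M. prefix n w \<in> ?S \<and> Y n w = z} = emeasure M (avoid D n z)"
      by (simp only:)
    also have "\<dots> = emeasure M {w\<in>avoid D n z. ereal 0 < H n w}"
    proof (rule emeasure_eq_AE)
      show "AE w in M. (w \<in> avoid D n z) = (w \<in> {w\<in>avoid D n z. ereal 0 < H n w})"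
        using AE_holding_pos by eventually_elim (simp add: zero_ereal_def)
      have "{w\<in>avoid D n z. ereal 0 < H n w} = avoid D n z \<inter> {w\<in>space M. ereal 0 < H n w}"
        by (auto simp: avoid_def)
      then show "{w\<in>avoid D n z. ereal 0 < H n w} \<in> sets M" by simp
    qed measurable
    also have "\<dots> = kpow (restr p (- D)) n a z"
      unfolding Suc.IH[OF order_refl] using False by (cases n) (simp_all add: kmul_restr)
    finally show ?thesis .
  qed
  qed
  finally show ?case by (simp add: kmul_def)
qed

lemma avoid_prob:
  assumes "a \<notin> D"
  shows "emeasure M (avoid D n v) =
    (case n of 0 \<Rightarrow> kid a v | Suc m \<Rightarrow> (kpow (restr p (- D)) m \<odot> p) a v)"
proof -
  have "emeasure M (avoid D n v) = emeasure M {w\<in>avoid D n v. ereal 0 < H n w}"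
  proof (rule emeasure_eq_AE)
    show "AE w in M. (w \<in> avoid D n v) = (w \<in> {w\<in>avoid D n v. ereal 0 < H n w})"
      using AE_holding_pos by eventually_elim (simp add: zero_ereal_def)
    have "{w\<in>avoid D n v. ereal 0 < H n w} = avoid D n v \<inter> {w\<in>space M. ereal 0 < H n w}"
      by (auto simp: avoid_def)
    then show "{w\<in>avoid D n v. ereal 0 < H n w} \<in> sets M" by simp
  qed measurable
  then show ?thesis using avoid_law[OF assms, of 0 n v] by simp
qed

text \<open>The law of the position at which \<open>D\<close> is entered. The final \<open>\<odot> p\<close> is the step that enters \<open>D\<close>.\<close>
theorem hitting_law:
  assumes "a \<notin> D" "v \<in> D"
  shows "emeasure M {w\<in>space M. hit D (path w) = hit {v} (path w) \<and> hit D (path w) < \<infinity>} =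
    (green p (- D) \<odot> p) a v"
proof -
  have "emeasure M {w\<in>space M. hit D (path w) = hit {v} (path w) \<and> hit D (path w) < \<infinity>} =
      emeasure M (\<Union>n. avoid D n v)"
  proof (rule emeasure_eq_AE)
    show "AE w in M. (w \<in> {w\<in>space M. hit D (path w) = hit {v} (path w) \<and> hit D (path w) < \<infinity>})
        = (w \<in> (\<Union>n. avoid D n v))"
      using AE_regular_path
    proof eventually_elim
      case (elim w)
      show ?case
        unfolding avoid_def mem_Collect_eq UN_iff hit_at_state_iff[OF elim assms(2)] by blast
    qed
  qed measurable
  also have "\<dots> = (\<Sum>n. emeasure M (avoid D n v))"
  proof (rule suminf_emeasure[symmetric])
    have "\<not> m < n" if "w \<in> avoid D m v" "w \<in> avoid D n v" for m n w
      using that assms(2) unfolding avoid_def by blast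
    then have "m = n" if "w \<in> avoid D m v" "w \<in> avoid D n v" for m n w
      using that by (meson linorder_neqE_nat)
    then show "disjoint_family (\<lambda>n. avoid D n v)" by (auto simp: disjoint_family_on_def)
  qed auto
  also have "\<dots> = (\<Sum>n. emeasure M (avoid D (Suc n) v)) + emeasure M (avoid D 0 v)"
    using suminf_offset[of "\<lambda>n. emeasure M (avoid D n v)" 1] by simp
  also have "emeasure M (avoid D 0 v) = 0"
    using assms by (auto simp: avoid_prob kid_def)
  also have "(\<Sum>n. emeasure M (avoid D (Suc n) v)) = (green p (- D) \<odot> p) a v"
    unfolding avoid_prob[OF assms(1)] nat.case green_def ksum_def kmul_def
    by (simp add: nn_integral_suminf flip: ennreal_suminf_multc)
  finally show ?thesis by simp
qed

lemma nn_integral_exp_tail: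
  assumes "0 < l"
  shows "(\<integral>\<^sup>+t. ennreal (exp (- l * t)) * indicator {0..} t \<partial>lborel) = ennreal (1 / l)"
proof -
  interpret D: prob_space "density lborel (exponential_density l)"
    by (rule prob_space_exponential_density[OF assms])
  have "1 = (\<integral>\<^sup>+t. ennreal (exponential_density l t) \<partial>lborel)"
    using D.emeasure_space_1 by (simp add: emeasure_density)
  also have "\<dots> = (\<integral>\<^sup>+t. ennreal l * (ennreal (exp (- l * t)) * indicator {0..} t) \<partial>lborel)"
    using assms by (intro nn_integral_cong)
      (auto simp: exponential_density_def ennreal_mult mult.commute split: split_indicator)
  also have "\<dots> = ennreal l * (\<integral>\<^sup>+t. ennreal (exp (- l * t)) * indicator {0..} t \<partial>lborel)"
    by (rule nn_integral_cmult) measurable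
  finally have eq: "ennreal l * (\<integral>\<^sup>+t. ennreal (exp (- l * t)) * indicator {0..} t \<partial>lborel) = 1" ..
  have "ennreal (1 / l) = ennreal (1 / l) * (ennreal l * (\<integral>\<^sup>+t. ennreal (exp (- l * t)) * indicator {0..} t \<partial>lborel))"
    unfolding eq by simp
  also have "\<dots> = (ennreal (1 / l) * ennreal l) * (\<integral>\<^sup>+t. ennreal (exp (- l * t)) * indicator {0..} t \<partial>lborel)"
    by (simp only: mult.assoc)
  also have "ennreal (1 / l) * ennreal l = 1"
    using assms by (simp flip: ennreal_mult)
  finally show ?thesis by simp
qed

text \<open>The layer-cake formula; a negative argument yields 0 on both sides.\<close>
lemma holding_layer_cake:
  "e2ennreal h = (\<integral>\<^sup>+t. indicator {0..} t * (if ereal t < h then 1 else 0) \<partial>lborel)"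
proof -
  have meas: "{t. 0 \<le> t \<and> ereal t < h} \<in> sets lborel" by simp
  have "(\<integral>\<^sup>+t. indicator {0..} t * (if ereal t < h then 1 else 0) \<partial>lborel) =
      (\<integral>\<^sup>+t. indicator {t. 0 \<le> t \<and> ereal t < h} t \<partial>lborel)"
    by (intro nn_integral_cong) (auto split: split_indicator)
  also have "\<dots> = emeasure lborel {t. 0 \<le> t \<and> ereal t < h}"
    by (rule nn_integral_indicator[OF meas])
  also have "\<dots> = e2ennreal h"
  proof (cases h)
    case (real r)
    have "{t. 0 \<le> t \<and> ereal t < h} = {0..<r}" using real by auto
    then have "emeasure lborel {t. 0 \<le> t \<and> ereal t < h} = emeasure lborel {0..<r}" by (simp only:)
    then show ?thesis using real by (cases "0 \<le> r") (simp_all add: ennreal_neg)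
  next
    case PInf
    have "{t::real. 0 \<le> t} = {0..}" by auto
    moreover have "emeasure lborel {0::real..} = top"
    proof (rule ccontr)
      assume "emeasure lborel {0::real..} \<noteq> top"
      then have "emeasure lborel {0::real..} < top" by (simp add: less_top)
      then obtain n where n: "emeasure lborel {0::real..} < of_nat n"
        using ennreal_Ex_less_of_nat by auto
      have "emeasure lborel {0..<real n} \<le> emeasure lborel {0::real..}"
        by (rule emeasure_mono) auto
      then have "of_nat n \<le> emeasure lborel {0::real..}"
        by (simp add: ennreal_of_nat_eq_real_of_nat)
      with n show False by simp
    qed
    ultimately show ?thesis using PInf by simp
  next
    case MInf
    then show ?thesis by (simp add: e2ennreal_neg)
  qed
  finally show ?thesis ..
qed

lemma mean_holding:
  assumes "a \<notin> D" "0 < q v"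
  shows "(\<integral>\<^sup>+w. e2ennreal (H n w) * indicator (avoid D n v) w \<partial>M) =
    emeasure M (avoid D n v) * ennreal (1 / q v)"
proof -
  interpret pair_sigma_finite M lborel ..
  have "(\<integral>\<^sup>+w. e2ennreal (H n w) * indicator (avoid D n v) w \<partial>M) =
    (\<integral>\<^sup>+w. \<integral>\<^sup>+t. indicator {0..} t * (if ereal t < H n w then 1 else 0) * indicator (avoid D n v) w \<partial>lborel \<partial>M)"
    by (subst holding_layer_cake, subst nn_integral_multc) auto
  also have "\<dots> = (\<integral>\<^sup>+t. \<integral>\<^sup>+w. indicator {0..} t * (if ereal t < H n w then 1 else 0) * indicator (avoid D n v) w \<partial>M \<partial>lborel)"
    by (rule Fubini'[symmetric]) measurable
  also have "\<dots> = (\<integral>\<^sup>+t. emeasure M (avoid D n v) * (ennreal (exp (- q v * t)) * indicator {0..} t) \<partial>lborel)"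
  proof (intro nn_integral_cong)
    fix t :: real
    show "(\<integral>\<^sup>+w. indicator {0..} t * (if ereal t < H n w then 1 else 0) * indicator (avoid D n v) w \<partial>M)
      = emeasure M (avoid D n v) * (ennreal (exp (- q v * t)) * indicator {0..} t)"
    proof (cases "0 \<le> t")
      case True
      have "{w\<in>avoid D n v. ereal t < H n w} = avoid D n v \<inter> {w\<in>space M. ereal t < H n w}"
        by (auto simp: avoid_def)
      then have [measurable]: "{w\<in>avoid D n v. ereal t < H n w} \<in> sets M" by simp
      have "(\<integral>\<^sup>+w. indicator {0..} t * (if ereal t < H n w then 1 else 0) * indicator (avoid D n v) w \<partial>M)
        = (\<integral>\<^sup>+w. indicator {w\<in>avoid D n v. ereal t < H n w} w \<partial>M)"
        using True by (intro nn_integral_cong) (auto split: split_indicator)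
      also have "\<dots> = emeasure M {w\<in>avoid D n v. ereal t < H n w}"
        by (rule nn_integral_indicator) measurable
      also have "\<dots> = emeasure M (avoid D n v) * ennreal (exp (- q v * t))"
        unfolding avoid_law[OF assms(1) True] avoid_prob[OF assms(1)] ..
      finally show ?thesis using True by simp
    qed simp
  qed
  also have "\<dots> = emeasure M (avoid D n v) * ennreal (1 / q v)"
    by (subst nn_integral_cmult) (auto simp only: nn_integral_exp_tail[OF assms(2)], measurable)
  finally show ?thesis .
qed

lemma AE_holding_finite:
  assumes "0 < q v"
  shows "AE w in M. \<forall>n. Y n w = v \<longrightarrow> H n w < \<infinity>"
  unfolding AE_all_countable
proof
  fix n
  have "(\<integral>\<^sup>+w. e2ennreal (H n w) * indicator (avoid {} n v) w \<partial>M) \<noteq> \<infinity>"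
    unfolding mean_holding[OF _ assms, of "{}", simplified]
    by (simp add: ennreal_mult_eq_top_iff)
  then have "AE w in M. e2ennreal (H n w) * indicator (avoid {} n v) w \<noteq> \<infinity>"
    by (intro nn_integral_PInf_AE) measurable
  then show "AE w in M. Y n w = v \<longrightarrow> H n w < \<infinity>"
    using AE_space by eventually_elim (auto simp: avoid_def)
qed

text \<open>The expected time in \<open>v\<close> before \<open>D\<close> is the expected number of visits times the mean holding time.\<close>
theorem mean_occupation_time:
  assumes a: "a \<notin> D" and v: "v \<notin> D" and q: "0 < q v"
  shows "(\<integral>\<^sup>+w. (\<integral>\<^sup>+s\<in>{s. 0 \<le> s \<and> ereal s \<le> hit D (path w)}. indicator {s. X s w = v} s \<partial>lborel) \<partial>M) =
    green p (- D) a v * ennreal (1 / q v)"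
proof -
  have "(\<integral>\<^sup>+w. (\<integral>\<^sup>+s\<in>{s. 0 \<le> s \<and> ereal s \<le> hit D (path w)}. indicator {s. X s w = v} s \<partial>lborel) \<partial>M) =
    (\<integral>\<^sup>+w. (\<Sum>n. e2ennreal (H n w) * indicator (avoid D n v) w) \<partial>M)"
  proof (rule nn_integral_cong_AE)
    show "AE w in M. (\<integral>\<^sup>+s\<in>{s. 0 \<le> s \<and> ereal s \<le> hit D (path w)}. indicator {s. X s w = v} s \<partial>lborel) =
        (\<Sum>n. e2ennreal (H n w) * indicator (avoid D n v) w)"
      using AE_regular_path AE_holding_finite[OF q] AE_space
    proof eventually_elim
      case (elim w)
      show ?case
        by (subst occupation_time_eq_suminf[OF elim(1) v])
           (use elim in \<open>auto simp: avoid_def indicator_def intro!: suminf_cong\<close>)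
    qed
  qed
  also have "\<dots> = (\<Sum>n. emeasure M (avoid D n v) * ennreal (1 / q v))"
    by (subst nn_integral_suminf) (auto simp: mean_holding[OF a q])
  also have "\<dots> = (\<Sum>n. kpow (restr p (- D)) n a v * ennreal (1 / q v))"
  proof (intro suminf_cong)
    fix n show "emeasure M (avoid D n v) * ennreal (1 / q v) = kpow (restr p (- D)) n a v * ennreal (1 / q v)"
      unfolding avoid_prob[OF a] using v by (cases n) (simp_all add: kmul_restr)
  qed
  also have "\<dots> = green p (- D) a v * ennreal (1 / q v)"
    by (simp add: green_def ksum_def)
  finally show ?thesis .
qed

end

section \<open>The skip-free chain on levels and phases\<close>
lemma nn_integral_count_space_option:
  fixes f :: "(int \<times> 'n::finite) option \<Rightarrow> ennreal"
  shows "(\<integral>\<^sup>+v. f v \<partial>count_space UNIV) =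
    f None + (\<integral>\<^sup>+l. (\<Sum>j\<in>UNIV. f (Some (l, j))) \<partial>count_space UNIV)"
proof -
  have "(\<integral>\<^sup>+v. f v \<partial>count_space UNIV) =
      (\<integral>\<^sup>+v. f v * indicator {None} v + f v * indicator (range Some) v \<partial>count_space UNIV)"
  proof (intro nn_integral_cong)
    fix v show "f v = f v * indicator {None} v + f v * indicator (range Some) v"
      by (cases v) auto
  qed
  also have "\<dots> = f None + (\<integral>\<^sup>+v. f v * indicator (range Some) v \<partial>count_space UNIV)"
    by (subst nn_integral_add) (auto simp: nn_integral_indicator_finite)
  also have "(\<integral>\<^sup>+v. f v * indicator (range Some) v \<partial>count_space UNIV) = (\<integral>\<^sup>+v. f v \<partial>count_space (range Some))"
    by (rule nn_integral_count_space_indicator[symmetric]) simp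
  also have "\<dots> = (\<integral>\<^sup>+x. f (Some x) \<partial>count_space UNIV)"
    by (rule nn_integral_bij_count_space[symmetric]) (simp add: bij_betw_def)
  also have "\<dots> = (\<integral>\<^sup>+l. (\<integral>\<^sup>+j. f (Some (l, j)) \<partial>count_space UNIV) \<partial>count_space UNIV)"
    by (rule nn_integral_fst_count_space[symmetric])
  also have "\<dots> = (\<integral>\<^sup>+l. (\<Sum>j\<in>UNIV. f (Some (l, j))) \<partial>count_space UNIV)"
    by (intro nn_integral_cong nn_integral_count_space_finite) simp
  finally show ?thesis .
qed

lemma nn_integral_count_space_range:
  fixes g :: "'i \<Rightarrow> ennreal" and h :: "nat \<Rightarrow> 'i"
  assumes "inj h" "\<And>l. l \<notin> range h \<Longrightarrow> g l = 0"
  shows "(\<integral>\<^sup>+l. g l \<partial>count_space UNIV) = (\<Sum>n. g (h n))"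
proof -
  have "(\<integral>\<^sup>+l. g l \<partial>count_space UNIV) = (\<integral>\<^sup>+l. g l * indicator (range h) l \<partial>count_space UNIV)"
    using assms(2) by (intro nn_integral_cong) (auto split: split_indicator)
  also have "\<dots> = (\<integral>\<^sup>+l. g l \<partial>count_space (range h))"
    by (rule nn_integral_count_space_indicator[symmetric]) simp
  also have "\<dots> = (\<integral>\<^sup>+n. g (h n) \<partial>count_space UNIV)"
    using assms(1) by (intro nn_integral_bij_count_space[symmetric]) (simp add: bij_betw_def)
  finally show ?thesis by (simp add: nn_integral_count_space_nat)
qed

lemma nn_integral_count_space_int_ge:
  fixes g :: "int \<Rightarrow> ennreal"
  assumes "\<And>l. l < c \<Longrightarrow> g l = 0"
  shows "(\<integral>\<^sup>+l. g l \<partial>count_space UNIV) = (\<Sum>n. g (c + int n))"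
proof (rule nn_integral_count_space_range)
  fix l assume l: "l \<notin> range (\<lambda>n. c + int n)"
  have "l < c"
  proof (rule ccontr)
    assume "\<not> l < c"
    then have "l = c + int (nat (l - c))" by simp
    with l show False by blast
  qed
  then show "g l = 0" by (rule assms)
qed (auto intro: injI)

lemma nn_integral_count_space_int_le:
  fixes g :: "int \<Rightarrow> ennreal"
  assumes "\<And>l. l > 0 \<Longrightarrow> g l = 0"
  shows "(\<integral>\<^sup>+l. g l \<partial>count_space UNIV) = (\<Sum>n. g (- int n))"
proof (rule nn_integral_count_space_range)
  fix l assume l: "l \<notin> range (\<lambda>n. - int n)"
  have "l > 0"
  proof (rule ccontr)
    assume "\<not> l > 0"
    then have "l = - int (nat (- l))" by simp
    with l show False by blast
  qed
  then show "g l = 0" by (rule assms)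
qed (auto intro: injI)

text \<open>The states in level \<open>c\<close> or higher.\<close>
definition above :: "int \<Rightarrow> (int \<times> 'n) option set" where
  "above c = {s. \<exists>k i. s = Some (k, i) \<and> c \<le> k}"

text \<open>The complement of \<open>above c\<close>. It contains the cemetery, as a killed path never passes above \<open>c\<close>.\<close>
definition below :: "int \<Rightarrow> (int \<times> 'n) option set" where
  "below c = - above c"

definition level :: "int \<Rightarrow> (int \<times> 'n) option set" where
  "level c = range (\<lambda>j. Some (c, j))"

lemma mem_above [simp]: "Some (k, i) \<in> above c \<longleftrightarrow> c \<le> k" "None \<notin> above c"
  by (auto simp: above_def)

lemma mem_below [simp]: "Some (k, i) \<in> below c \<longleftrightarrow> k < c" "None \<in> below c"
  by (auto simp: below_def)

lemma mem_level [simp]: "Some (k, i) \<in> level c \<longleftrightarrow> k = c" "None \<notin> level c"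
  by (auto simp: level_def)

lemma below_Un_level: "below c \<union> level c = (below (c + 1) :: (int \<times> 'n) option set)"
proof (rule set_eqI)
  fix s :: "(int \<times> 'n) option"
  show "s \<in> below c \<union> level c \<longleftrightarrow> s \<in> below (c + 1)"
    by (cases s) auto
qed

lemma below_Int_level: "below c \<inter> level c = ({} :: (int \<times> 'n) option set)"
  by (auto simp: level_def)

lemma tau_up_eq_hit: "tau_up c = hit (above c)"
  by (intro ext) (auto simp: tau_up_def hit_def above_def intro!: INF_cong)

lemma tau_eq_hit: "tau c = hit (level c)"
  by (intro ext) (auto simp: tau_def hit_def level_def image_iff intro!: INF_cong)

text \<open>The transition structure alone, without any process.\<close>
locale skipfree =
  fixes A :: "int \<Rightarrow> real^'n^'n"
  assumes blocks: "skipfree_blocks A"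
begin

text \<open>The exit rate of phase \<open>i\<close>.\<close>
definition q :: "'n \<Rightarrow> real" where "q i = - A 0 $ i $ i"

text \<open>The blocks \<open>A m\<close> with the diagonal of \<open>A 0\<close> removed: the rates of the actual jumps.\<close>
definition off :: "int \<Rightarrow> 'n \<Rightarrow> 'n \<Rightarrow> real" where
  "off m i j = (if m = 0 \<and> i = j then 0 else A m $ i $ j)"

abbreviation pk :: "(int \<times> 'n) option \<Rightarrow> (int \<times> 'n) option \<Rightarrow> ennreal" where
  "pk u v \<equiv> ennreal (jump_prob (map_gen A) u v)"

lemma q_pos [simp]: "0 < q i"
  using blocks by (simp add: q_def skipfree_blocks_def)

lemma q_neq_0 [simp]: "q i \<noteq> 0"
  using q_pos[of i] by linarith

lemma q_nonneg [simp]: "0 \<le> q i"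
  using q_pos[of i] by linarith

lemma off_nonneg [simp]: "0 \<le> off m i j"
  using blocks by (auto simp: off_def skipfree_blocks_def)

lemma off_down: "m \<le> -2 \<Longrightarrow> off m i j = 0"
  using blocks by (auto simp: off_def skipfree_blocks_def)

lemma A_eq_off: "A m $ i $ j = off m i j - (if m = 0 \<and> i = j then q j else 0)"
  by (auto simp: off_def q_def)

lemma kill_nonneg: "0 \<le> kill_rate A i"
  using blocks by (auto simp: skipfree_blocks_def)

lemma exit_rate_Some [simp]: "exit_rate (map_gen A) (Some (k, i)) = q i"
  by (simp add: exit_rate_def level_rates_def q_def)

lemma exit_rate_None [simp]: "exit_rate (map_gen A) None = 0"
  by (simp add: exit_rate_def)

lemma jump_prob_Some [simp]: "jump_prob (map_gen A) (Some (k, i)) (Some (l, j)) = off (l - k) i j / q i"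
  by (auto simp: jump_prob_def level_rates_def off_def)

lemma jump_prob_kill [simp]: "jump_prob (map_gen A) (Some (k, i)) None = kill_rate A i / q i"
  by (simp add: jump_prob_def)

lemma jump_prob_None [simp]: "jump_prob (map_gen A) None v = (if v = None then 1 else 0)"
  by (auto simp: jump_prob_def)

lemma jump_prob_nonneg: "0 \<le> jump_prob (map_gen A) u v"
  by (cases u; cases v) (auto intro!: divide_nonneg_nonneg simp: kill_nonneg split: prod.split)

lemma off_sums: "(\<lambda>n. \<Sum>j\<in>UNIV. off (int n - 1) i j) sums (q i - kill_rate A i)"
proof -
  have "(\<lambda>n. A (int n - 1)) sums phase_gen A"
    using blocks by (auto simp: skipfree_blocks_def phase_gen_def)
  then have "(\<lambda>n. A (int n - 1) $ i $ j) sums (phase_gen A $ i $ j)" for j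
    by (intro bounded_linear.sums[OF bounded_linear_vec_nth])
  then have "(\<lambda>n. \<Sum>j\<in>UNIV. A (int n - 1) $ i $ j) sums (\<Sum>j\<in>UNIV. phase_gen A $ i $ j)"
    by (intro sums_sum)
  then have "(\<lambda>n. (if n = 1 then q i else 0) + (\<Sum>j\<in>UNIV. A (int n - 1) $ i $ j)) sums (q i + (- kill_rate A i))"
    using sums_single[of 1 "\<lambda>_. q i"] by (intro sums_add) (auto simp: kill_rate_def)
  moreover have "(if n = 1 then q i else 0) + (\<Sum>j\<in>UNIV. A (int n - 1) $ i $ j) = (\<Sum>j\<in>UNIV. off (int n - 1) i j)" for n
    by (auto simp: A_eq_off sum_subtractf)
  ultimately show ?thesis by simp
qed

lemma jump_prob_sum: "(\<integral>\<^sup>+v. pk u v \<partial>count_space UNIV) = 1"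
proof (cases u)
  case None
  then show ?thesis by (subst nn_integral_count_space_option) simp
next
  case (Some ki)
  then obtain k i where u: "u = Some (k, i)" by (cases ki) auto
  have nn: "0 \<le> q i - kill_rate A i"
    by (rule sums_le[OF _ sums_zero off_sums[of i]]) (simp add: sum_nonneg)
  have "(\<integral>\<^sup>+v. pk u v \<partial>count_space UNIV) = ennreal (kill_rate A i / q i) +
     (\<integral>\<^sup>+l. (\<Sum>j\<in>UNIV. ennreal (off (l - k) i j / q i)) \<partial>count_space UNIV)"
    unfolding u by (subst nn_integral_count_space_option) simp
  also have "(\<integral>\<^sup>+l. (\<Sum>j\<in>UNIV. ennreal (off (l - k) i j / q i)) \<partial>count_space UNIV) =
     (\<Sum>n. \<Sum>j\<in>UNIV. ennreal (off (k - 1 + int n - k) i j / q i))"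
    by (rule nn_integral_count_space_int_ge) (simp add: off_down)
  also have "\<dots> = (\<Sum>n. ennreal ((\<Sum>j\<in>UNIV. off (int n - 1) i j) / q i))"
    by (simp add: sum_divide_distrib algebra_simps)
  also have "\<dots> = ennreal ((q i - kill_rate A i) / q i)"
  proof (rule sums_unique[symmetric])
    have "(\<lambda>n. (\<Sum>j\<in>UNIV. off (int n - 1) i j) / q i) sums ((q i - kill_rate A i) / q i)"
      by (intro sums_divide off_sums)
    then show "(\<lambda>n. ennreal ((\<Sum>j\<in>UNIV. off (int n - 1) i j) / q i)) sums ennreal ((q i - kill_rate A i) / q i)"
      using nn by (subst sums_ennreal) (simp_all add: sum_nonneg)
  qed
  also have "ennreal (kill_rate A i / q i) + ennreal ((q i - kill_rate A i) / q i) = 1"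
    using nn by (subst ennreal_plus[symmetric]) (simp_all add: kill_nonneg add_divide_distrib[symmetric])
  finally show ?thesis .
qed

lemma green_shift:
  "green pk (below (b + c)) (Some (k + c, i)) (Some (l + c, j)) = green pk (below b) (Some (k, i)) (Some (l, j))"
proof -
  define \<sigma> :: "(int \<times> 'n) option \<Rightarrow> (int \<times> 'n) option" where
    "\<sigma> = map_option (\<lambda>(k, i). (k + c, i))"
  define \<sigma>' :: "(int \<times> 'n) option \<Rightarrow> (int \<times> 'n) option" where
    "\<sigma>' = map_option (\<lambda>(k, i). (k - c, i))"
  have inv: "\<sigma>' (\<sigma> s) = s" "\<sigma> (\<sigma>' s) = s" for s
    by (cases s; auto simp: \<sigma>_def \<sigma>'_def)+
  have bij: "bij \<sigma>" by (rule o_bij[of \<sigma>']) (auto simp: fun_eq_iff inv)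
  have mem: "s \<in> below (b + c) \<longleftrightarrow> \<sigma>' s \<in> below b" for s
    by (cases s) (auto simp: \<sigma>'_def)
  have "\<sigma> ` below b = below (b + c)"
  proof (intro set_eqI iffI)
    fix s :: "(int \<times> 'n) option" assume "s \<in> below (b + c)"
    then have "\<sigma> (\<sigma>' s) \<in> \<sigma> ` below b" using mem by blast
    then show "s \<in> \<sigma> ` below b" by (simp only: inv)
  next
    fix s :: "(int \<times> 'n) option" assume "s \<in> \<sigma> ` below b"
    then obtain r where "r \<in> below b" "s = \<sigma> r" by blast
    then show "s \<in> below (b + c)" by (simp only: mem inv)
  qed
  moreover have "pk (\<sigma> u) (\<sigma> v) = pk u v" for u v
  proof -
    have "\<sigma> None = None" "\<And>k i. \<sigma> (Some (k, i)) = Some (k + c, i)" by (simp_all add: \<sigma>_def)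
    then show ?thesis by (cases u; cases v) (simp_all add: split_paired_all)
  qed
  ultimately show ?thesis
    using green_bij[of \<sigma> pk "below b" "Some (k, i)" "Some (l, j)"] bij by (simp add: \<sigma>_def)
qed

text \<open>By irreducibility every state reaches level \<open>b\<close>.\<close>
lemma green_below_finite:
  assumes "l < b"
  shows "green pk (below b) u (Some (l, j)) < \<infinity>"
proof -
  have "(\<lambda>u v. level_rates A u v > 0)\<^sup>*\<^sup>* (l, j) (b, j)"
  proof -
    have "irreducible_rates (level_rates A)" using blocks by (simp add: skipfree_blocks_def)
    then show ?thesis unfolding irreducible_rates_def by simp
  qed
  then have path: "(\<lambda>x y. pk x y > 0)\<^sup>*\<^sup>* (Some (l, j)) (Some (b, j))"
  proof (induction rule: rtranclp_induct)
    case (step y z)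
    obtain k i where y: "y = (k, i)" by (cases y)
    obtain k' i' where z: "z = (k', i')" by (cases z)
    have A: "A (k' - k) $ i $ i' > 0" using step(2) by (simp add: y z level_rates_def)
    have "\<not> (k' - k = 0 \<and> i = i')"
    proof
      assume "k' - k = 0 \<and> i = i'"
      then show False using q_pos[of i] A by (simp add: q_def)
    qed
    then have "off (k' - k) i i' > 0" using A by (simp add: off_def)
    then have "pk (Some y) (Some z) > 0" by (simp add: y z)
    with step.IH show ?case by (rule rtranclp.rtrancl_into_rtrancl)
  qed simp
  show ?thesis
    by (rule green_finite[OF _ path]) (use assms in \<open>simp_all add: jump_prob_sum\<close>)
qed

end

section \<open>Descent below the starting level and the matrix R\<close>
lemma matpow_0 [simp]: "matpow B 0 = mat 1"
  by (simp add: matpow_def)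

lemma matpow_Suc: "matpow B (Suc n) = B ** matpow B n"
  by (simp add: matpow_def)

lemma matpow_add: "matpow B (m + n) = matpow B m ** matpow B n"
  by (induction m) (simp_all add: matpow_Suc matrix_mul_assoc)

lemma matpow_1 [simp]: "matpow B (Suc 0) = B"
  by (simp add: matpow_Suc)

lemma matpow_nonneg: "(\<And>i j. 0 \<le> B $ i $ j) \<Longrightarrow> 0 \<le> matpow B n $ i $ j"
  by (induction n arbitrary: i j)
    (auto simp: matpow_Suc matrix_matrix_mult_def mat_def intro!: sum_nonneg)

lemma sums_matrix_iff:
  "f sums (S :: real^'n^'n) \<longleftrightarrow> (\<forall>i j. (\<lambda>n. f n $ i $ j) sums (S $ i $ j))"
proof
  assume "f sums S"
  then show "\<forall>i j. (\<lambda>n. f n $ i $ j) sums (S $ i $ j)"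
    by (intro allI bounded_linear.sums[OF bounded_linear_vec_nth])
next
  assume "\<forall>i j. (\<lambda>n. f n $ i $ j) sums (S $ i $ j)"
  then show "f sums S"
    unfolding sums_def by (intro vec_tendstoI) (simp add: sum_component)
qed

context skipfree
begin

abbreviation origin :: "'n \<Rightarrow> (int \<times> 'n) option" where "origin i \<equiv> Some (0, i)"

lemma nn_integral_level:
  "(\<integral>\<^sup>+y. F y * indicator (level c) y \<partial>count_space UNIV) = (\<Sum>y\<in>UNIV. F (Some (c, y :: 'n)))"
  unfolding level_def by (rule nn_integral_indicator_range) (auto intro: injI)

text \<open>The expected number of visits to level \<open>- n\<close>, phase \<open>j\<close>, before the return to level 0 or above;
for \<open>n = 0\<close> only the visit at time 0 counts.
A path that jumps upwards at once does not contribute: skip-free downward, it would have to come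
back through level 0 first.\<close>
definition N :: "nat \<Rightarrow> 'n \<Rightarrow> 'n \<Rightarrow> ennreal" where
  "N n i j = green pk (below 0) (origin i) (Some (- int n, j))"

lemma N_0: "N 0 i j = (if i = j then 1 else 0)"
  unfolding N_def by (subst green_notin) (simp_all add: kid_def)

lemma green_below_shift0:
  "green pk (below (b + c)) (Some (c, i)) (Some (l + c, j)) = green pk (below b) (origin i) (Some (l, j))"
  using green_shift[of b c 0 i l j] by simp

text \<open>A path into level \<open>- n - 1\<close> is split at its last visit to level \<open>-1\<close>, which it cannot skip. Hence
\<open>N n\<close> is the \<open>n\<close>-th power of \<open>N 1\<close>.\<close>
lemma N_Suc: "N (Suc n) i j = (\<Sum>y\<in>UNIV. N 1 i y * N n y j)"
proof -
  have B: "below (-1) \<union> level (-1) = (below 0 :: (int \<times> 'n) option set)"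
    using below_Un_level[of "-1"] by simp
  have zero: "green pk (below (-1)) (origin i) (Some (- int (Suc n), j)) = 0"
  proof (rule green_closed)
    fix u v :: "(int \<times> 'n) option"
    assume u: "u \<in> {origin i, None}" and v: "v \<in> below (-1)" "v \<notin> {origin i, None}"
    then obtain l j' where v': "v = Some (l, j')" by (cases v) auto
    then have "l - 0 \<le> -2" using v by simp
    with u v' show "pk u v = 0" by (auto simp: off_down)
  qed auto
  have "N (Suc n) i j = green pk (below (-1)) (origin i) (Some (- int (Suc n), j)) +
     (\<integral>\<^sup>+y. green pk (below 0) (origin i) y * green pk (below (-1)) y (Some (- int (Suc n), j))
        * indicator (level (-1)) y \<partial>count_space UNIV)"
    unfolding N_def using green_last_exit[OF below_Int_level, of "origin i" "-1" pk "Some (- int (Suc n), j)"]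
    by (simp only: B) simp
  also have "\<dots> = (\<Sum>y\<in>UNIV. green pk (below 0) (origin i) (Some (-1, y)) *
      green pk (below (-1)) (Some (-1, y)) (Some (- int (Suc n), j)))"
    unfolding zero nn_integral_level by simp
  also have "\<dots> = (\<Sum>y\<in>UNIV. N 1 i y * N n y j)"
  proof (intro sum.cong refl)
    fix y
    have "- int (Suc n) = - int n + -1" by simp
    then have "green pk (below (-1)) (Some (-1, y)) (Some (- int (Suc n), j)) = N n y j"
      using green_below_shift0[of 0 "-1" y "- int n" j] by (simp only: N_def) simp
    then show "green pk (below 0) (origin i) (Some (-1, y)) * green pk (below (-1)) (Some (-1, y)) (Some (- int (Suc n), j))
       = N 1 i y * N n y j" by (simp add: N_def)
  qed
  finally show ?thesis .
qed

lemma N_finite: "N n i j < top"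
proof (cases n)
  case 0 then show ?thesis by (simp add: N_0)
next
  case (Suc m)
  then show ?thesis
    unfolding N_def using green_below_finite[of "- int n" 0 "origin i" j] by simp
qed

text \<open>Paths from level 0 to level \<open>m\<close> that stay below level \<open>m + l + 1\<close> either stay below \<open>m + l\<close> or have
a last visit to level \<open>m + l\<close>, from where they descend by \<open>l\<close> levels.\<close>
lemma green_level_step:
  assumes "int m + int l \<noteq> 0"
  shows "green pk (below (int (m + l) + 1)) (origin i) (Some (int m, j)) =
    green pk (below (int (m + l))) (origin i) (Some (int m, j)) +
    (\<Sum>y\<in>UNIV. green pk (below (int (m + l) + 1)) (origin i) (Some (int (m + l), y)) * N l y j)"
proof -
  have "green pk (below (int (m + l) + 1)) (origin i) (Some (int m, j)) =
    green pk (below (int (m + l))) (origin i) (Some (int m, j)) +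
    (\<integral>\<^sup>+y. green pk (below (int (m + l) + 1)) (origin i) y * green pk (below (int (m + l))) y (Some (int m, j))
        * indicator (level (int (m + l))) y \<partial>count_space UNIV)"
    using green_last_exit[OF below_Int_level, of "origin i" "int (m + l)" pk "Some (int m, j)"] assms
    by (simp only: below_Un_level) simp
  then show ?thesis
    unfolding nn_integral_level N_def
    using green_below_shift0[of 0 "int (m + l)" _ "- int l" j] by simp
qed

text \<open>Decomposition at the first visit to level \<open>m\<close>.\<close>
lemma green_first_level:
  assumes "B \<inter> level m = {}" "B \<union> level m = below (m + l)"
  shows "green pk (below (m + l)) (origin i) (Some (m, j)) =
    kid (origin i) (Some (m, j)) +
    (\<Sum>y\<in>UNIV. (green pk B \<odot> pk) (origin i) (Some (m, y)) * green pk (below l) (origin y) (Some (0, j)))"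
proof -
  have "green pk (below (m + l)) (origin i) (Some (m, j)) =
    kid (origin i) (Some (m, j)) +
    (\<integral>\<^sup>+y. (green pk B \<odot> pk) (origin i) y * green pk (below (m + l)) y (Some (m, j))
        * indicator (level m) y \<partial>count_space UNIV)"
    using green_first_entrance[OF assms(1), of "Some (m, j)" pk "origin i"] by (simp add: assms(2))
  then show ?thesis
    unfolding nn_integral_level using green_below_shift0[of l m _ 0 j] by (simp add: add.commute)
qed

lemma N_1_eq:
  "N 1 i j = (\<Sum>l. \<Sum>y\<in>UNIV. N l i y * ennreal (off (int l - 1) y j / q y))"
proof -
  have "N 1 i j = (green pk (below 0) \<odot> pk) (origin i) (Some (-1, j))"
    unfolding N_def by (subst green_unfold) (simp add: kid_def)
  also have "\<dots> = (\<integral>\<^sup>+l. (\<Sum>y\<in>UNIV. green pk (below 0) (origin i) (Some (l, y)) * pk (Some (l, y)) (Some (-1, j))) \<partial>count_space UNIV)"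
    unfolding kmul_def by (subst nn_integral_count_space_option) simp
  also have "\<dots> = (\<Sum>l. \<Sum>y\<in>UNIV. green pk (below 0) (origin i) (Some (- int l, y)) * pk (Some (- int l, y)) (Some (-1, j)))"
  proof (rule nn_integral_count_space_int_le)
    fix l :: int assume "l > 0"
    then have "green pk (below 0) (origin i) (Some (l, y)) = 0" for y
      by (subst green_notin) (auto simp: kid_def)
    then show "(\<Sum>y\<in>UNIV. green pk (below 0) (origin i) (Some (l, y)) * pk (Some (l, y)) (Some (-1, j))) = 0"
      by simp
  qed
  finally show ?thesis by (simp add: N_def algebra_simps)
qed

text \<open>The equation for \<open>R\<close> with the diagonal of \<open>A 0\<close> moved to the other side, where it has nonnegative
terms only.\<close>
lemma nonneg_solution_iff:
  "nonneg_solution A R \<longleftrightarrow> (\<forall>i j. 0 \<le> R $ i $ j) \<and>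
     (\<forall>i j. (\<lambda>l. \<Sum>y\<in>UNIV. matpow R l $ i $ y * off (int l - 1) y j) sums (R $ i $ j * q j))"
proof -
  have "(\<lambda>l. (matpow R l ** A (int l - 1)) $ i $ j) sums 0 \<longleftrightarrow>
      (\<lambda>l. \<Sum>y\<in>UNIV. matpow R l $ i $ y * off (int l - 1) y j) sums (R $ i $ j * q j)" for i j
  proof -
    have entry: "(matpow R l ** A (int l - 1)) $ i $ j =
      (\<Sum>y\<in>UNIV. matpow R l $ i $ y * off (int l - 1) y j) - (if l = 1 then R $ i $ j * q j else 0)" for l
    proof -
      have "(\<Sum>y\<in>UNIV. matpow R l $ i $ y * (if int l - 1 = 0 \<and> y = j then q j else 0)) =
        (\<Sum>y\<in>UNIV. if y = j then (if l = 1 then R $ i $ j * q j else 0) else 0)"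
        by (intro sum.cong) auto
      then show ?thesis
        by (simp add: matrix_matrix_mult_def A_eq_off right_diff_distrib sum_subtractf)
    qed
    have single: "(\<lambda>l. if l = 1 then R $ i $ j * q j else 0) sums (R $ i $ j * q j)"
      using sums_single[of 1 "\<lambda>_. R $ i $ j * q j"] by simp
    show ?thesis
    proof
      assume "(\<lambda>l. (matpow R l ** A (int l - 1)) $ i $ j) sums 0"
      from sums_add[OF this single]
      show "(\<lambda>l. \<Sum>y\<in>UNIV. matpow R l $ i $ y * off (int l - 1) y j) sums (R $ i $ j * q j)"
        unfolding entry by simp
    next
      assume "(\<lambda>l. \<Sum>y\<in>UNIV. matpow R l $ i $ y * off (int l - 1) y j) sums (R $ i $ j * q j)"
      from sums_diff[OF this single]
      show "(\<lambda>l. (matpow R l ** A (int l - 1)) $ i $ j) sums 0" unfolding entry by simp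
    qed
  qed
  then show ?thesis
    unfolding nonneg_solution_def sums_matrix_iff by simp
qed

lemma nonneg_solution_matpow:
  assumes "nonneg_solution A R" "1 \<le> n"
  shows "(\<lambda>l. \<Sum>y\<in>UNIV. matpow R l $ i $ y * off (int l - int n) y j) sums (matpow R n $ i $ j * q j)"
proof -
  obtain m where n: "n = Suc m" using assms(2) by (cases n) auto
  have "(\<lambda>l. \<Sum>x\<in>UNIV. matpow R m $ i $ x * (\<Sum>y\<in>UNIV. matpow R l $ x $ y * off (int l - 1) y j))
      sums (\<Sum>x\<in>UNIV. matpow R m $ i $ x * (R $ x $ j * q j))"
    using assms(1) unfolding nonneg_solution_iff by (intro sums_sum sums_mult) auto
  also have "(\<Sum>x\<in>UNIV. matpow R m $ i $ x * (R $ x $ j * q j)) = matpow R n $ i $ j * q j"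
  proof -
    have "matpow R n = matpow R m ** R" using matpow_add[of R m 1] by (simp add: n)
    then show ?thesis by (simp add: matrix_matrix_mult_def sum_distrib_right mult.assoc)
  qed
  also have "(\<lambda>l. \<Sum>x\<in>UNIV. matpow R m $ i $ x * (\<Sum>y\<in>UNIV. matpow R l $ x $ y * off (int l - 1) y j)) =
    (\<lambda>l. \<Sum>y\<in>UNIV. matpow R (l + m) $ i $ y * off (int (l + m) - int n) y j)"
  proof (rule ext)
    fix l
    have "matpow R (l + m) = matpow R m ** matpow R l" using matpow_add[of R m l] by (simp add: add.commute)
    then have "(\<Sum>y\<in>UNIV. matpow R (l + m) $ i $ y * off (int (l + m) - int n) y j) =
      (\<Sum>y\<in>UNIV. \<Sum>x\<in>UNIV. matpow R m $ i $ x * (matpow R l $ x $ y * off (int l - 1) y j))"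
      by (simp add: matrix_matrix_mult_def sum_distrib_right mult.assoc n)
    also have "\<dots> = (\<Sum>x\<in>UNIV. \<Sum>y\<in>UNIV. matpow R m $ i $ x * (matpow R l $ x $ y * off (int l - 1) y j))"
      by (rule sum.swap)
    finally show "(\<Sum>x\<in>UNIV. matpow R m $ i $ x * (\<Sum>y\<in>UNIV. matpow R l $ x $ y * off (int l - 1) y j)) =
      (\<Sum>y\<in>UNIV. matpow R (l + m) $ i $ y * off (int (l + m) - int n) y j)"
      by (simp add: sum_distrib_left)
  qed
  finally show ?thesis
    by (subst (asm) sums_zero_iff_shift) (auto simp: n intro!: sum.neutral off_down)
qed

text \<open>Any nonnegative solution \<open>R\<close> dominates: the function equal to
\<open>(R\<^sup>n)\<^sub>i\<^sub>j q\<^sub>j / q\<^sub>i\<close> at level \<open>- n\<close> and phase \<open>j\<close> satisfies the inequality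
\<open>\<delta> + h Q \<le> h\<close> for the taboo kernel \<open>Q\<close>, and the row of the Green kernel is the least such \<open>h\<close>.\<close>
lemma N_le_solution:
  assumes R: "nonneg_solution A R"
  shows "N n i j \<le> ennreal (matpow R n $ i $ j * q j / q i)"
proof -
  have Rpos: "0 \<le> matpow R n $ i $ j" for n i j
    using R by (intro matpow_nonneg) (simp add: nonneg_solution_def)
  \<comment> \<open>The value \<open>\<infinity>\<close> makes the inequality below trivial at the cemetery and does not enter elsewhere,
    as the cemetery is left with probability 0.\<close>
  define h :: "(int \<times> 'n) option \<Rightarrow> ennreal" where
    "h v = (case v of None \<Rightarrow> top
      | Some (k, j) \<Rightarrow> if k \<le> 0 then ennreal (matpow R (nat (- k)) $ i $ j * q j / q i) else 0)" for v
  have step: "(\<integral>\<^sup>+z. h z * pk z (Some (- int n, j)) \<partial>count_space UNIV) = h (Some (- int n, j))" if "1 \<le> n" for n j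
  proof -
    have "(\<integral>\<^sup>+z. h z * pk z (Some (- int n, j)) \<partial>count_space UNIV) =
      (\<integral>\<^sup>+l. (\<Sum>y\<in>UNIV. h (Some (l, y)) * pk (Some (l, y)) (Some (- int n, j))) \<partial>count_space UNIV)"
      by (subst nn_integral_count_space_option) simp
    also have "\<dots> = (\<Sum>l. \<Sum>y\<in>UNIV. h (Some (- int l, y)) * pk (Some (- int l, y)) (Some (- int n, j)))"
      by (rule nn_integral_count_space_int_le) (simp add: h_def)
    also have "\<dots> = (\<Sum>l. ennreal ((\<Sum>y\<in>UNIV. matpow R l $ i $ y * off (int l - int n) y j) / q i))"
    proof (intro suminf_cong)
      fix l
      have "h (Some (- int l, y)) * pk (Some (- int l, y)) (Some (- int n, j)) =
          ennreal (matpow R l $ i $ y * off (int l - int n) y j / q i)" for y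
        by (simp add: h_def ennreal_mult[symmetric] Rpos algebra_simps)
      then show "(\<Sum>y\<in>UNIV. h (Some (- int l, y)) * pk (Some (- int l, y)) (Some (- int n, j))) =
          ennreal ((\<Sum>y\<in>UNIV. matpow R l $ i $ y * off (int l - int n) y j) / q i)"
        by (simp add: Rpos sum_divide_distrib)
    qed
    also have "\<dots> = ennreal (matpow R n $ i $ j * q j / q i)"
    proof (rule sums_unique[symmetric])
      have "(\<lambda>l. (\<Sum>y\<in>UNIV. matpow R l $ i $ y * off (int l - int n) y j) / q i) sums (matpow R n $ i $ j * q j / q i)"
        by (intro sums_divide nonneg_solution_matpow R that)
      then show "(\<lambda>l. ennreal ((\<Sum>y\<in>UNIV. matpow R l $ i $ y * off (int l - int n) y j) / q i))
          sums ennreal (matpow R n $ i $ j * q j / q i)"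
        by (subst sums_ennreal) (auto intro!: sum_nonneg divide_nonneg_nonneg mult_nonneg_nonneg Rpos)
    qed
    finally show ?thesis by (simp add: h_def)
  qed
  let ?F = "\<lambda>_. kid (origin i)" and ?H = "\<lambda>_. h"
  have "?F \<oplus> (?H \<odot> restr pk (below 0)) \<le> (?H :: (int \<times> 'n) option \<Rightarrow> _)"
  proof (intro le_funI)
    fix u v :: "(int \<times> 'n) option"
    have eq: "(?F \<oplus> (?H \<odot> restr pk (below 0))) u v =
      kid (origin i) v + (\<integral>\<^sup>+z. h z * pk z v \<partial>count_space UNIV) * indicator (below 0) v"
      by (simp add: kadd_def kmul_restr) (simp add: kmul_def)
    show "(?F \<oplus> (?H \<odot> restr pk (below 0))) u v \<le> h v"
    proof (cases v)
      case None then show ?thesis by (simp add: h_def)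
    next
      case (Some kj)
      then obtain k j where v: "v = Some (k, j)" by (cases kj) auto
      consider "k > 0" | "k = 0" | "k < 0" by linarith
      then show ?thesis
      proof cases
        case 1 then show ?thesis unfolding eq by (simp add: v kid_def)
      next
        case 2 then show ?thesis unfolding eq by (auto simp: v kid_def h_def mat_def)
      next
        case 3
        define n where "n = nat (- k)"
        have n: "k = - int n" "1 \<le> n" using 3 by (auto simp: n_def)
        then have "h v = (\<integral>\<^sup>+z. h z * pk z v \<partial>count_space UNIV)" using step[of n j] by (simp add: v)
        then show ?thesis unfolding eq using n by (simp add: v kid_def)
      qed
    qed
  qed
  then have "?F \<odot> ksum (restr pk (below 0)) \<le> (?H :: (int \<times> 'n) option \<Rightarrow> _)"
    by (rule ksum_least_right)
  then have "(?F \<odot> ksum (restr pk (below 0))) (origin i) (Some (- int n, j)) \<le> h (Some (- int n, j))"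
    by (auto simp: le_fun_def)
  moreover have "(?F \<odot> ksum (restr pk (below 0))) (origin i) = (kid \<odot> ksum (restr pk (below 0))) (origin i)"
    by (intro ext) (simp only: kmul_def)
  ultimately show ?thesis by (simp add: N_def green_def h_def)
qed

end

section \<open>Passage events\<close>
lemma phase_at_tau_iff:
  assumes rc: "\<forall>t\<ge>0. eventually (\<lambda>s. x s = x t) (at_right t)"
  shows "phase_at x (tau m x) j \<longleftrightarrow> tau m x = hit {Some (m, j)} x \<and> tau m x < \<infinity>"
proof
  assume ph: "phase_at x (tau m x) j"
  then have fin: "hit (level m) x < \<infinity>" by (simp add: phase_at_def tau_eq_hit)
  obtain t where t: "0 \<le> t" "hit (level m) x = ereal t" "x t \<in> level m"
    by (rule hit_attained[OF rc fin])
  have "x t = Some (m, j)"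
  proof -
    obtain k where "x t = Some (k, j)" using ph t(2) by (auto simp: phase_at_def tau_eq_hit)
    then show ?thesis using t(3) by simp
  qed
  then have "hit {Some (m, j)} x \<le> hit (level m) x" using t hit_le[of t x "{Some (m, j)}"] by simp
  moreover have "hit (level m) x \<le> hit {Some (m, j)} x" by (rule hit_antimono) simp
  ultimately show "tau m x = hit {Some (m, j)} x \<and> tau m x < \<infinity>" using fin by (simp add: tau_eq_hit)
next
  assume eq: "tau m x = hit {Some (m, j)} x \<and> tau m x < \<infinity>"
  have "hit {Some (m, j)} x < \<infinity>" using conjunct2[OF eq] unfolding conjunct1[OF eq] .
  from hit_attained[OF rc this] obtain t where "hit {Some (m, j)} x = ereal t" "x t \<in> {Some (m, j)}"
    by metis
  then show "phase_at x (tau m x) j" using eq by (simp add: phase_at_def)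
qed

text \<open>The event of passing above \<open>m\<close> exactly at level \<open>m\<close>, in terms of hitting times only.\<close>
lemma hit_exact_event:
  assumes rc: "\<forall>t\<ge>0. eventually (\<lambda>s. x s = x t) (at_right t)"
  shows "tau m x = tau_up m x \<and> phase_at x (tau m x) j \<longleftrightarrow>
    hit (above m) x = hit {Some (m, j)} x \<and> hit (above m) x < \<infinity>"
proof -
  have le: "tau_up m x \<le> tau m x" "tau m x \<le> hit {Some (m, j)} x"
    unfolding tau_eq_hit tau_up_eq_hit by (rule hit_antimono, auto simp: level_def)+
  have "tau m x = tau_up m x" if eq: "tau_up m x = hit {Some (m, j)} x"
    using le unfolding eq[symmetric] by (intro antisym)
  then show ?thesis
    unfolding phase_at_tau_iff[OF rc] tau_up_eq_hit[symmetric] by auto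
qed

lemma hit_before_event:
  assumes rc: "\<forall>t\<ge>0. eventually (\<lambda>s. x s = x t) (at_right t)" and "m < n"
  shows "tau m x < tau_up n x \<and> phase_at x (tau m x) j \<longleftrightarrow>
    hit (level m \<union> above n) x = hit {Some (m, j)} x \<and> hit (level m \<union> above n) x < \<infinity>"
proof -
  have U: "hit (level m \<union> above n) x = min (tau m x) (tau_up n x)"
    by (simp add: hit_Un tau_eq_hit tau_up_eq_hit)
  have le: "tau m x \<le> hit {Some (m, j)} x"
    unfolding tau_eq_hit by (rule hit_antimono) simp
  have neq: "tau m x \<noteq> tau_up n x" if fin: "tau m x < \<infinity>"
  proof
    assume eq: "tau m x = tau_up n x"
    have fin1: "hit (level m) x < \<infinity>" and fin2: "hit (above n) x < \<infinity>"
      using fin eq by (simp_all add: tau_eq_hit tau_up_eq_hit)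
    obtain t where t: "hit (level m) x = ereal t" "x t \<in> level m"
      by (rule hit_attained[OF rc fin1])
    obtain s where s: "hit (above n) x = ereal s" "x s \<in> above n"
      by (rule hit_attained[OF rc fin2])
    have "s = t" using t(1) s(1) eq by (simp add: tau_eq_hit tau_up_eq_hit)
    then show False using t(2) s(2) assms(2) by (auto simp: level_def)
  qed
  have "tau m x = hit {Some (m, j)} x \<and> tau m x < tau_up n x"
    if a: "min (tau m x) (tau_up n x) = hit {Some (m, j)} x" "min (tau m x) (tau_up n x) < \<infinity>"
  proof -
    have "tau m x \<le> min (tau m x) (tau_up n x)" using le a(1) by (simp only:)
    then have le': "tau m x \<le> tau_up n x" by (simp only: min.bounded_iff)
    then have m: "min (tau m x) (tau_up n x) = tau m x" by (rule min_absorb1)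
    show ?thesis using le' neq a unfolding m by (simp add: order_less_le)
  qed
  moreover have "min (tau m x) (tau_up n x) = tau m x" if "tau m x < tau_up n x"
    using that by simp
  ultimately show ?thesis
    unfolding phase_at_tau_iff[OF rc] U by metis
qed

section \<open>Identification and invertibility of R\<close>

lemma matrix_add_rdistrib: "(B + C) ** D = B ** D + C ** (D :: real^'p^'n)"
  by (simp add: vec_eq_iff matrix_matrix_mult_def sum.distrib distrib_right)

lemma invertible_iff_kernel: "invertible (B :: real^'n^'n) \<longleftrightarrow> (\<forall>x. B *v x = 0 \<longrightarrow> x = 0)"
  unfolding invertible_left_inverse matrix_left_invertible_ker ..

context skipfree
begin

text \<open>The real-valued version of \<open>N\<close>, which is finite.\<close>
definition nr :: "nat \<Rightarrow> 'n \<Rightarrow> 'n \<Rightarrow> real" where "nr n i j = enn2real (N n i j)"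

lemma nr_nonneg [simp]: "0 \<le> nr n i j"
  by (simp add: nr_def)

lemma N_eq_nr: "N n i j = ennreal (nr n i j)"
  using N_finite[of n i j] by (simp add: nr_def)

text \<open>\<open>N 1\<close> conjugated by the diagonal of exit rates, which turns expected numbers of visits into ratios
of expected local times. It is shown to be the minimal nonnegative solution.\<close>
definition Rs :: "real^'n^'n" where
  "Rs = (\<chi> i j. q i * nr 1 i j / q j)"

lemma Rs_nth: "Rs $ i $ j = q i * nr 1 i j / q j"
  by (simp add: Rs_def)

lemma matpow_Rs: "matpow Rs n $ i $ j = q i * nr n i j / q j"
proof (induction n arbitrary: i j)
  case 0
  have "nr 0 i j = (if i = j then 1 else 0)" by (simp add: nr_def N_0)
  then show ?case by (simp add: mat_def)
next
  case (Suc n)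
  have "ennreal (nr (Suc n) i j) = ennreal (\<Sum>y\<in>UNIV. nr 1 i y * nr n y j)"
    using N_Suc[of n i j] by (simp add: N_eq_nr ennreal_mult[symmetric] sum_nonneg)
  then have "nr (Suc n) i j = (\<Sum>y\<in>UNIV. nr 1 i y * nr n y j)"
    by (subst (asm) ennreal_inj) (simp_all add: sum_nonneg)
  then show ?case
    by (simp add: matpow_Suc matrix_matrix_mult_def Suc.IH Rs_nth sum_distrib_left sum_divide_distrib mult.assoc)
qed

lemma Rs_solution: "nonneg_solution A Rs"
  unfolding nonneg_solution_iff
proof (intro conjI allI)
  fix i j
  show "0 \<le> Rs $ i $ j" by (simp add: Rs_def)
  define g where "g l = (\<Sum>y\<in>UNIV. nr l i y * (off (int l - 1) y j / q y))" for l
  have gpos: "0 \<le> g l" for l by (simp add: g_def sum_nonneg)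
  have "(\<Sum>l. ennreal (g l)) = ennreal (nr 1 i j)"
    unfolding g_def N_eq_nr[symmetric] N_1_eq by (simp add: N_eq_nr ennreal_mult[symmetric])
  moreover have "(\<lambda>l. ennreal (g l)) sums (\<Sum>l. ennreal (g l))"
    by (rule summable_sums[OF summableI])
  ultimately have "g sums nr 1 i j"
    by (simp add: sums_ennreal gpos)
  then have "(\<lambda>l. q i * g l) sums (q i * nr 1 i j)" by (rule sums_mult)
  moreover have "q i * g l = (\<Sum>y\<in>UNIV. matpow Rs l $ i $ y * off (int l - 1) y j)" for l
    by (simp add: g_def matpow_Rs sum_distrib_left mult.assoc)
  ultimately show "(\<lambda>l. \<Sum>y\<in>UNIV. matpow Rs l $ i $ y * off (int l - 1) y j) sums (Rs $ i $ j * q j)"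
    by (simp add: Rs_def)
qed

lemma minimal_solution_eq_Rs:
  assumes R: "minimal_nonneg_solution A R"
  shows "R = Rs"
proof -
  have "R $ i $ j = Rs $ i $ j" for i j
  proof (rule antisym)
    show "R $ i $ j \<le> Rs $ i $ j"
      using R Rs_solution by (simp add: minimal_nonneg_solution_def)
    have sol: "nonneg_solution A R" using R by (simp add: minimal_nonneg_solution_def)
    have "ennreal (nr 1 i j) \<le> ennreal (R $ i $ j * q j / q i)"
      using N_le_solution[OF sol, of 1 i j] by (simp add: N_eq_nr)
    moreover have "0 \<le> R $ i $ j * q j / q i" using sol by (simp add: nonneg_solution_def)
    ultimately have "nr 1 i j \<le> R $ i $ j * q j / q i" by (simp add: ennreal_le_iff)
    then show "Rs $ i $ j \<le> R $ i $ j" by (simp add: Rs_def field_simps)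
  qed
  then show ?thesis by (simp add: vec_eq_iff)
qed

text \<open>A left null vector of \<open>R\<close> annihilates all terms of \<open>\<Sum>n. R\<^sup>n A (n - 1) = 0\<close> but the first one, so it
is a left null vector of \<open>A (-1)\<close>.\<close>
lemma nonneg_solution_invertible:
  assumes R: "nonneg_solution A R" and inv: "invertible (A (-1))"
  shows "invertible R"
proof (rule ccontr)
  assume "\<not> invertible R"
  then have "\<not> invertible (transpose R)"
    using transpose_invertible[of "transpose R"] by (simp add: transpose_transpose) blast
  then obtain x where x: "transpose R *v x = 0" "x \<noteq> 0"
    unfolding invertible_iff_kernel by blast
  have xR: "(\<Sum>i\<in>UNIV. x $ i * R $ i $ j) = 0" for j
    using x(1) by (simp add: vec_eq_iff matrix_vector_mult_def transpose_def mult.commute)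
  have zero: "(\<Sum>i\<in>UNIV. x $ i * (matpow R (Suc l) ** B) $ i $ j) = 0" for l B j
  proof -
    have "(\<Sum>i\<in>UNIV. x $ i * (matpow R (Suc l) ** B) $ i $ j) =
      (\<Sum>i\<in>UNIV. \<Sum>y\<in>UNIV. x $ i * R $ i $ y * (matpow R l ** B) $ y $ j)"
      by (simp add: matpow_Suc matrix_mul_assoc[symmetric])
         (simp add: matrix_matrix_mult_def[of R] sum_distrib_left mult.assoc)
    also have "\<dots> = (\<Sum>y\<in>UNIV. (\<Sum>i\<in>UNIV. x $ i * R $ i $ y) * (matpow R l ** B) $ y $ j)"
      by (subst sum.swap) (simp add: sum_distrib_right)
    finally show ?thesis by (simp add: xR)
  qed
  have "(\<Sum>i\<in>UNIV. x $ i * A (-1) $ i $ j) = 0" for j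
  proof -
    have "(\<lambda>l. (matpow R l ** A (int l - 1)) $ i $ j) sums 0" for i
      using R by (simp add: nonneg_solution_def sums_matrix_iff)
    then have "(\<lambda>l. \<Sum>i\<in>UNIV. x $ i * (matpow R l ** A (int l - 1)) $ i $ j) sums (\<Sum>i\<in>UNIV. x $ i * 0)"
      by (intro sums_sum sums_mult)
    moreover have "(\<lambda>l. \<Sum>i\<in>UNIV. x $ i * (matpow R l ** A (int l - 1)) $ i $ j) sums
        (\<Sum>i\<in>UNIV. x $ i * (matpow R 0 ** A (int 0 - 1)) $ i $ j)"
    proof -
      have "(\<Sum>i\<in>UNIV. x $ i * (matpow R l ** A (int l - 1)) $ i $ j) = 0" if "l \<notin> {0}" for l
        using zero[of "l - 1"] that by (cases l) simp_all
      then have "(\<lambda>l. \<Sum>i\<in>UNIV. x $ i * (matpow R l ** A (int l - 1)) $ i $ j) sums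
        (\<Sum>l\<in>{0}. \<Sum>i\<in>UNIV. x $ i * (matpow R l ** A (int l - 1)) $ i $ j)"
        by (intro sums_finite) simp_all
      then show ?thesis by simp
    qed
    ultimately have "(\<Sum>i\<in>UNIV. x $ i * 0) = (\<Sum>i\<in>UNIV. x $ i * (matpow R 0 ** A (int 0 - 1)) $ i $ j)"
      by (rule sums_unique2)
    then show ?thesis by simp
  qed
  then have "transpose (A (-1)) *v x = 0"
    by (simp add: vec_eq_iff matrix_vector_mult_def transpose_def mult.commute)
  moreover have "invertible (transpose (A (-1)))" using inv by (rule transpose_invertible)
  ultimately have "x = 0" unfolding invertible_iff_kernel by blast
  then show False using x(2) by simp
qed

lemma ctmc_lawI:
  assumes "ctmc M (map_gen A) (origin i) X"
  shows "ctmc_law M (map_gen A) (origin i) X (\<Sum>i\<in>UNIV. q i)"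
proof
  fix u v :: "(int \<times> 'n) option"
  show "ctmc M (map_gen A) (origin i) X" by fact
  show "0 \<le> exit_rate (map_gen A) u" by (cases u) auto
  have "q j \<le> (\<Sum>i\<in>UNIV. q i)" for j by (rule member_le_sum) auto
  then show "exit_rate (map_gen A) u \<le> (\<Sum>i\<in>UNIV. q i)"
    by (cases u) (auto intro!: sum_nonneg)
  show "0 \<le> jump_prob (map_gen A) u v" by (rule jump_prob_nonneg)
  show "(\<integral>\<^sup>+v. pk u v \<partial>count_space UNIV) = 1" by (rule jump_prob_sum)
qed

lemma mean_local_time_eq:
  assumes "ctmc (P i) (map_gen A) (origin i) X" "m < c" "0 < c"
  shows "mean_local_time P X m c i j = green pk (below c) (origin i) (Some (m, j)) * ennreal (1 / q j)"
proof -
  interpret L: ctmc_law "P i" "map_gen A" "origin i" X "\<Sum>i\<in>UNIV. q i"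
    by (rule ctmc_lawI) fact
  show ?thesis
    using L.mean_occupation_time[of "above c" "Some (m, j)"] assms(2,3)
    by (simp add: mean_local_time_def local_time_def tau_up_eq_hit below_def)
qed

lemma hit_exact_eq:
  assumes "ctmc (P i) (map_gen A) (origin i) X" "1 \<le> m"
  shows "ennreal (hit_exact_mat P X m $ i $ j) =
    (green pk (below (int m)) \<odot> pk) (origin i) (Some (int m, j))"
proof -
  interpret L: ctmc_law "P i" "map_gen A" "origin i" X "\<Sum>i\<in>UNIV. q i"
    by (rule ctmc_lawI) fact
  have "{w\<in>space (P i). tau (int m) (L.path w) = tau_up (int m) (L.path w) \<and> phase_at (L.path w) (tau (int m) (L.path w)) j}
    = {w\<in>space (P i). hit (above (int m)) (L.path w) = hit {Some (int m, j)} (L.path w) \<and> hit (above (int m)) (L.path w) < \<infinity>}"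
  proof (rule Collect_cong)
    fix w
    show "(w \<in> space (P i) \<and> tau (int m) (L.path w) = tau_up (int m) (L.path w) \<and> phase_at (L.path w) (tau (int m) (L.path w)) j) = (w \<in> space (P i) \<and> hit (above (int m)) (L.path w) = hit {Some (int m, j)} (L.path w) \<and> hit (above (int m)) (L.path w) < \<infinity>)"
    proof (cases "w \<in> space (P i)")
      case True
      have rc: "\<forall>t\<ge>0. eventually (\<lambda>s. L.path w s = L.path w t) (at_right t)"
        by (intro allI impI L.right_cont True)
      show ?thesis unfolding hit_exact_event[OF rc] ..
    qed simp
  qed
  then have "ennreal (hit_exact_mat P X m $ i $ j) =
    emeasure (P i) {w\<in>space (P i). hit (above (int m)) (L.path w) = hit {Some (int m, j)} (L.path w) \<and> hit (above (int m)) (L.path w) < \<infinity>}"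
    unfolding hit_exact_mat_def L.emeasure_eq_measure by simp
  also have "\<dots> = (green pk (- above (int m)) \<odot> pk) (origin i) (Some (int m, j))"
    using assms(2) by (intro L.hitting_law) auto
  finally show ?thesis by (simp add: below_def)
qed

lemma hit_before_eq:
  assumes "ctmc (P i) (map_gen A) (origin i) X" "1 \<le> m" "m < n"
  shows "ennreal (hit_before_mat P X m n $ i $ j) =
    (green pk (below (int n) - level (int m)) \<odot> pk) (origin i) (Some (int m, j))"
proof -
  interpret L: ctmc_law "P i" "map_gen A" "origin i" X "\<Sum>i\<in>UNIV. q i"
    by (rule ctmc_lawI) fact
  let ?D = "level (int m) \<union> above (int n)"
  have mn: "int m < int n" using assms(3) by simp
  have "{w\<in>space (P i). tau (int m) (L.path w) < tau_up (int n) (L.path w) \<and> phase_at (L.path w) (tau (int m) (L.path w)) j}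
    = {w\<in>space (P i). hit ?D (L.path w) = hit {Some (int m, j)} (L.path w) \<and> hit ?D (L.path w) < \<infinity>}"
  proof (rule Collect_cong)
    fix w
    show "(w \<in> space (P i) \<and> tau (int m) (L.path w) < tau_up (int n) (L.path w) \<and> phase_at (L.path w) (tau (int m) (L.path w)) j) = (w \<in> space (P i) \<and> hit ?D (L.path w) = hit {Some (int m, j)} (L.path w) \<and> hit ?D (L.path w) < \<infinity>)"
    proof (cases "w \<in> space (P i)")
      case True
      have rc: "\<forall>t\<ge>0. eventually (\<lambda>s. L.path w s = L.path w t) (at_right t)"
        by (intro allI impI L.right_cont True)
      show ?thesis unfolding hit_before_event[OF rc mn] ..
    qed simp
  qed
  then have "ennreal (hit_before_mat P X m n $ i $ j) =
    emeasure (P i) {w\<in>space (P i). hit ?D (L.path w) = hit {Some (int m, j)} (L.path w) \<and> hit ?D (L.path w) < \<infinity>}"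
    unfolding hit_before_mat_def L.emeasure_eq_measure by simp
  also have "\<dots> = (green pk (- ?D) \<odot> pk) (origin i) (Some (int m, j))"
    using assms(2,3) by (intro L.hitting_law) auto
  also have "- ?D = below (int n) - level (int m)" by (auto simp: below_def)
  finally show ?thesis .
qed

section \<open>Matrix identities for the occupation times\<close>
text \<open>The real-valued Green kernel below \<open>c\<close>; meaningful for \<open>m < c\<close>, where the kernel is finite.\<close>
definition gr :: "int \<Rightarrow> int \<Rightarrow> 'n \<Rightarrow> 'n \<Rightarrow> real" where
  "gr c m i j = enn2real (green pk (below c) (origin i) (Some (m, j)))"

lemma gr_nonneg [simp]: "0 \<le> gr c m i j"
  by (simp add: gr_def)

lemma green_eq_gr: "m < c \<Longrightarrow> green pk (below c) (origin i) (Some (m, j)) = ennreal (gr c m i j)"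
  using green_below_finite[of m c "origin i" j] by (simp add: gr_def)

text \<open>The matrix of expected local times in level \<open>m\<close> before the first passage over \<open>c\<close>; it comprises
both \<open>Phi\<close> and \<open>Xi\<close>.\<close>
definition Lt :: "int \<Rightarrow> int \<Rightarrow> real^'n^'n" where
  "Lt c m = (\<chi> i j. gr c m i j / q j)"

lemma Lt_step:
  assumes "1 \<le> l"
  shows "Lt (int (m + l) + 1) (int m) =
    Lt (int (m + l)) (int m) + Lt (int (m + l) + 1) (int (m + l)) ** matpow Rs l"
proof -
  have "gr (int (m + l) + 1) (int m) i j =
    gr (int (m + l)) (int m) i j + (\<Sum>y\<in>UNIV. gr (int (m + l) + 1) (int (m + l)) i y * nr l y j)" for i j
  proof -
    have "ennreal (gr (int (m + l) + 1) (int m) i j) = ennreal (gr (int (m + l)) (int m) i j)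
        + (\<Sum>y\<in>UNIV. ennreal (gr (int (m + l) + 1) (int (m + l)) i y) * ennreal (nr l y j))"
      using green_level_step[of m l i j] assms by (simp add: green_eq_gr N_eq_nr)
    also have "\<dots> = ennreal (gr (int (m + l)) (int m) i j + (\<Sum>y\<in>UNIV. gr (int (m + l) + 1) (int (m + l)) i y * nr l y j))"
      by (simp add: ennreal_mult[symmetric] sum_nonneg)
    finally show ?thesis by (subst (asm) ennreal_inj) (simp_all add: sum_nonneg)
  qed
  then show ?thesis
    by (simp add: vec_eq_iff Lt_def matrix_matrix_mult_def matpow_Rs add_divide_distrib sum_divide_distrib)
qed

lemma Lt_sum:
  assumes "1 \<le> l"
  shows "Lt (int (m + l)) (int m) = (\<Sum>i<l. Lt (int (m + i) + 1) (int (m + i)) ** matpow Rs i)"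
  using assms
proof (induction l rule: nat_induct_at_least)
  case base
  then show ?case by (simp add: add.commute)
next
  case (Suc l)
  then show ?case using Lt_step[of l m] by (simp add: add_ac)
qed

text \<open>First-entrance decomposition in matrix form. For \<open>m = 0\<close> the initial visit to level 0 is not an
entrance and contributes the diagonal matrix of mean holding times.\<close>
lemma Lt_first_entrance:
  assumes B: "B \<inter> level (int m) = {}" "B \<union> level (int m) = below (int m + int l)" and l: "1 \<le> l"
    and h: "\<And>i j. ennreal (h $ i $ j) = (green pk B \<odot> pk) (origin i) (Some (int m, j))"
    and pos: "\<And>i j. 0 \<le> h $ i $ j"
  shows "Lt (int m + int l) (int m) = (if m = 0 then (\<chi> i j. if i = j then 1 / q j else 0) else 0) + h ** Lt (int l) 0"
proof -
  have "gr (int m + int l) (int m) i j = (if m = 0 \<and> i = j then 1 else 0) + (\<Sum>y\<in>UNIV. h $ i $ y * gr (int l) 0 y j)" for i j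
  proof -
    have "ennreal (gr (int m + int l) (int m) i j) = kid (origin i) (Some (int m, j)) +
        (\<Sum>y\<in>UNIV. ennreal (h $ i $ y) * ennreal (gr (int l) 0 y j))"
      using green_first_level[OF B, of i j] l by (simp add: green_eq_gr h)
    also have "\<dots> = ennreal ((if m = 0 \<and> i = j then 1 else 0) + (\<Sum>y\<in>UNIV. h $ i $ y * gr (int l) 0 y j))"
      using pos by (simp add: ennreal_mult[symmetric] sum_nonneg kid_def)
    finally show ?thesis using pos by (subst (asm) ennreal_inj) (simp_all add: sum_nonneg)
  qed
  then show ?thesis
    by (simp add: vec_eq_iff Lt_def matrix_matrix_mult_def add_divide_distrib sum_divide_distrib)
qed

text \<open>The chain observed on level 0 and killed above \<open>l\<close> has the expected local times \<open>Lt l 0\<close>. As they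
are finite, first return to level 0 gives \<open>(1 - h) Lt = D\<close> with \<open>h\<close> the return probabilities and
\<open>D\<close> an invertible diagonal matrix.\<close>
lemma Lt_invertible:
  assumes l: "1 \<le> l"
  shows "invertible (Lt (int l) 0)"
proof -
  let ?B = "below (int l) - level 0"
  have B: "?B \<inter> level (int 0) = {}" "?B \<union> level (int 0) = (below (int 0 + int l) :: (int \<times> 'n) option set)"
    using l by (auto simp: level_def)
  define c where "c i j = (green pk ?B \<odot> pk) (origin i) (Some (0, j))" for i j
  have cfin: "c i y < top" for i y
  proof (rule ccontr)
    assume "\<not> c i y < top"
    \<comment> \<open>An infinite entry would make the finite \<open>green\<close> infinite, as the last factor is at least 1.\<close>
    then have top: "c i y = top" by (simp add: less_top[symmetric])
    have "green pk (below (int l)) (origin i) (Some (0, y)) =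
      kid (origin i) (Some (0, y)) + (\<Sum>x\<in>UNIV. c i x * green pk (below (int l)) (origin x) (Some (0, y)))"
      using green_first_level[OF B, of i y] by (simp add: c_def)
    moreover have "c i y * green pk (below (int l)) (origin y) (Some (0, y)) \<le>
        (\<Sum>x\<in>UNIV. c i x * green pk (below (int l)) (origin x) (Some (0, y)))"
      by (rule member_le_sum) auto
    moreover have "c i y * green pk (below (int l)) (origin y) (Some (0, y)) = top"
      using green_self_ge_1[of pk "below (int l)" "origin y"] by (auto simp: top ennreal_top_mult)
    ultimately have "green pk (below (int l)) (origin i) (Some (0, y)) = top" by (simp add: top_unique)
    then show False using green_below_finite[of 0 "int l" "origin i" y] l by simp
  qed
  define h :: "real^'n^'n" where "h = (\<chi> i j. enn2real (c i j))"
  have h: "ennreal (h $ i $ j) = (green pk ?B \<odot> pk) (origin i) (Some (int 0, j))" for i j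
    using cfin[of i j] by (simp add: h_def c_def)
  define D :: "real^'n^'n" where "D = (\<chi> i j. if i = j then 1 / q j else 0)"
  define Di :: "real^'n^'n" where "Di = (\<chi> i j. if i = j then q j else 0)"
  have "Lt (int l) 0 = D + h ** Lt (int l) 0"
    using Lt_first_entrance[OF B l h] by (simp add: D_def h_def)
  moreover have "(mat 1 - h) ** Lt (int l) 0 + h ** Lt (int l) 0 = Lt (int l) 0"
    unfolding matrix_add_rdistrib[symmetric] by simp
  ultimately have "(mat 1 - h) ** Lt (int l) 0 = D"
    by (metis add_right_cancel)
  moreover have "Di ** D = mat 1"
    by (auto simp: vec_eq_iff matrix_matrix_mult_def Di_def D_def mat_def if_distrib[of "\<lambda>x. x * _"] sum.If_cases)
  ultimately have "(Di ** (mat 1 - h)) ** Lt (int l) 0 = mat 1"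
    by (simp add: matrix_mul_assoc[symmetric])
  then show ?thesis unfolding invertible_left_inverse by blast
qed

end

section \<open>Scale matrices and the passage probabilities\<close>
lemma matrix_inv_mult:
  fixes B :: "real^'n^'n"
  assumes "invertible B"
  shows "B ** matrix_inv B = mat 1" "matrix_inv B ** B = mat 1"
proof -
  have "B ** matrix_inv B = mat 1 \<and> matrix_inv B ** B = mat 1"
    using assms unfolding invertible_def matrix_inv_def by (rule someI_ex)
  then show "B ** matrix_inv B = mat 1" "matrix_inv B ** B = mat 1" by auto
qed

lemma matrix_inv_eqI:
  fixes B C :: "real^'n^'n"
  assumes "B ** C = mat 1"
  shows "matrix_inv B = C"
proof -
  have inv: "invertible B"
    using assms matrix_left_right_inverse[of B C] by (auto simp: invertible_def)
  have "matrix_inv B = matrix_inv B ** (B ** C)" by (simp add: assms)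
  also have "\<dots> = (matrix_inv B ** B) ** C" by (rule matrix_mul_assoc)
  finally show ?thesis by (simp add: matrix_inv_mult[OF inv])
qed

lemma eq_mult_matrix_inv:
  fixes B H C :: "real^'n^'n"
  assumes "C = H ** B" "invertible B"
  shows "H = C ** matrix_inv B"
  using assms by (simp add: matrix_mul_assoc[symmetric] matrix_inv_mult)

lemma matpow_Suc_right: "matpow B (Suc n) = matpow B n ** B"
  using matpow_add[of B n 1] by simp

lemma matpow_inverse:
  fixes B C :: "real^'n^'n"
  assumes "B ** C = mat 1"
  shows "matpow B n ** matpow C n = mat 1"
proof (induction n)
  case (Suc n)
  have "matpow B (Suc n) ** matpow C (Suc n) = matpow B n ** (B ** C) ** matpow C n"
    by (simp only: matpow_Suc_right[of B] matpow_Suc[of C] matrix_mul_assoc)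
  with Suc show ?case by (simp add: assms)
qed simp

lemma matrix_sum_rdistrib:
  fixes f :: "nat \<Rightarrow> real^'n^'n" and C :: "real^'n^'n"
  shows "(\<Sum>i<l. f i) ** C = (\<Sum>i<l. f i ** C)"
  by (induction l) (simp_all add: matrix_add_rdistrib)

text \<open>The passage from sums \<open>X k\<close> of the \<open>F i R\<^sup>i\<close> to \<open>W k = X k R\<^sup>-\<^sup>k\<close>: the difference \<open>X (m + l) - X m\<close>
is the shifted sum multiplied by \<open>R\<^sup>m\<close>.\<close>
lemma scale_function_quotient:
  fixes R :: "real^'n^'n" and F X :: "nat \<Rightarrow> real^'n^'n"
  assumes R: "invertible R"
    and X: "\<And>k. 1 \<le> k \<Longrightarrow> X k = (\<Sum>i<k. F i ** matpow R i)"
    and inv: "invertible (X l)" and l: "1 \<le> l" and m: "1 \<le> m"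
  defines "W \<equiv> \<lambda>k. X k ** matpow (matrix_inv R) k"
  shows "invertible (W l)"
    and "(W (m + l) - W m ** matpow (matrix_inv R) l) ** matrix_inv (W l) =
      (\<Sum>i<l. F (m + i) ** matpow R i) ** matrix_inv (X l)"
proof -
  let ?S = "matpow (matrix_inv R)"
  have SR: "?S k ** matpow R k = mat 1" and RS: "matpow R k ** ?S k = mat 1" for k
    by (rule matpow_inverse, simp add: matrix_inv_mult[OF R])+
  have WI: "W l ** (matpow R l ** matrix_inv (X l)) = mat 1"
  proof -
    have "W l ** (matpow R l ** matrix_inv (X l)) = X l ** (?S l ** matpow R l) ** matrix_inv (X l)"
      by (simp only: W_def matrix_mul_assoc)
    then show ?thesis by (simp add: SR matrix_inv_mult[OF inv])
  qed
  then show "invertible (W l)"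
    using matrix_left_right_inverse[of "W l"] by (auto simp: invertible_def)
  have split: "X (m + l) = X m + (\<Sum>i<l. F (m + i) ** matpow R i) ** matpow R m"
  proof -
    have "X (m + l) = (\<Sum>i<m + l. F i ** matpow R i)" using m by (intro X) simp
    also have "\<dots> = (\<Sum>i<m. F i ** matpow R i) + (\<Sum>i<l. F (m + i) ** matpow R (m + i))"
      by (induction l) (simp_all add: add.assoc)
    also have "(\<Sum>i<l. F (m + i) ** matpow R (m + i)) = (\<Sum>i<l. F (m + i) ** matpow R i) ** matpow R m"
      unfolding matrix_sum_rdistrib
      by (intro sum.cong refl) (simp add: matrix_mul_assoc[symmetric] matpow_add[symmetric] add.commute)
    finally show ?thesis by (simp add: X[OF m])
  qed
  have "W m ** ?S l = X m ** ?S (m + l)"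
    by (simp only: W_def matpow_add matrix_mul_assoc)
  moreover have "W (m + l) = X m ** ?S (m + l) + (\<Sum>i<l. F (m + i) ** matpow R i) ** matpow R m ** ?S (m + l)"
    unfolding W_def split matrix_add_rdistrib ..
  moreover have "matpow R m ** ?S (m + l) = ?S l"
    by (simp add: matpow_add matrix_mul_assoc RS)
  ultimately have "W (m + l) - W m ** ?S l = (\<Sum>i<l. F (m + i) ** matpow R i) ** ?S l"
    by (simp add: matrix_mul_assoc[symmetric])
  then have "(W (m + l) - W m ** ?S l) ** matrix_inv (W l) =
      (\<Sum>i<l. F (m + i) ** matpow R i) ** (?S l ** matpow R l) ** matrix_inv (X l)"
    by (simp only: matrix_inv_eqI[OF WI] matrix_mul_assoc)
  then show "(W (m + l) - W m ** ?S l) ** matrix_inv (W l) =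
      (\<Sum>i<l. F (m + i) ** matpow R i) ** matrix_inv (X l)"
    by (simp add: SR)
qed

theorem mainTheorem13:
  fixes A :: "int \<Rightarrow> real^'n^'n"
    and P :: "'n \<Rightarrow> 'w measure"
    and X :: "real \<Rightarrow> 'w \<Rightarrow> (int \<times> 'n) option"
    and R :: "real^'n^'n"
  assumes MAP: "lattice_MAP A P X"
    and R: "minimal_nonneg_solution A R"
  shows "(\<forall>m i j. mean_local_time P X (int m) (int m + 1) i j < \<infinity>) \<and>
    (\<forall>k\<ge>1. \<forall>i j. mean_local_time P X 0 (int k) i j < \<infinity>) \<and>
    invertible (Phi P X 0) \<and>
    (\<forall>m\<ge>1. hit_exact_mat P X m = Phi P X m ** matrix_inv (Phi P X 0)) \<and>
    (\<forall>l\<ge>1. invertible (\<Sum>i<l. Phi P X i ** matpow R i)) \<and>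
    (\<forall>m\<ge>1. \<forall>l\<ge>1. hit_before_mat P X m (m + l) =
       (\<Sum>i<l. Phi P X (m + i) ** matpow R i) **
       matrix_inv (\<Sum>i<l. Phi P X i ** matpow R i)) \<and>
    (invertible (A (-1)) \<longrightarrow>
       invertible R \<and>
       (\<forall>l\<ge>1. invertible (scale_W P X R l)) \<and>
       (\<forall>m\<ge>1. \<forall>l\<ge>1. hit_before_mat P X m (m + l) =
          (scale_W P X R (m + l) - scale_W P X R m ** matpow (matrix_inv R) l) **
          matrix_inv (scale_W P X R l)))"
proof -
  interpret skipfree A
    by (rule skipfree.intro) (use MAP in \<open>simp add: lattice_MAP_def\<close>)
  have law: "ctmc (P i) (map_gen A) (Some (0, i)) X" for i
    using MAP by (simp add: lattice_MAP_def)
  have mean: "mean_local_time P X m c i j = green pk (below c) (origin i) (Some (m, j)) * ennreal (1 / q j)"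
    if "m < c" "0 < c" for m c i j
    by (rule mean_local_time_eq[OF law that])
  have mean_fin: "mean_local_time P X m c i j < \<infinity>" if "m < c" "0 < c" for m c i j
    using green_below_finite[OF that(1), of "origin i" j] by (simp add: mean[OF that] ennreal_mult_less_top)
  have mean_Lt: "enn2real (mean_local_time P X m c i j) = Lt c m $ i $ j" if "m < c" "0 < c" for m c i j
    using that by (simp add: mean green_eq_gr Lt_def ennreal_mult[symmetric])
  have R_eq: "R = Rs" by (rule minimal_solution_eq_Rs[OF R])
  have Phi: "Phi P X m = Lt (int m + 1) (int m)" for m
    by (simp add: Phi_def vec_eq_iff mean_Lt)
  have Xi: "Xi P X k = Lt (int k) 0" if "1 \<le> k" for k
    using that by (simp add: Xi_def vec_eq_iff mean_Lt)
  have Lt_Phi: "Lt (int (m + l)) (int m) = (\<Sum>i<l. Phi P X (m + i) ** matpow R i)" if "1 \<le> l" for m l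
    unfolding Phi R_eq by (rule Lt_sum[OF that])
  have Xi_Phi: "Xi P X l = (\<Sum>i<l. Phi P X i ** matpow R i)" if "1 \<le> l" for l
    using Lt_Phi[OF that, of 0] by (simp add: Xi[OF that])
  have Xi_inv: "invertible (Xi P X l)" if "1 \<le> l" for l
    unfolding Xi[OF that] by (rule Lt_invertible[OF that])
  have Phi0: "Phi P X 0 = Xi P X 1" by (simp add: Phi Xi)
  have exact: "Phi P X m = hit_exact_mat P X m ** Phi P X 0" if m: "1 \<le> m" for m
  proof -
    have "Lt (int m + int 1) (int m) = (if m = 0 then (\<chi> i j. if i = j then 1 / q j else 0) else 0)
        + hit_exact_mat P X m ** Lt (int 1) 0"
      by (rule Lt_first_entrance[OF below_Int_level _ _ hit_exact_eq[OF law m]])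
         (simp_all add: below_Un_level hit_exact_mat_def)
    then show ?thesis using m by (simp add: Phi)
  qed
  have before: "(\<Sum>i<l. Phi P X (m + i) ** matpow R i) = hit_before_mat P X m (m + l) ** Xi P X l"
    if m: "1 \<le> m" and l: "1 \<le> l" for m l
  proof -
    have "Lt (int m + int l) (int m) = (if m = 0 then (\<chi> i j. if i = j then 1 / q j else 0) else 0)
        + hit_before_mat P X m (m + l) ** Lt (int l) 0"
    proof (rule Lt_first_entrance[OF _ _ l hit_before_eq[OF law m]])
      show "(below (int (m + l)) - level (int m)) \<union> level (int m) = (below (int m + int l) :: (int \<times> 'n) option set)"
        using l by (auto simp: level_def)
    qed (use l in \<open>auto simp: hit_before_mat_def\<close>)
    then show ?thesis using m by (simp add: Lt_Phi[OF l, symmetric] Xi[OF l])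
  qed
  have before_eq: "hit_before_mat P X m (m + l) =
       (\<Sum>i<l. Phi P X (m + i) ** matpow R i) ** matrix_inv (Xi P X l)"
    if "1 \<le> m" "1 \<le> l" for m l
    by (rule eq_mult_matrix_inv[OF before[OF that] Xi_inv[OF that(2)]])
  have scale: "invertible R \<and> (\<forall>l\<ge>1. invertible (scale_W P X R l)) \<and>
       (\<forall>m\<ge>1. \<forall>l\<ge>1. hit_before_mat P X m (m + l) =
          (scale_W P X R (m + l) - scale_W P X R m ** matpow (matrix_inv R) l) **
          matrix_inv (scale_W P X R l))" if "invertible (A (-1))"
  proof (intro conjI allI impI)
    have "nonneg_solution A R"
      using R unfolding minimal_nonneg_solution_def by (rule conjunct1)
    then show R_inv: "invertible R"
      using that by (rule nonneg_solution_invertible)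
    fix l :: nat assume l: "1 \<le> l"
    show "invertible (scale_W P X R l)"
      unfolding scale_W_def
      using scale_function_quotient(1)[where F = "Phi P X" and X = "Xi P X" and m = 1, OF R_inv Xi_Phi Xi_inv[OF l] l]
      by simp
    fix m :: nat assume m: "1 \<le> m"
    have "(scale_W P X R (m + l) - scale_W P X R m ** matpow (matrix_inv R) l) ** matrix_inv (scale_W P X R l)
        = (\<Sum>i<l. Phi P X (m + i) ** matpow R i) ** matrix_inv (Xi P X l)"
      unfolding scale_W_def
      using scale_function_quotient(2)[where F = "Phi P X" and X = "Xi P X", OF R_inv Xi_Phi Xi_inv[OF l] l m]
      by simp
    then show "hit_before_mat P X m (m + l) =
          (scale_W P X R (m + l) - scale_W P X R m ** matpow (matrix_inv R) l) **
          matrix_inv (scale_W P X R l)"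
      by (simp only: before_eq[OF m l])
  qed
  have c1: "\<forall>m i j. mean_local_time P X (int m) (int m + 1) i j < \<infinity>"
    and c2: "\<forall>k\<ge>1. \<forall>i j. mean_local_time P X 0 (int k) i j < \<infinity>"
    by (intro allI impI mean_fin; simp)+
  have c3: "invertible (Phi P X 0)"
    unfolding Phi0 by (rule Xi_inv) simp
  have c4: "\<forall>m\<ge>1. hit_exact_mat P X m = Phi P X m ** matrix_inv (Phi P X 0)"
    by (intro allI impI eq_mult_matrix_inv[OF exact c3])
  have c5: "\<forall>l\<ge>1. invertible (\<Sum>i<l. Phi P X i ** matpow R i)"
    using Xi_inv by (simp only: Xi_Phi) simp
  have c6: "\<forall>m\<ge>1. \<forall>l\<ge>1. hit_before_mat P X m (m + l) =
       (\<Sum>i<l. Phi P X (m + i) ** matpow R i) ** matrix_inv (\<Sum>i<l. Phi P X i ** matpow R i)"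
  proof (intro allI impI)
    fix m l :: nat assume "1 \<le> m" and l: "1 \<le> l"
    then show "hit_before_mat P X m (m + l) =
       (\<Sum>i<l. Phi P X (m + i) ** matpow R i) ** matrix_inv (\<Sum>i<l. Phi P X i ** matpow R i)"
      unfolding Xi_Phi[OF l, symmetric] by (rule before_eq)
  qed
  show ?thesis
    by (rule conjI[OF c1 conjI[OF c2 conjI[OF c3 conjI[OF c4 conjI[OF c5 conjI[OF c6 impI[OF scale]]]]]]])
qed

end
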